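(* Let $(\Gamma,\mathrm d)$ be an $S$-compatible $N$-dimensional bicovariant first order differential calculus on a Hopf algebra $A$, with exterior algebra $\Gamma^\wedge$, and let $\mathcal C_\Gamma$ be its quantum Cartan algebra, with antipode $S$. Put $R_j=-S^{-1}(X_j)$. The map $\rho:\mathcal C_\Gamma\to\mathrm{End}(\Gamma^\wedge)$, $x\mapsto\rho_x$, defined on generators of $\mathcal C_\Gamma$ by $$\rho_{R_j}=L^R_j,\qquad \rho_{S^{-1}(f_{jk})}=L^R_{jk},\qquad \rho_{-S^{-1}(\xi_j)}=i^R_j,\qquad \rho_{S^{-1}(\delta)}=\mathrm d,$$ and extended as a $\mathbb Z_2$-graded algebra anti-homomorphism to the whole of $\mathcal C_\Gamma$, defines a right $\mathcal C_\Gamma$-Hopf module algebra structure on $\Gamma^\wedge$; that is, $\Gamma^\wedge$ is a right $\mathcal C_\Gamma$-module via $\rho$, and $\rho_x(\alpha\wedge\beta)=\rho_{x_{(1)}}(\alpha)\wedge\rho_{x_{(2)}}(\beta)$ (with the $\mathbb Z_2$-graded sign convention) and $\rho_x(1)=\varepsilon(x)1$ for all $x\in\mathcal C_\Gamma$, $\alpha,\beta\in\Gamma^\wedge$.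
   Context: Summation over repeated indices is understood; indices run in $\{1,\dots,N\}$; $\delta_{ij}$ is the Kronecker symbol, while $\delta$ without indices is an algebra generator. Calculus. $A$ is a unital complex Hopf algebra with invertible antipode, $H$ its dual Hopf algebra; antipodes are denoted $S$. $(\Gamma,\mathrm d)$ is a bicovariant first order differential calculus in the sense of Woronowicz: $\Gamma$ is an $A$-bimodule, $\mathrm d:A\to\Gamma$ is linear and satisfies the Leibniz rule, every element of $\Gamma$ is a sum $x_k\,\mathrm dy_k$, and there are a left coaction $\Delta_\Gamma:\Gamma\to A\otimes\Gamma$ and a right coaction ${}_\Gamma\Delta:\Gamma\to\Gamma\otimes A$ with $\Delta_\Gamma(x\,\mathrm dy)=\Delta(x)(\mathrm{id}\otimes\mathrm d)\Delta(y)$ and ${}_\Gamma\Delta(x\,\mathrm dy)=\Delta(x)(\mathrm d\otimes\mathrm{id})\Delta(y)$. Its dimension $N$ (the dimension of the space ${}_{inv}\Gamma$ of left-invariant elements, $\Delta_\Gamma(\omega)=1\otimes\omega$) is finite. Fix a basis $\omega_1,\dots,\omega_N$ of ${}_{inv}\Gamma$; it is a free $A$-module basis of $\Gamma$. For $f\in H$, $x\in A$ put $f\triangleright x=x_{(1)}f(x_{(2)})$. There are $f_{ij}\in H$ and $J_{ij}\in A$ with $\omega_ix=(f_{ij}\triangleright x)\omega_j$ for $x\in A$ and ${}_\Gamma\Delta(\omega_i)=\omega_j\otimes J_{ji}$. The elements $\eta_j=\omega_iS(J_{ij})$ form a basis of the right-invariant elements (${}_\Gamma\Delta(\eta)=\eta\otimes1$).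 The quantum tangent space is $\mathcal T=\{X\in A':X(1)=0,\ X|_{R_\Gamma}=0\}\subset H$, where $R_\Gamma\subset\ker\varepsilon$ is the right ideal characterizing the calculus; $\{X_i\}$ is the basis of $\mathcal T$ dual to $\{\omega_i\}$ under the pairing $\{X,x\,\mathrm dy\}=\varepsilon(x)X(y)$, so $\mathrm dx=(X_i\triangleright x)\omega_i$. Set $\sigma^{kl}_{ij}=f_{il}(J_{kj})$, the components of the Woronowicz braiding, i.e. the $A$-bimodule map $\sigma$ on $\Gamma\otimes_A\Gamma$ with $\sigma(\omega_i\otimes\omega_j)=\sigma_{ij}^{kl}\omega_k\otimes\omega_l$, and $C_{ij}^k=X_j(J_{ik})$. Let $\sigma^t$ be the transposed map on $\mathcal T\otimes\mathcal T$, $\sigma^t(X_i\otimes X_j)=\sigma^{ij}_{kl}X_k\otimes X_l$, and let $t^{ij}_{kl}\in\mathbb C$, with $t^{ij}_{ij}=0$ (no sum), be such that $\ker(\mathrm{id}-\sigma^t)$ is spanned by the elements $X_i\otimes X_j+t^{ij}_{kl}X_k\otimes X_l$. $\mathcal E_\Gamma\subset H$ denotes the unital subalgebra generated by the elements $X_i,f_{jk}$. It is a sub-bialgebra of $H$ in which the relations $$X_iX_j-\sigma^{ij}_{kl}X_kX_l=C^k_{ij}X_k,\qquad \sigma^{ij}_{nm}f_{ip}f_{jq}=f_{ni}f_{mj}\sigma^{pq}_{ij},$$ $$C^i_{mn}f_{mj}f_{nk}+f_{ij}X_k=\sigma^{jk}_{pq}X_pf_{iq}+C^l_{jk}f_{il},\qquad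 X_kf_{nl}=\sigma^{kl}_{ij}f_{ni}X_j$$ hold. The calculus is called $S$-compatible if the antipode $S$ of $H$ satisfies $S(f_{ij})\in\mathcal E_\Gamma$ for all $i,j$. Quantum Cartan algebra. $\mathcal C_\Gamma$ is the unital $\mathbb Z_2$-graded algebra over $\mathbb C$ extending $\mathcal E_\Gamma$: it is generated by the algebra $\mathcal E_\Gamma$ (in even degree, with the relations holding in $\mathcal E_\Gamma$) and odd elements $\xi_i,\delta$, subject to $$\xi_i\xi_j+t^{ij}_{kl}\xi_k\xi_l=0,\quad \xi_i\delta+\delta\xi_i=X_i,\quad \delta\delta=0,\quad \xi_if_{kj}-\sigma^{ij}_{nm}f_{kn}\xi_m=0,$$ $$\xi_iX_j-\sigma^{ij}_{kl}X_k\xi_l=C^k_{ij}\xi_k,\quad f_{ij}\delta-\delta f_{ij}=0,\quad X_i\delta-\delta X_i=0.$$ It is a $\mathbb Z_2$-graded Hopf algebra with invertible antipode: $\triangle(X_i)=1\otimes X_i+X_j\otimes f_{ji}$, $\triangle(f_{ij})=f_{ik}\otimes f_{kj}$, $\triangle(\xi_i)=1\otimes\xi_i+\xi_j\otimes f_{ji}$, $\triangle(\delta)=1\otimes\delta+\delta\otimes1$, $\varepsilon(X_i)=\varepsilon(\xi_i)=\varepsilon(\delta)=0$, $\varepsilon(f_{ij})=\delta_{ij}$; the antipode $S$ of $\mathcal C_\Gamma$ restricts on $\mathcal E_\Gamma$ to that of $H$ and $S(X_i)=-X_jS(f_{ji})$, $S(\xi_i)=-\xi_jS(f_{ji})$,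 $S(\delta)=-\delta$; its inverse satisfies $S^{-1}(X_i)=-S^{-1}(f_{ji})X_j$, $S^{-1}(\xi_i)=-S^{-1}(f_{ji})\xi_j$. A $\mathbb Z_2$-graded anti-homomorphism satisfies $\rho_{xy}=(-1)^{|x||y|}\rho_y\rho_x$. Graded sign convention for module algebras: $\rho_x(\alpha\wedge\beta)=(-1)^{|x_{(2)}||\alpha|}\rho_{x_{(1)}}(\alpha)\wedge\rho_{x_{(2)}}(\beta)$. Exterior algebra and operators. $\Gamma^\wedge=\Gamma^{\otimes}/\langle\ker(\mathrm{id}-\sigma)\rangle$, the quotient of the tensor algebra of $\Gamma$ over $A$ by the two-sided ideal generated by $\ker(\mathrm{id}-\sigma)\subset\Gamma\otimes_A\Gamma$; $\mathrm d$ extends uniquely to a degree one graded derivation of $\Gamma^\wedge$ with $\mathrm d^2=0$. $\Gamma^\wedge$ carries left and right $A$-coactions given recursively by $\Delta_\Gamma(x\,\mathrm d\alpha)=\Delta(x)(\mathrm{id}\otimes\mathrm d)\Delta_\Gamma(\alpha)$, ${}_\Gamma\Delta(x\,\mathrm d\alpha)=\Delta(x)(\mathrm d\otimes\mathrm{id})\,{}_\Gamma\Delta(\alpha)$. For $h\in H$, $\alpha\in\Gamma^\wedge$ put $\alpha\triangleleft h=(h\otimes\mathrm{id})\Delta_\Gamma(\alpha)$. The degree $0$ operators are $L^R_i(\alpha)=\alpha\triangleleft R_i$, with $R_i=-S^{-1}(X_i)$, and $L^R_{ij}(\alpha)=\alpha\triangleleft S^{-1}(f_{ij})$. The right inner derivative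 $i^R_j$ is the degree $-1$ operator on $\Gamma^\wedge$ (zero on $A$) with $i^R_j(\eta_i)=\delta_{ij}$ and $i^R_j(\alpha\wedge\beta)=i^R_j(\alpha)\wedge\beta+(-1)^{|\alpha|}L^R_{kj}(\alpha)\wedge i^R_k(\beta)$ for all $\alpha,\beta\in\Gamma^\wedge$. *)

theory Defs
  imports Complex_Main "HOL-Library.Poly_Mapping" "HOL-Library.Function_Algebras"
begin

section \<open>Complex vector spaces and algebras\<close>

class scaleC =
  fixes scaleC :: "complex \<Rightarrow> 'a \<Rightarrow> 'a" (infixr \<open>*\<^sub>C\<close> 75)

class complex_vector = scaleC + ab_group_add +
  assumes scaleC_add_right: "a *\<^sub>C (x + y) = a *\<^sub>C x + a *\<^sub>C y"
    and scaleC_add_left: "(a + b) *\<^sub>C x = a *\<^sub>C x + b *\<^sub>C x"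
    and scaleC_scaleC: "a *\<^sub>C (b *\<^sub>C x) = (a * b) *\<^sub>C x"
    and scaleC_one: "1 *\<^sub>C x = x"

class complex_algebra_1 = complex_vector + ring_1 +
  assumes mult_scaleC_left: "(a *\<^sub>C x) * y = a *\<^sub>C (x * y)"
    and mult_scaleC_right: "x * (a *\<^sub>C y) = a *\<^sub>C (x * y)"

instantiation complex :: complex_algebra_1
begin
definition scaleC_complex_def [simp]: "scaleC a (x::complex) = a * x"
instance by standard (simp_all add: algebra_simps)
end

instantiation "fun" :: (type, complex_vector) complex_vector
begin
definition scaleC_fun_def: "scaleC a f = (\<lambda>x. a *\<^sub>C f x)"
instance
  by standard
    (simp_all add: scaleC_fun_def fun_eq_iff scaleC_add_right scaleC_add_left scaleC_scaleC scaleC_one)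
end

global_interpretation complex_vector:
  vector_space "scaleC :: complex \<Rightarrow> 'a \<Rightarrow> 'a::complex_vector"
  by unfold_locales (simp_all add: scaleC_add_right scaleC_add_left scaleC_scaleC scaleC_one)

global_interpretation complex_vector_pair:
  vector_space_pair "scaleC :: complex \<Rightarrow> 'a \<Rightarrow> 'a::complex_vector"
    "scaleC :: complex \<Rightarrow> 'b \<Rightarrow> 'b::complex_vector"
  by unfold_locales

abbreviation cspan :: "'a::complex_vector set \<Rightarrow> 'a set"
  where "cspan \<equiv> module.span scaleC"

abbreviation cindependent :: "'a::complex_vector set \<Rightarrow> bool"
  where "cindependent S \<equiv> \<not> module.dependent scaleC S"

abbreviation clinear :: "('a::complex_vector \<Rightarrow> 'b::complex_vector) \<Rightarrow> bool"
  where "clinear \<equiv> Vector_Spaces.linear scaleC scaleC"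

definition cbilinear :: "('a::complex_vector \<Rightarrow> 'b::complex_vector \<Rightarrow> 'c::complex_vector) \<Rightarrow> bool"
  where "cbilinear f \<longleftrightarrow> (\<forall>x. clinear (f x)) \<and> (\<forall>y. clinear (\<lambda>x. f x y))"

definition is_basis :: "(nat \<Rightarrow> 'a::complex_vector) \<Rightarrow> nat \<Rightarrow> 'a set \<Rightarrow> bool"
  where "is_basis b N V \<longleftrightarrow>
    inj_on b {1..N} \<and> cindependent (b ` {1..N}) \<and> cspan (b ` {1..N}) = V"

definition algebra_hom :: "('a::complex_algebra_1 \<Rightarrow> 'b::complex_algebra_1) \<Rightarrow> bool"
  where "algebra_hom h \<longleftrightarrow> clinear h \<and> h 1 = 1 \<and> (\<forall>x y. h (x * y) = h x * h y)"


section \<open>The algebraic tensor product over the complex numbers\<close>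

text \<open>A list of pairs stands for the sum of the corresponding elementary tensors.\<close>

inductive tensor_eq ::
  "('a::complex_vector \<times> 'b::complex_vector) list \<Rightarrow> ('a \<times> 'b) list \<Rightarrow> bool"
where
  refl: "tensor_eq u u"
| sym: "tensor_eq u v \<Longrightarrow> tensor_eq v u"
| trans: "tensor_eq u v \<Longrightarrow> tensor_eq v w \<Longrightarrow> tensor_eq u w"
| append: "tensor_eq u u' \<Longrightarrow> tensor_eq v v' \<Longrightarrow> tensor_eq (u @ v) (u' @ v')"
| commute: "tensor_eq (u @ v) (v @ u)"
| add_left: "tensor_eq [(x + x', y)] [(x, y), (x', y)]"
| add_right: "tensor_eq [(x, y + y')] [(x, y), (x, y')]"
| scale: "tensor_eq [(c *\<^sub>C x, y)] [(x, c *\<^sub>C y)]"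
| zero: "tensor_eq [(0, y)] []"

quotient_type (overloaded) ('a, 'b) tensor (infixr \<open>\<otimes>\<close> 60) =
  "('a::complex_vector \<times> 'b::complex_vector) list" / tensor_eq
  by (rule equivpI) (auto intro: reflpI sympI transpI tensor_eq.intros(1-3))

lemma tensor_eq_map:
  assumes "tensor_eq u v" and "clinear g"
  shows "tensor_eq (map (\<lambda>(x, y). (g x, y)) u) (map (\<lambda>(x, y). (g x, y)) v)"
proof -
  interpret Vector_Spaces.linear scaleC scaleC g by (rule assms(2))
  from assms(1) show ?thesis
    by (induction rule: tensor_eq.induct)
      (auto simp: add scale intro: tensor_eq.intros)
qed

lemma clinear_scaleC: "clinear (scaleC c :: 'a::complex_vector \<Rightarrow> 'a)"
  by unfold_locales (simp_all add: scaleC_add_right scaleC_scaleC mult.commute)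

lemma clinear_uminus: "clinear (uminus :: 'a::complex_vector \<Rightarrow> 'a)"
  by unfold_locales simp_all

instantiation tensor :: (complex_vector, complex_vector) complex_vector
begin

lift_definition zero_tensor :: "('a, 'b) tensor" is "[]" .

lift_definition plus_tensor :: "('a, 'b) tensor \<Rightarrow> ('a, 'b) tensor \<Rightarrow> ('a, 'b) tensor" is append
  by (rule tensor_eq.append)

lift_definition uminus_tensor :: "('a, 'b) tensor \<Rightarrow> ('a, 'b) tensor"
  is "map (\<lambda>(x, y). (- x, y))"
  by (rule tensor_eq_map[OF _ clinear_uminus])

lift_definition scaleC_tensor :: "complex \<Rightarrow> ('a, 'b) tensor \<Rightarrow> ('a, 'b) tensor"
  is "\<lambda>c. map (\<lambda>(x, y). (c *\<^sub>C x, y))"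
  by (rule tensor_eq_map[OF _ clinear_scaleC])

definition minus_tensor :: "('a, 'b) tensor \<Rightarrow> ('a, 'b) tensor \<Rightarrow> ('a, 'b) tensor"
  where "minus_tensor s t = s + (- t)"

lemma tensor_eq_shuffle:
  assumes "tensor_eq [p] [q, r]" and "tensor_eq u (v @ w)"
  shows "tensor_eq (p # u) (q # v @ r # w)"
proof -
  have "tensor_eq (p # u) ([q, r] @ (v @ w))"
    using tensor_eq.append[OF assms] by simp
  moreover have "tensor_eq ([q] @ ([r] @ v) @ w) ([q] @ (v @ [r]) @ w)"
    by (intro tensor_eq.append tensor_eq.refl tensor_eq.commute)
  ultimately show ?thesis
    by (auto intro: tensor_eq.trans)
qed

instance
proof
  fix a b c :: "('a, 'b) tensor" and k l :: complex
  show "a + b + c = a + (b + c)"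
    by transfer (simp add: tensor_eq.refl)
  show "a + b = b + a"
    by transfer (rule tensor_eq.commute)
  show "0 + a = a"
    by transfer (simp add: tensor_eq.refl)
  show "- a + a = 0"
  proof transfer
    fix u :: "('a \<times> 'b) list"
    show "tensor_eq (map (\<lambda>(x, y). (- x, y)) u @ u) []"
    proof (induction u)
      case (Cons p u)
      obtain x y where p: "p = (x, y)" by fastforce
      let ?m = "map (\<lambda>(x, y). (- x, y)) u"
      have "tensor_eq ((0, y) # ?m @ u) ((- x, y) # ?m @ (x, y) # u)"
        using tensor_eq_shuffle[of "(0, y)" "(- x, y)" "(x, y)" "?m @ u" ?m u]
          tensor_eq.add_left[of "- x" x y] by (simp add: tensor_eq.refl)
      moreover have "tensor_eq ([(0, y)] @ (?m @ u)) ([] @ [])"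
        by (rule tensor_eq.append[OF tensor_eq.zero Cons.IH])
      ultimately show ?case
        by (auto simp: p intro: tensor_eq.trans tensor_eq.sym)
    qed (simp add: tensor_eq.refl)
  qed
  show "a - b = a + - b"
    by (simp add: minus_tensor_def)
  show "k *\<^sub>C (a + b) = k *\<^sub>C a + k *\<^sub>C b"
    by transfer (simp add: tensor_eq.refl)
  show "(k + l) *\<^sub>C a = k *\<^sub>C a + l *\<^sub>C a"
  proof transfer
    fix k l and u :: "('a \<times> 'b) list"
    show "tensor_eq (map (\<lambda>(x, y). ((k + l) *\<^sub>C x, y)) u)
      (map (\<lambda>(x, y). (k *\<^sub>C x, y)) u @ map (\<lambda>(x, y). (l *\<^sub>C x, y)) u)"
    proof (induction u)
      case (Cons p u)
      then show ?case
        by (auto simp: scaleC_add_left split: prod.split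
            intro!: tensor_eq_shuffle tensor_eq.add_left)
    qed (simp add: tensor_eq.refl)
  qed
  show "k *\<^sub>C (l *\<^sub>C a) = (k * l) *\<^sub>C a"
    by transfer (simp add: scaleC_scaleC comp_def case_prod_unfold tensor_eq.refl)
  show "1 *\<^sub>C a = a"
    by transfer (simp add: scaleC_one case_prod_beta tensor_eq.refl)
qed

end

lift_definition elementary_tensor ::
  "'a::complex_vector \<Rightarrow> 'b::complex_vector \<Rightarrow> ('a, 'b) tensor" (infixr \<open>\<otimes>\<close> 72)
  is "\<lambda>x y. [(x, y)]" .

text \<open>
  The linear map on the tensor product induced by a bilinear map \<open>f\<close>. For bilinear \<open>f\<close> the choice
  of the representing list is immaterial (lemma \<open>tensor_lift\<close>); with a Sweedler sum
  \<open>\<Delta> x = x\<^sub>(\<^sub>1\<^sub>) \<otimes> x\<^sub>(\<^sub>2\<^sub>)\<close>, the term \<open>tensor_lift f (\<Delta> x)\<close> is \<open>f x\<^sub>(\<^sub>1\<^sub>) x\<^sub>(\<^sub>2\<^sub>)\<close>.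
\<close>

definition tensor_lift ::
  "('a::complex_vector \<Rightarrow> 'b::complex_vector \<Rightarrow> 'c::complex_vector) \<Rightarrow> ('a, 'b) tensor \<Rightarrow> 'c"
  where "tensor_lift f t = (\<Sum>(x, y)\<leftarrow>rep_tensor t. f x y)"

lemma tensor_eq_sum:
  assumes "tensor_eq u v" and "cbilinear f"
  shows "(\<Sum>(x, y)\<leftarrow>u. f x y) = (\<Sum>(x, y)\<leftarrow>v. f x y)"
proof -
  have r: "Vector_Spaces.linear scaleC scaleC (f x)" for x
    using assms(2) by (simp add: cbilinear_def)
  have l: "Vector_Spaces.linear scaleC scaleC (\<lambda>x. f x y)" for y
    using assms(2) by (simp add: cbilinear_def)
  show ?thesis
    using assms(1)
    by (induction rule: tensor_eq.induct)
      (simp_all add: complex_vector_pair.linear_add[OF r] complex_vector_pair.linear_add[OF l]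
        complex_vector_pair.linear_scale[OF r] complex_vector_pair.linear_scale[OF l]
        complex_vector_pair.linear_0[OF l] add.commute)
qed

lemma tensor_lift:
  assumes "cbilinear f"
  shows "tensor_lift f (x \<otimes> y) = f x y" and "clinear (tensor_lift f)"
proof -
  have abs: "tensor_lift f (abs_tensor u) = (\<Sum>(x, y)\<leftarrow>u. f x y)" for u
    unfolding tensor_lift_def
    by (rule tensor_eq_sum[OF _ assms]) (rule Quotient_rep_abs[OF Quotient_tensor tensor_eq.refl])
  show "tensor_lift f (x \<otimes> y) = f x y"
    by (simp add: elementary_tensor.abs_eq abs)
  have "Vector_Spaces.linear scaleC scaleC (\<lambda>x. f x y)" for y
    using assms by (simp add: cbilinear_def)
  then have s: "f (c *\<^sub>C x) y = c *\<^sub>C f x y" for c x y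
    by (rule complex_vector_pair.linear_scale)
  show "clinear (tensor_lift f)"
  proof unfold_locales
    fix s t :: "('a, 'b) tensor" and c
    obtain u v where uv: "s = abs_tensor u" "t = abs_tensor v"
      by (metis Quotient_abs_rep[OF Quotient_tensor])
    show "tensor_lift f (s + t) = tensor_lift f s + tensor_lift f t"
      by (simp add: uv plus_tensor.abs_eq abs)
    have "(\<Sum>(x, y)\<leftarrow>map (\<lambda>(x, y). (c *\<^sub>C x, y)) u. f x y) = c *\<^sub>C (\<Sum>(x, y)\<leftarrow>u. f x y)"
      by (induction u) (auto simp: s scaleC_add_right)
    then show "tensor_lift f (c *\<^sub>C s) = c *\<^sub>C tensor_lift f s"
      by (simp add: uv scaleC_tensor.abs_eq abs)
  qed
qed

definition tensor_map ::
  "('a::complex_vector \<Rightarrow> 'c::complex_vector) \<Rightarrow> ('b::complex_vector \<Rightarrow> 'd::complex_vector) \<Rightarrow>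
    ('a, 'b) tensor \<Rightarrow> ('c, 'd) tensor"
  where "tensor_map f g = tensor_lift (\<lambda>x y. f x \<otimes> g y)"

definition tensor_assoc ::
  "(('a::complex_vector, 'b::complex_vector) tensor, 'c::complex_vector) tensor \<Rightarrow>
    ('a, ('b, 'c) tensor) tensor"
  where "tensor_assoc = tensor_lift (\<lambda>s z. tensor_lift (\<lambda>x y. x \<otimes> (y \<otimes> z)) s)"

text \<open>\<open>(x \<otimes> y) \<cdot> (x' \<otimes> y') = m x x' \<otimes> m' y y'\<close>\<close>

definition tensor_act ::
  "('a::complex_vector \<Rightarrow> 'c::complex_vector \<Rightarrow> 'e::complex_vector) \<Rightarrow>
   ('b::complex_vector \<Rightarrow> 'd::complex_vector \<Rightarrow> 'f::complex_vector) \<Rightarrow>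
    ('a, 'b) tensor \<Rightarrow> ('c, 'd) tensor \<Rightarrow> ('e, 'f) tensor"
  where "tensor_act m m' s t =
    tensor_lift (\<lambda>x y. tensor_lift (\<lambda>x' y'. m x x' \<otimes> m' y y') t) s"


section \<open>Hopf algebras\<close>

record (overloaded) 'a hopf_struct =
  comul :: "'a \<Rightarrow> ('a, 'a) tensor"
  counit :: "'a \<Rightarrow> complex"
  antipode :: "'a \<Rightarrow> 'a"

text \<open>
  The argument \<open>m\<close> is the multiplication of the tensor square, so that ungraded and
  \<open>\<int>\<^sub>2\<close>-graded Hopf algebras are covered at once.
\<close>

definition hopf_axioms ::
  "(('a, 'a) tensor \<Rightarrow> ('a, 'a) tensor \<Rightarrow> ('a, 'a) tensor) \<Rightarrow> 'a::complex_algebra_1 hopf_struct \<Rightarrow> bool"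
  where "hopf_axioms m A \<longleftrightarrow>
    clinear (comul A) \<and> clinear (counit A) \<and> clinear (antipode A) \<and>
    (\<forall>x. tensor_assoc (tensor_map (comul A) id (comul A x)) = tensor_map id (comul A) (comul A x)) \<and>
    (\<forall>x. tensor_lift (\<lambda>y z. counit A y *\<^sub>C z) (comul A x) = x) \<and>
    (\<forall>x. tensor_lift (\<lambda>y z. counit A z *\<^sub>C y) (comul A x) = x) \<and>
    comul A 1 = 1 \<otimes> 1 \<and> (\<forall>x y. comul A (x * y) = m (comul A x) (comul A y)) \<and>
    counit A 1 = 1 \<and> (\<forall>x y. counit A (x * y) = counit A x * counit A y) \<and>
    (\<forall>x. tensor_lift (\<lambda>y z. antipode A y * z) (comul A x) = counit A x *\<^sub>C 1) \<and>
    (\<forall>x. tensor_lift (\<lambda>y z. y * antipode A z) (comul A x) = counit A x *\<^sub>C 1)"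

definition hopf_algebra :: "'a::complex_algebra_1 hopf_struct \<Rightarrow> bool"
  where "hopf_algebra A \<longleftrightarrow> hopf_axioms (tensor_act (*) (*)) A"

text \<open>A \<open>\<int>\<^sub>2\<close>-grading is a family \<open>D\<close> of which only \<open>D 0\<close> (even) and \<open>D 1\<close> (odd) matter.\<close>

definition z2_grading :: "(nat \<Rightarrow> 'a::complex_vector set) \<Rightarrow> bool"
  where "z2_grading D \<longleftrightarrow> (\<forall>p<2. module.subspace scaleC (D p)) \<and>
    (\<forall>x. \<exists>!y. y \<in> D 0 \<and> x - y \<in> D 1)"

definition z2_graded_algebra :: "(nat \<Rightarrow> 'a::complex_algebra_1 set) \<Rightarrow> bool"
  where "z2_graded_algebra D \<longleftrightarrow> z2_grading D \<and> 1 \<in> D 0 \<and>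
    (\<forall>p<2. \<forall>q<2. \<forall>x\<in>D p. \<forall>y\<in>D q. x * y \<in> D ((p + q) mod 2))"

definition z2_part :: "(nat \<Rightarrow> 'a::complex_vector set) \<Rightarrow> nat \<Rightarrow> 'a \<Rightarrow> 'a"
  where "z2_part D p x = (THE y. y \<in> D p \<and> x - y \<in> D (1 - p))"

text \<open>
  \<open>(x \<otimes> y) \<cdot> (x' \<otimes> y') = (-1)\<^bsup>|y||x'|\<^esup> xx' \<otimes> yy'\<close>, spelled out on the homogeneous parts of
  \<open>y\<close> and \<open>x'\<close>
\<close>

definition graded_tensor_mult ::
  "(nat \<Rightarrow> 'a::complex_algebra_1 set) \<Rightarrow> ('a, 'a) tensor \<Rightarrow> ('a, 'a) tensor \<Rightarrow> ('a, 'a) tensor"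
  where "graded_tensor_mult D s t =
    tensor_lift (\<lambda>x y. tensor_lift (\<lambda>x' y'. \<Sum>p<2. \<Sum>q<2.
      (-1) ^ (p * q) *\<^sub>C ((x * z2_part D q x') \<otimes> (z2_part D p y * y'))) t) s"

definition graded_hopf_algebra ::
  "(nat \<Rightarrow> 'a::complex_algebra_1 set) \<Rightarrow> 'a hopf_struct \<Rightarrow> bool"
  where "graded_hopf_algebra D A \<longleftrightarrow>
    z2_graded_algebra D \<and> hopf_axioms (graded_tensor_mult D) A \<and>
    (\<forall>p<2. \<forall>x\<in>D p. comul A x \<in>
      cspan {y \<otimes> z |y z q r. q < 2 \<and> r < 2 \<and> (q + r) mod 2 = p \<and> y \<in> D q \<and> z \<in> D r}) \<and>
    (\<forall>x\<in>D 1. counit A x = 0) \<and>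
    (\<forall>p<2. \<forall>x\<in>D p. antipode A x \<in> D p)"

subsection \<open>The dual Hopf algebra\<close>

text \<open>
  The functionals \<open>f\<close> whose coproduct \<open>f(xy) = f\<^sub>(\<^sub>1\<^sub>)(x) f\<^sub>(\<^sub>2\<^sub>)(y)\<close> is a finite sum of products of
  functionals.
\<close>

definition hopf_dual :: "('a::complex_algebra_1 \<Rightarrow> complex) set"
  where "hopf_dual = {f. clinear f \<and>
    (\<exists>n g h. (\<forall>k<n. clinear (g k) \<and> clinear (h k)) \<and>
      (\<forall>x y. f (x * y) = (\<Sum>k<(n::nat). g k x * h k y)))}"

text \<open>
  The product of the dual. (The pointwise product of functions is never used on functionals;
  the unit of the dual is \<open>counit A\<close>.)
\<close>

definition conv ::
  "'a::complex_algebra_1 hopf_struct \<Rightarrow> ('a \<Rightarrow> complex) \<Rightarrow> ('a \<Rightarrow> complex) \<Rightarrow> 'a \<Rightarrow> complex"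
  where "conv A f g x = tensor_lift (\<lambda>y z. f y * g z) (comul A x)"

definition dual_antipode :: "'a::complex_algebra_1 hopf_struct \<Rightarrow> ('a \<Rightarrow> complex) \<Rightarrow> 'a \<Rightarrow> complex"
  where "dual_antipode A f = f \<circ> antipode A"

definition dual_antipode_inv ::
  "'a::complex_algebra_1 hopf_struct \<Rightarrow> ('a \<Rightarrow> complex) \<Rightarrow> 'a \<Rightarrow> complex"
  where "dual_antipode_inv A f = f \<circ> inv (antipode A)"

definition left_act ::
  "'a::complex_algebra_1 hopf_struct \<Rightarrow> ('a \<Rightarrow> complex) \<Rightarrow> 'a \<Rightarrow> 'a"
  where "left_act A f x = tensor_lift (\<lambda>y z. f z *\<^sub>C y) (comul A x)"


section \<open>Bicovariant first order differential calculi\<close>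

record (overloaded) ('a, 'g) calculus_struct =
  lmult :: "'a \<Rightarrow> 'g \<Rightarrow> 'g"
  rmult :: "'g \<Rightarrow> 'a \<Rightarrow> 'g"
  diff :: "'a \<Rightarrow> 'g"
  lcoact :: "'g \<Rightarrow> ('a, 'g) tensor"
  rcoact :: "'g \<Rightarrow> ('g, 'a) tensor"

definition bimodule :: "('a::complex_algebra_1 \<Rightarrow> 'g::complex_vector \<Rightarrow> 'g) \<Rightarrow> ('g \<Rightarrow> 'a \<Rightarrow> 'g) \<Rightarrow> bool"
  where "bimodule l r \<longleftrightarrow> cbilinear l \<and> cbilinear r \<and>
    (\<forall>\<gamma>. l 1 \<gamma> = \<gamma> \<and> r \<gamma> 1 = \<gamma>) \<and>
    (\<forall>x y \<gamma>. l (x * y) \<gamma> = l x (l y \<gamma>) \<and> r \<gamma> (x * y) = r (r \<gamma> x) y \<and> l x (r \<gamma> y) = r (l x \<gamma>) y)"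

definition left_comodule ::
  "'a::complex_algebra_1 hopf_struct \<Rightarrow> ('g::complex_vector \<Rightarrow> ('a, 'g) tensor) \<Rightarrow> bool"
  where "left_comodule A \<delta> \<longleftrightarrow> clinear \<delta> \<and>
    (\<forall>\<gamma>. tensor_assoc (tensor_map (comul A) id (\<delta> \<gamma>)) = tensor_map id \<delta> (\<delta> \<gamma>)) \<and>
    (\<forall>\<gamma>. tensor_lift (\<lambda>x \<beta>. counit A x *\<^sub>C \<beta>) (\<delta> \<gamma>) = \<gamma>)"

definition right_comodule ::
  "'a::complex_algebra_1 hopf_struct \<Rightarrow> ('g::complex_vector \<Rightarrow> ('g, 'a) tensor) \<Rightarrow> bool"
  where "right_comodule A \<delta> \<longleftrightarrow> clinear \<delta> \<and>
    (\<forall>\<gamma>. tensor_assoc (tensor_map \<delta> id (\<delta> \<gamma>)) = tensor_map id (comul A) (\<delta> \<gamma>)) \<and>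
    (\<forall>\<gamma>. tensor_lift (\<lambda>\<beta> x. counit A x *\<^sub>C \<beta>) (\<delta> \<gamma>) = \<gamma>)"

definition bicovariant_calculus ::
  "'a::complex_algebra_1 hopf_struct \<Rightarrow> ('a, 'g::complex_vector) calculus_struct \<Rightarrow> bool"
  where "bicovariant_calculus A G \<longleftrightarrow>
    bimodule (lmult G) (rmult G) \<and>
    clinear (diff G) \<and>
    (\<forall>x y. diff G (x * y) = rmult G (diff G x) y + lmult G x (diff G y)) \<and>
    (\<forall>\<gamma>. \<exists>n x y. \<gamma> = (\<Sum>k<(n::nat). lmult G (x k) (diff G (y k)))) \<and>
    left_comodule A (lcoact G) \<and> right_comodule A (rcoact G) \<and>
    (\<forall>x y. lcoact G (lmult G x (diff G y)) =
      tensor_act (*) (lmult G) (comul A x) (tensor_map id (diff G) (comul A y))) \<and>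
    (\<forall>x y. rcoact G (lmult G x (diff G y)) =
      tensor_act (lmult G) (*) (comul A x) (tensor_map (diff G) id (comul A y)))"

definition left_invariant :: "('a::complex_algebra_1, 'g::complex_vector) calculus_struct \<Rightarrow> 'g set"
  where "left_invariant G = {\<gamma>. lcoact G \<gamma> = 1 \<otimes> \<gamma>}"

text \<open>Woronowicz's right ideal \<open>R\<^sub>\<Gamma> = {x \<in> ker \<epsilon>. S(x\<^sub>(\<^sub>1\<^sub>)) dx\<^sub>(\<^sub>2\<^sub>) = 0}\<close>\<close>

definition calculus_ideal ::
  "'a::complex_algebra_1 hopf_struct \<Rightarrow> ('a, 'g::complex_vector) calculus_struct \<Rightarrow> 'a set"
  where "calculus_ideal A G = {x. counit A x = 0 \<and>
    tensor_lift (\<lambda>y z. lmult G (antipode A y) (diff G z)) (comul A x) = 0}"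

definition tangent_space ::
  "'a::complex_algebra_1 hopf_struct \<Rightarrow> ('a, 'g::complex_vector) calculus_struct \<Rightarrow> ('a \<Rightarrow> complex) set"
  where "tangent_space A G = {X. clinear X \<and> X 1 = 0 \<and> (\<forall>x\<in>calculus_ideal A G. X x = 0)}"

text \<open>\<open>{X, x dy} = \<epsilon>(x) X(y)\<close>; the functional exists and is unique for \<open>X\<close> in the tangent space.\<close>

definition tangent_pairing ::
  "'a::complex_algebra_1 hopf_struct \<Rightarrow> ('a, 'g::complex_vector) calculus_struct \<Rightarrow>
    ('a \<Rightarrow> complex) \<Rightarrow> 'g \<Rightarrow> complex"
  where "tangent_pairing A G X =
    (THE \<phi>. clinear \<phi> \<and> (\<forall>x y. \<phi> (lmult G x (diff G y)) = counit A x * X y))"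

text \<open>\<open>\<sigma>\<^sup>k\<^sup>l\<^sub>i\<^sub>j = f\<^sub>i\<^sub>l(J\<^sub>k\<^sub>j)\<close>, upper indices first\<close>

definition braid_coeff ::
  "(nat \<Rightarrow> nat \<Rightarrow> 'a \<Rightarrow> complex) \<Rightarrow> (nat \<Rightarrow> nat \<Rightarrow> 'a) \<Rightarrow> nat \<Rightarrow> nat \<Rightarrow> nat \<Rightarrow> nat \<Rightarrow> complex"
  where "braid_coeff f J k l i j = f i l (J k j)"

text \<open>\<open>C\<^sub>i\<^sub>j\<^sup>k = X\<^sub>j(J\<^sub>i\<^sub>k)\<close>\<close>

definition struct_coeff ::
  "(nat \<Rightarrow> 'a \<Rightarrow> complex) \<Rightarrow> (nat \<Rightarrow> nat \<Rightarrow> 'a) \<Rightarrow> nat \<Rightarrow> nat \<Rightarrow> nat \<Rightarrow> complex"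
  where "struct_coeff X J i j k = X j (J i k)"

text \<open>\<open>\<eta>\<^sub>j = \<omega>\<^sub>i S(J\<^sub>i\<^sub>j)\<close>\<close>

definition right_form ::
  "'a::complex_algebra_1 hopf_struct \<Rightarrow> ('a, 'g::complex_vector) calculus_struct \<Rightarrow> nat \<Rightarrow>
    (nat \<Rightarrow> 'g) \<Rightarrow> (nat \<Rightarrow> nat \<Rightarrow> 'a) \<Rightarrow> nat \<Rightarrow> 'g"
  where "right_form A G N \<omega> J j = (\<Sum>i=1..N. rmult G (\<omega> i) (antipode A (J i j)))"

text \<open>
  The structure data of a calculus of dimension \<open>N\<close> relative to a basis \<open>\<omega>\<close> of the left-invariant
  forms.
\<close>

definition calculus_data ::
  "'a::complex_algebra_1 hopf_struct \<Rightarrow> ('a, 'g::complex_vector) calculus_struct \<Rightarrow> nat \<Rightarrow>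
    (nat \<Rightarrow> 'g) \<Rightarrow> (nat \<Rightarrow> nat \<Rightarrow> 'a \<Rightarrow> complex) \<Rightarrow> (nat \<Rightarrow> nat \<Rightarrow> 'a) \<Rightarrow> (nat \<Rightarrow> 'a \<Rightarrow> complex) \<Rightarrow> bool"
  where "calculus_data A G N \<omega> f J X \<longleftrightarrow>
    is_basis \<omega> N (left_invariant G) \<and>
    (\<forall>i\<in>{1..N}. \<forall>j\<in>{1..N}. f i j \<in> hopf_dual) \<and>
    (\<forall>i\<in>{1..N}. \<forall>x. rmult G (\<omega> i) x = (\<Sum>j=1..N. lmult G (left_act A (f i j) x) (\<omega> j))) \<and>
    (\<forall>i\<in>{1..N}. rcoact G (\<omega> i) = (\<Sum>j=1..N. \<omega> j \<otimes> J j i)) \<and>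
    is_basis X N (tangent_space A G) \<and>
    (\<forall>i\<in>{1..N}. \<forall>j\<in>{1..N}. tangent_pairing A G (X i) (\<omega> j) = (if i = j then 1 else 0))"

text \<open>
  The relation coefficients \<open>t\<close>: the kernel of \<open>id - \<sigma>\<^sup>t\<close> on \<open>\<T> \<otimes> \<T>\<close> is spanned by the elements
  \<open>X\<^sub>i \<otimes> X\<^sub>j + t\<^sup>i\<^sup>j\<^sub>k\<^sub>l X\<^sub>k \<otimes> X\<^sub>l\<close>, where \<open>(i, j)\<close> runs through a set \<open>P\<close> of index pairs. The set is
  needed because the kernel may contain no element with coefficient 1 at a given pair;
  \<open>P = {1..N} \<times> {1..N}\<close> is allowed.
\<close>

definition kernel_coeffs ::
  "nat \<Rightarrow> (nat \<Rightarrow> nat \<Rightarrow> 'a \<Rightarrow> complex) \<Rightarrow> (nat \<Rightarrow> nat \<Rightarrow> 'a) \<Rightarrow> (nat \<Rightarrow> 'a \<Rightarrow> complex) \<Rightarrow>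
    (nat \<times> nat) set \<Rightarrow> (nat \<Rightarrow> nat \<Rightarrow> nat \<Rightarrow> nat \<Rightarrow> complex) \<Rightarrow> bool"
  where "kernel_coeffs N f J X P t \<longleftrightarrow>
    P \<subseteq> {1..N} \<times> {1..N} \<and> (\<forall>(i, j)\<in>P. t i j i j = 0) \<and>
    (\<exists>\<sigma>t. clinear \<sigma>t \<and>
      (\<forall>i\<in>{1..N}. \<forall>j\<in>{1..N}. \<sigma>t (X i \<otimes> X j) =
        (\<Sum>k=1..N. \<Sum>l=1..N. braid_coeff f J i j k l *\<^sub>C (X k \<otimes> X l))) \<and>
      {u \<in> cspan {X i \<otimes> X j |i j. i \<in> {1..N} \<and> j \<in> {1..N}}. \<sigma>t u = u} =
        cspan {X i \<otimes> X j + (\<Sum>k=1..N. \<Sum>l=1..N. t i j k l *\<^sub>C (X k \<otimes> X l)) |i j. (i, j) \<in> P})"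


section \<open>Algebras given by generators and relations\<close>

datatype 'x word = Word (letters: "'x list")

instantiation word :: (type) monoid_add
begin
definition "0 = Word []"
definition "v + w = Word (letters v @ letters w)"
instance by standard (simp_all add: zero_word_def plus_word_def)
end

text \<open>The free unital algebra is the monoid algebra of the monoid of words.\<close>

type_synonym 'x free_algebra = "'x word \<Rightarrow>\<^sub>0 complex"

definition gen :: "'x \<Rightarrow> 'x free_algebra"
  where "gen x = Poly_Mapping.single (Word [x]) 1"

definition scalar :: "complex \<Rightarrow> 'x free_algebra"
  where "scalar c = Poly_Mapping.single 0 c"

definition free_on :: "'x set \<Rightarrow> 'x free_algebra set"
  where "free_on S = {p. \<forall>w\<in>Poly_Mapping.keys p. set (letters w) \<subseteq> S}"

definition free_eval :: "('x \<Rightarrow> 'b::complex_algebra_1) \<Rightarrow> 'x free_algebra \<Rightarrow> 'b"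
  where "free_eval v p =
    (\<Sum>w\<in>Poly_Mapping.keys p. Poly_Mapping.lookup p w *\<^sub>C prod_list (map v (letters w)))"

definition two_sided_ideal :: "'r::ring_1 set \<Rightarrow> 'r set \<Rightarrow> 'r set"
  where "two_sided_ideal B R = {p. \<exists>(n::nat) a r b.
    (\<forall>k<n. a k \<in> B \<and> r k \<in> R \<and> b k \<in> B) \<and> p = (\<Sum>k<n. a k * r k * b k)}"

text \<open>
  The algebra \<open>'b\<close> is presented by the generators \<open>v s\<close>, \<open>s \<in> S\<close>, and the relations \<open>r = 0\<close>,
  \<open>r \<in> R\<close>.
\<close>

definition presented_by :: "('x \<Rightarrow> 'b::complex_algebra_1) \<Rightarrow> 'x set \<Rightarrow> 'x free_algebra set \<Rightarrow> bool"
  where "presented_by v S R \<longleftrightarrow>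
    free_eval v ` free_on S = UNIV \<and>
    {p \<in> free_on S. free_eval v p = 0} = two_sided_ideal (free_on S) R"


section \<open>The quantum Cartan algebra\<close>

inductive_set bialgebra_E ::
  "'a::complex_algebra_1 hopf_struct \<Rightarrow> nat \<Rightarrow> (nat \<Rightarrow> nat \<Rightarrow> 'a \<Rightarrow> complex) \<Rightarrow>
    (nat \<Rightarrow> 'a \<Rightarrow> complex) \<Rightarrow> ('a \<Rightarrow> complex) set"
  for A N f X
where
  one: "counit A \<in> bialgebra_E A N f X"
| X: "i \<in> {1..N} \<Longrightarrow> X i \<in> bialgebra_E A N f X"
| f: "i \<in> {1..N} \<Longrightarrow> j \<in> {1..N} \<Longrightarrow> f i j \<in> bialgebra_E A N f X"
| add: "g \<in> bialgebra_E A N f X \<Longrightarrow> h \<in> bialgebra_E A N f X \<Longrightarrow> g + h \<in> bialgebra_E A N f X"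
| scale: "g \<in> bialgebra_E A N f X \<Longrightarrow> c *\<^sub>C g \<in> bialgebra_E A N f X"
| mult: "g \<in> bialgebra_E A N f X \<Longrightarrow> h \<in> bialgebra_E A N f X \<Longrightarrow> conv A g h \<in> bialgebra_E A N f X"

definition S_compatible ::
  "'a::complex_algebra_1 hopf_struct \<Rightarrow> nat \<Rightarrow> (nat \<Rightarrow> nat \<Rightarrow> 'a \<Rightarrow> complex) \<Rightarrow>
    (nat \<Rightarrow> 'a \<Rightarrow> complex) \<Rightarrow> bool"
  where "S_compatible A N f X \<longleftrightarrow>
    (\<forall>i\<in>{1..N}. \<forall>j\<in>{1..N}. dual_antipode A (f i j) \<in> bialgebra_E A N f X)"

datatype 'e cartan_gen = Ev 'e | Xi nat | Dl

fun is_odd :: "'e cartan_gen \<Rightarrow> bool"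
  where "is_odd (Ev e) = False" | "is_odd (Xi i) = True" | "is_odd Dl = True"

fun cartan_value :: "('e \<Rightarrow> 'c) \<Rightarrow> (nat \<Rightarrow> 'c) \<Rightarrow> 'c \<Rightarrow> 'e cartan_gen \<Rightarrow> 'c"
  where
    "cartan_value \<iota> \<xi> \<delta> (Ev e) = \<iota> e"
  | "cartan_value \<iota> \<xi> \<delta> (Xi i) = \<xi> i"
  | "cartan_value \<iota> \<xi> \<delta> Dl = \<delta>"

definition cartan_gens :: "'e set \<Rightarrow> nat \<Rightarrow> 'e cartan_gen set"
  where "cartan_gens E N = Ev ` E \<union> Xi ` {1..N} \<union> {Dl}"

text \<open>All relations of the subalgebra \<open>E\<close> of the dual hold for the generators \<open>Ev e\<close>.\<close>

definition even_relations ::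
  "'a::complex_algebra_1 hopf_struct \<Rightarrow> ('a \<Rightarrow> complex) set \<Rightarrow>
    ('a \<Rightarrow> complex) cartan_gen free_algebra set"
  where "even_relations A E =
    {gen (Ev (counit A)) - 1}
    \<union> {gen (Ev (g + h)) - gen (Ev g) - gen (Ev h) |g h. g \<in> E \<and> h \<in> E}
    \<union> {gen (Ev (c *\<^sub>C g)) - scalar c * gen (Ev g) |c g. g \<in> E}
    \<union> {gen (Ev (conv A g h)) - gen (Ev g) * gen (Ev h) |g h. g \<in> E \<and> h \<in> E}"

definition odd_relations ::
  "nat \<Rightarrow> (nat \<Rightarrow> nat \<Rightarrow> 'a \<Rightarrow> complex) \<Rightarrow> (nat \<Rightarrow> nat \<Rightarrow> 'a) \<Rightarrow> (nat \<Rightarrow> 'a \<Rightarrow> complex) \<Rightarrow>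
    (nat \<times> nat) set \<Rightarrow> (nat \<Rightarrow> nat \<Rightarrow> nat \<Rightarrow> nat \<Rightarrow> complex) \<Rightarrow>
    ('a \<Rightarrow> complex) cartan_gen free_algebra set"
  where "odd_relations N f J X P t =
    {gen (Xi i) * gen (Xi j) + (\<Sum>k=1..N. \<Sum>l=1..N. scalar (t i j k l) * gen (Xi k) * gen (Xi l))
      |i j. (i, j) \<in> P}
    \<union> {gen (Xi i) * gen Dl + gen Dl * gen (Xi i) - gen (Ev (X i)) |i. i \<in> {1..N}}
    \<union> {gen Dl * gen Dl}
    \<union> {gen (Xi i) * gen (Ev (f k j)) -
        (\<Sum>n=1..N. \<Sum>m=1..N. scalar (braid_coeff f J i j n m) * gen (Ev (f k n)) * gen (Xi m))
      |i j k. i \<in> {1..N} \<and> j \<in> {1..N} \<and> k \<in> {1..N}}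
    \<union> {gen (Xi i) * gen (Ev (X j)) -
        (\<Sum>k=1..N. \<Sum>l=1..N. scalar (braid_coeff f J i j k l) * gen (Ev (X k)) * gen (Xi l)) -
        (\<Sum>k=1..N. scalar (struct_coeff X J i j k) * gen (Xi k))
      |i j. i \<in> {1..N} \<and> j \<in> {1..N}}
    \<union> {gen (Ev (f i j)) * gen Dl - gen Dl * gen (Ev (f i j)) |i j. i \<in> {1..N} \<and> j \<in> {1..N}}
    \<union> {gen (Ev (X i)) * gen Dl - gen Dl * gen (Ev (X i)) |i. i \<in> {1..N}}"

definition is_cartan_algebra ::
  "'a::complex_algebra_1 hopf_struct \<Rightarrow> nat \<Rightarrow> (nat \<Rightarrow> nat \<Rightarrow> 'a \<Rightarrow> complex) \<Rightarrow> (nat \<Rightarrow> nat \<Rightarrow> 'a) \<Rightarrow>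
    (nat \<Rightarrow> 'a \<Rightarrow> complex) \<Rightarrow> (nat \<times> nat) set \<Rightarrow> (nat \<Rightarrow> nat \<Rightarrow> nat \<Rightarrow> nat \<Rightarrow> complex) \<Rightarrow>
    (('a \<Rightarrow> complex) \<Rightarrow> 'c::complex_algebra_1) \<Rightarrow> (nat \<Rightarrow> 'c) \<Rightarrow> 'c \<Rightarrow> bool"
  where "is_cartan_algebra A N f J X P t \<iota> \<xi> \<delta> \<longleftrightarrow>
    presented_by (cartan_value \<iota> \<xi> \<delta>) (cartan_gens (bialgebra_E A N f X) N)
      (even_relations A (bialgebra_E A N f X) \<union> odd_relations N f J X P t)"

definition cartan_grading ::
  "'a::complex_algebra_1 hopf_struct \<Rightarrow> nat \<Rightarrow> (nat \<Rightarrow> nat \<Rightarrow> 'a \<Rightarrow> complex) \<Rightarrow>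
    (nat \<Rightarrow> 'a \<Rightarrow> complex) \<Rightarrow> (('a \<Rightarrow> complex) \<Rightarrow> 'c::complex_algebra_1) \<Rightarrow> (nat \<Rightarrow> 'c) \<Rightarrow> 'c \<Rightarrow>
    nat \<Rightarrow> 'c set"
  where "cartan_grading A N f X \<iota> \<xi> \<delta> p =
    cspan {prod_list (map (cartan_value \<iota> \<xi> \<delta>) w) |w.
      set w \<subseteq> cartan_gens (bialgebra_E A N f X) N \<and> length (filter is_odd w) mod 2 = p}"

text \<open>
  The \<open>\<int>\<^sub>2\<close>-graded Hopf algebra structure of the Cartan algebra, which is determined by its values
  on generators.
\<close>

definition cartan_hopf_struct ::
  "'a::complex_algebra_1 hopf_struct \<Rightarrow> nat \<Rightarrow> (nat \<Rightarrow> nat \<Rightarrow> 'a \<Rightarrow> complex) \<Rightarrow>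
    (nat \<Rightarrow> 'a \<Rightarrow> complex) \<Rightarrow> (('a \<Rightarrow> complex) \<Rightarrow> 'c::complex_algebra_1) \<Rightarrow> (nat \<Rightarrow> 'c) \<Rightarrow> 'c \<Rightarrow>
    'c hopf_struct \<Rightarrow> bool"
  where "cartan_hopf_struct A N f X \<iota> \<xi> \<delta> C \<longleftrightarrow>
    graded_hopf_algebra (cartan_grading A N f X \<iota> \<xi> \<delta>) C \<and>
    bij (antipode C) \<and>
    (\<forall>i\<in>{1..N}. comul C (\<iota> (X i)) = 1 \<otimes> \<iota> (X i) + (\<Sum>j=1..N. \<iota> (X j) \<otimes> \<iota> (f j i))) \<and>
    (\<forall>i\<in>{1..N}. \<forall>j\<in>{1..N}. comul C (\<iota> (f i j)) = (\<Sum>k=1..N. \<iota> (f i k) \<otimes> \<iota> (f k j))) \<and>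
    (\<forall>i\<in>{1..N}. comul C (\<xi> i) = 1 \<otimes> \<xi> i + (\<Sum>j=1..N. \<xi> j \<otimes> \<iota> (f j i))) \<and>
    comul C \<delta> = 1 \<otimes> \<delta> + \<delta> \<otimes> 1 \<and>
    (\<forall>i\<in>{1..N}. counit C (\<iota> (X i)) = 0 \<and> counit C (\<xi> i) = 0) \<and> counit C \<delta> = 0 \<and>
    (\<forall>i\<in>{1..N}. \<forall>j\<in>{1..N}. counit C (\<iota> (f i j)) = (if i = j then 1 else 0)) \<and>
    (\<forall>h\<in>bialgebra_E A N f X. antipode C (\<iota> h) = \<iota> (dual_antipode A h)) \<and>
    (\<forall>i\<in>{1..N}. antipode C (\<iota> (X i)) = - (\<Sum>j=1..N. \<iota> (X j) * antipode C (\<iota> (f j i)))) \<and>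
    (\<forall>i\<in>{1..N}. antipode C (\<xi> i) = - (\<Sum>j=1..N. \<xi> j * antipode C (\<iota> (f j i)))) \<and>
    antipode C \<delta> = - \<delta>"


section \<open>The exterior algebra\<close>

text \<open>
  The tensor algebra over \<open>A\<close> of the bimodule \<open>\<Gamma>\<close>: the algebra generated by \<open>A\<close> (as a subalgebra)
  and \<open>\<Gamma>\<close>, in which the products of elements of \<open>A\<close> and \<open>\<Gamma>\<close> are given by the bimodule structure.
\<close>

definition tensor_algebra_relations ::
  "('a::complex_algebra_1, 'g::complex_vector) calculus_struct \<Rightarrow> ('a + 'g) free_algebra set"
  where "tensor_algebra_relations G =
    {gen (Inl 1) - 1}
    \<union> {gen (Inl (x + y)) - gen (Inl x) - gen (Inl y) |x y. True}
    \<union> {gen (Inl (c *\<^sub>C x)) - scalar c * gen (Inl x) |c x. True}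
    \<union> {gen (Inl (x * y)) - gen (Inl x) * gen (Inl y) |x y. True}
    \<union> {gen (Inr (\<beta> + \<gamma>)) - gen (Inr \<beta>) - gen (Inr \<gamma>) |\<beta> \<gamma>. True}
    \<union> {gen (Inr (lmult G x \<gamma>)) - gen (Inl x) * gen (Inr \<gamma>) |x \<gamma>. True}
    \<union> {gen (Inr (rmult G \<gamma> x)) - gen (Inr \<gamma>) * gen (Inl x) |x \<gamma>. True}"

definition is_tensor_algebra ::
  "('a::complex_algebra_1, 'g::complex_vector) calculus_struct \<Rightarrow> ('a \<Rightarrow> 't::complex_algebra_1) \<Rightarrow>
    ('g \<Rightarrow> 't) \<Rightarrow> bool"
  where "is_tensor_algebra G jA jG \<longleftrightarrow>
    presented_by (case_sum jA jG) UNIV (tensor_algebra_relations G)"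

text \<open>The component of degree \<open>n\<close>, that is, the \<open>n\<close>-fold tensor power of \<open>\<Gamma>\<close> over \<open>A\<close>\<close>

definition tensor_power ::
  "('a \<Rightarrow> 't::complex_algebra_1) \<Rightarrow> ('g \<Rightarrow> 't) \<Rightarrow> nat \<Rightarrow> 't set"
  where "tensor_power jA jG n = cspan {jA x * prod_list (map jG \<gamma>s) |x \<gamma>s. length \<gamma>s = n}"

text \<open>
  The Woronowicz braiding, as a map on the degree 2 component of the tensor algebra (its values
  elsewhere are irrelevant)
\<close>

definition is_braiding ::
  "nat \<Rightarrow> (nat \<Rightarrow> 'g) \<Rightarrow> (nat \<Rightarrow> nat \<Rightarrow> 'a \<Rightarrow> complex) \<Rightarrow> (nat \<Rightarrow> nat \<Rightarrow> 'a) \<Rightarrow>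
    ('a::complex_algebra_1 \<Rightarrow> 't::complex_algebra_1) \<Rightarrow> ('g \<Rightarrow> 't) \<Rightarrow> ('t \<Rightarrow> 't) \<Rightarrow> bool"
  where "is_braiding N \<omega> f J jA jG \<sigma> \<longleftrightarrow>
    (\<forall>s\<in>tensor_power jA jG 2. \<sigma> s \<in> tensor_power jA jG 2) \<and>
    (\<forall>s\<in>tensor_power jA jG 2. \<forall>t\<in>tensor_power jA jG 2. \<sigma> (s + t) = \<sigma> s + \<sigma> t) \<and>
    (\<forall>x. \<forall>s\<in>tensor_power jA jG 2. \<sigma> (jA x * s) = jA x * \<sigma> s \<and> \<sigma> (s * jA x) = \<sigma> s * jA x) \<and>
    (\<forall>i\<in>{1..N}. \<forall>j\<in>{1..N}. \<sigma> (jG (\<omega> i) * jG (\<omega> j)) =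
      (\<Sum>k=1..N. \<Sum>l=1..N. braid_coeff f J k l i j *\<^sub>C (jG (\<omega> k) * jG (\<omega> l))))"

definition is_exterior_algebra ::
  "('a \<Rightarrow> 't::complex_algebra_1) \<Rightarrow> ('g \<Rightarrow> 't) \<Rightarrow> ('t \<Rightarrow> 't) \<Rightarrow> ('t \<Rightarrow> 'w::complex_algebra_1) \<Rightarrow> bool"
  where "is_exterior_algebra jA jG \<sigma> \<pi> \<longleftrightarrow>
    algebra_hom \<pi> \<and> surj \<pi> \<and>
    {t. \<pi> t = 0} = two_sided_ideal UNIV {t \<in> tensor_power jA jG 2. \<sigma> t = t}"

definition ext_degree ::
  "('a \<Rightarrow> 't::complex_algebra_1) \<Rightarrow> ('g \<Rightarrow> 't) \<Rightarrow> ('t \<Rightarrow> 'w::complex_algebra_1) \<Rightarrow> nat \<Rightarrow> 'w set"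
  where "ext_degree jA jG \<pi> n = \<pi> ` tensor_power jA jG n"

text \<open>The induced \<open>\<int>\<^sub>2\<close>-grading\<close>

definition ext_parity ::
  "('a \<Rightarrow> 't::complex_algebra_1) \<Rightarrow> ('g \<Rightarrow> 't) \<Rightarrow> ('t \<Rightarrow> 'w::complex_algebra_1) \<Rightarrow> nat \<Rightarrow> 'w set"
  where "ext_parity jA jG \<pi> p = cspan (\<Union>n\<in>{n. n mod 2 = p}. ext_degree jA jG \<pi> n)"

text \<open>
  In the following definitions, \<open>W\<close> is the family of homogeneous components of the exterior
  algebra, and \<open>iA\<close>, \<open>iG\<close> are the canonical maps of \<open>A\<close> and \<open>\<Gamma>\<close> into it.
\<close>

definition is_exterior_derivative ::
  "('a, 'g) calculus_struct \<Rightarrow> (nat \<Rightarrow> 'w::complex_algebra_1 set) \<Rightarrow> ('a \<Rightarrow> 'w) \<Rightarrow> ('g \<Rightarrow> 'w) \<Rightarrow>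
    ('w \<Rightarrow> 'w) \<Rightarrow> bool"
  where "is_exterior_derivative G W iA iG d \<longleftrightarrow>
    clinear d \<and> (\<forall>x. d (iA x) = iG (diff G x)) \<and>
    (\<forall>n. \<forall>\<alpha>\<in>W n. d \<alpha> \<in> W (Suc n)) \<and>
    (\<forall>n. \<forall>\<alpha>\<in>W n. \<forall>\<beta>. d (\<alpha> * \<beta>) = d \<alpha> * \<beta> + (-1) ^ n *\<^sub>C (\<alpha> * d \<beta>)) \<and>
    (\<forall>\<alpha>. d (d \<alpha>) = 0)"

definition is_ext_lcoact ::
  "'a::complex_algebra_1 hopf_struct \<Rightarrow> ('a \<Rightarrow> 'w::complex_algebra_1) \<Rightarrow> ('w \<Rightarrow> 'w) \<Rightarrow>
    ('w \<Rightarrow> ('a, 'w) tensor) \<Rightarrow> bool"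
  where "is_ext_lcoact A iA d \<Lambda> \<longleftrightarrow>
    left_comodule A \<Lambda> \<and>
    (\<forall>x. \<Lambda> (iA x) = tensor_map id iA (comul A x)) \<and>
    (\<forall>x \<alpha>. \<Lambda> (iA x * d \<alpha>) =
      tensor_act (*) (\<lambda>y \<beta>. iA y * \<beta>) (comul A x) (tensor_map id d (\<Lambda> \<alpha>)))"

text \<open>\<open>\<alpha> \<triangleleft> h = (h \<otimes> id) \<Delta>\<^sub>\<Gamma>(\<alpha>)\<close>\<close>

definition right_act ::
  "('w \<Rightarrow> ('a::complex_vector, 'w::complex_vector) tensor) \<Rightarrow> 'w \<Rightarrow> ('a \<Rightarrow> complex) \<Rightarrow> 'w"
  where "right_act \<Lambda> \<alpha> h = tensor_lift (\<lambda>x \<beta>. h x *\<^sub>C \<beta>) (\<Lambda> \<alpha>)"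

definition LR1 ::
  "'a::complex_algebra_1 hopf_struct \<Rightarrow> (nat \<Rightarrow> 'a \<Rightarrow> complex) \<Rightarrow>
    ('w \<Rightarrow> ('a, 'w::complex_vector) tensor) \<Rightarrow> nat \<Rightarrow> 'w \<Rightarrow> 'w"
  where "LR1 A X \<Lambda> i \<alpha> = right_act \<Lambda> \<alpha> (- dual_antipode_inv A (X i))"

definition LR2 ::
  "'a::complex_algebra_1 hopf_struct \<Rightarrow> (nat \<Rightarrow> nat \<Rightarrow> 'a \<Rightarrow> complex) \<Rightarrow>
    ('w \<Rightarrow> ('a, 'w::complex_vector) tensor) \<Rightarrow> nat \<Rightarrow> nat \<Rightarrow> 'w \<Rightarrow> 'w"
  where "LR2 A f \<Lambda> i j \<alpha> = right_act \<Lambda> \<alpha> (dual_antipode_inv A (f i j))"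

definition is_right_inner_derivative ::
  "'a::complex_algebra_1 hopf_struct \<Rightarrow> ('a, 'g::complex_vector) calculus_struct \<Rightarrow> nat \<Rightarrow>
    (nat \<Rightarrow> 'g) \<Rightarrow> (nat \<Rightarrow> nat \<Rightarrow> 'a \<Rightarrow> complex) \<Rightarrow> (nat \<Rightarrow> nat \<Rightarrow> 'a) \<Rightarrow>
    (nat \<Rightarrow> 'w::complex_algebra_1 set) \<Rightarrow> ('a \<Rightarrow> 'w) \<Rightarrow> ('g \<Rightarrow> 'w) \<Rightarrow> ('w \<Rightarrow> ('a, 'w) tensor) \<Rightarrow>
    (nat \<Rightarrow> 'w \<Rightarrow> 'w) \<Rightarrow> bool"
  where "is_right_inner_derivative A G N \<omega> f J W iA iG \<Lambda> iR \<longleftrightarrow>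
    (\<forall>j\<in>{1..N}. clinear (iR j) \<and>
      (\<forall>x. iR j (iA x) = 0) \<and>
      (\<forall>n. \<forall>\<alpha>\<in>W (Suc n). iR j \<alpha> \<in> W n) \<and>
      (\<forall>i\<in>{1..N}. iR j (iG (right_form A G N \<omega> J i)) = (if i = j then 1 else 0)) \<and>
      (\<forall>n. \<forall>\<alpha>\<in>W n. \<forall>\<beta>. iR j (\<alpha> * \<beta>) =
        iR j \<alpha> * \<beta> + (-1) ^ n *\<^sub>C (\<Sum>k=1..N. LR2 A f \<Lambda> k j \<alpha> * iR k \<beta>)))"


section \<open>Graded right module algebras\<close>

text \<open>
  \<open>\<rho>\<close> is a \<open>\<int>\<^sub>2\<close>-graded unital algebra anti-homomorphism from an algebra graded by \<open>D\<close> to the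
  endomorphisms of a space graded by \<open>V\<close>; in other words, a right module structure.
\<close>

definition graded_anti_hom ::
  "(nat \<Rightarrow> 'c::complex_algebra_1 set) \<Rightarrow> (nat \<Rightarrow> 'w::complex_vector set) \<Rightarrow> ('c \<Rightarrow> 'w \<Rightarrow> 'w) \<Rightarrow> bool"
  where "graded_anti_hom D V \<rho> \<longleftrightarrow>
    (\<forall>x. clinear (\<rho> x)) \<and> clinear \<rho> \<and> \<rho> 1 = id \<and>
    (\<forall>p<2. \<forall>q<2. \<forall>x\<in>D p. \<forall>y\<in>D q. \<rho> (x * y) = (-1) ^ (p * q) *\<^sub>C (\<rho> y \<circ> \<rho> x)) \<and>
    (\<forall>p<2. \<forall>q<2. \<forall>x\<in>D p. \<forall>\<alpha>\<in>V q. \<rho> x \<alpha> \<in> V ((p + q) mod 2))"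

text \<open>
  \<open>\<rho>\<^sub>x(\<alpha>\<beta>) = (-1)\<^bsup>|x\<^sub>(\<^sub>2\<^sub>)||\<alpha>|\<^esup> \<rho>\<^bsub>x\<^sub>(\<^sub>1\<^sub>)\<^esub>(\<alpha>) \<rho>\<^bsub>x\<^sub>(\<^sub>2\<^sub>)\<^esub>(\<beta>)\<close> and \<open>\<rho>\<^sub>x(1) = \<epsilon>(x) 1\<close>
\<close>

definition graded_right_module_algebra ::
  "(nat \<Rightarrow> 'c::complex_algebra_1 set) \<Rightarrow> 'c hopf_struct \<Rightarrow> (nat \<Rightarrow> 'w::complex_algebra_1 set) \<Rightarrow>
    ('c \<Rightarrow> 'w \<Rightarrow> 'w) \<Rightarrow> bool"
  where "graded_right_module_algebra D C V \<rho> \<longleftrightarrow>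
    graded_anti_hom D V \<rho> \<and>
    (\<forall>x. \<forall>q<2. \<forall>\<alpha>\<in>V q. \<forall>\<beta>. \<rho> x (\<alpha> * \<beta>) =
      tensor_lift (\<lambda>y z. \<Sum>p<2. (-1) ^ (p * q) *\<^sub>C (\<rho> y \<alpha> * \<rho> (z2_part D p z) \<beta>)) (comul C x)) \<and>
    (\<forall>x. \<rho> x 1 = counit C x *\<^sub>C 1)"

end

theory Submission
  imports Defs
begin

text \<open>
  Since the antipode \<open>S\<close> of the Cartan algebra is a bijective graded anti-homomorphism, an action
  \<open>\<rho>\<close> is the same as the algebra homomorphism \<open>\<Phi> = \<rho> \<circ> S\<inverse>\<close> into the endomorphisms of the exterior
  algebra, and \<open>\<Phi>\<close> is prescribed on generators: \<open>h \<mapsto> (\<alpha> \<mapsto> \<alpha> \<triangleleft> S\<inverse>(h))\<close>, \<open>\<xi>\<^sub>j \<mapsto> - i\<^sup>R\<^sub>j\<close>, \<open>\<delta> \<mapsto> d\<close>.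
  Existence and uniqueness thus amount to the defining relations for these operators. Each of them
  is inherited by products of forms from the twisted Leibniz rules, so it is enough to verify it on
  \<open>A\<close> and on the left-invariant (or exact) one-forms; the Leibniz rules in turn reduce the induction
  step to the relations between the functionals \<open>f\<^sub>i\<^sub>j\<close> and \<open>X\<^sub>i\<close>, which express the right covariance
  of the bimodule structure.

  The module algebra property is multiplicative, so it is enough to verify it for the generators
  \<open>X\<^sub>i, f\<^sub>i\<^sub>j, \<xi>\<^sub>i, \<delta>\<close> rather than for their images under \<open>S\<inverse>\<close>. This is where \<open>S\<close>-compatibility
  enters: \<open>S(f\<^sub>i\<^sub>j)\<close> lies in the domain of the formula for \<open>\<Phi>\<close>, hence \<open>\<rho>\<close> maps \<open>f\<^sub>i\<^sub>j\<close> to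
  \<open>\<alpha> \<mapsto> \<alpha> \<triangleleft> f\<^sub>i\<^sub>j\<close>.
\<close>

section \<open>Linear maps and tensor products\<close>

text \<open>The operators \<open>d\<close>, \<open>\<Lambda>\<close> and \<open>iR\<close> are
  given, so nothing has to be shown well defined on the quotient; but they are prescribed on
  different elements. The coaction is known on functions and on the elements
  \<open>x d\<alpha>\<close>, the derivative on functions, and the inner derivatives on
  right-invariant forms, while \<open>L k j\<close> and \<open>Y j\<close> are simplest on
  left-invariant ones. The matrix \<open>J\<close>, inverted by applying the antipode or its inverse
  to the entries, mediates between the two kinds of invariant forms. It is also the source of the
  coefficients \<open>\<sigma>\<close> and \<open>C\<close>: they arise when a functional is applied
  to an identity in \<open>A\<close> that contains \<open>J\<close>.

  The twisted Leibniz rules mix indices, so a relation for a product needs the relation for all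
  indices on each factor. The quadratic relation of the \<open>\<xi>\<close> resists most: on a
  product its scalar coefficients are replaced by coefficients that are themselves forms. It is
  therefore proved for every element of the kernel of \<open>id - \<sigma>\<^sup>t\<close>, not only
  for the given spanning set.\<close>

named_theorems clin

lemma clinearI:
  assumes "\<And>x y. f (x + y) = f x + f y" and "\<And>c x. f (c *\<^sub>C x) = c *\<^sub>C f x"
  shows "clinear f"
  using assms by unfold_locales auto

lemmas clinear_add = complex_vector_pair.linear_add
  and clinear_scale = complex_vector_pair.linear_scale
  and clinear_0 = complex_vector_pair.linear_0
  and clinear_neg = complex_vector_pair.linear_neg
  and clinear_diff = complex_vector_pair.linear_diff
  and clinear_sum = complex_vector_pair.linear_sum

lemma cbilinearI [clin]:
  "(\<And>x. clinear (\<lambda>y. f x y)) \<Longrightarrow> (\<And>y. clinear (\<lambda>x. f x y)) \<Longrightarrow> cbilinear f"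
  by (simp add: cbilinear_def)

lemma clinear_comp: "clinear g \<Longrightarrow> clinear f \<Longrightarrow> clinear (\<lambda>x. g (f x))"
  by (rule clinearI) (simp_all add: clinear_add clinear_scale)

lemma clinear_id [clin]: "clinear (\<lambda>x. x)"
  by (rule clinearI) auto

lemma clinear_id' [clin]: "clinear id"
  by (rule clinearI) auto

lemma clinear_zero [clin]: "clinear (\<lambda>x. 0)"
  by (rule clinearI) auto

lemma clinear_plus [clin]: "clinear f \<Longrightarrow> clinear g \<Longrightarrow> clinear (\<lambda>x. f x + g x)"
  by (rule clinearI) (simp_all add: clinear_add clinear_scale scaleC_add_right)

lemma clinear_minus [clin]: "clinear f \<Longrightarrow> clinear g \<Longrightarrow> clinear (\<lambda>x. f x - g x)"
  by (rule clinearI)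
    (simp_all add: clinear_add clinear_scale complex_vector.scale_right_diff_distrib)

lemma clinear_uminus' [clin]: "clinear f \<Longrightarrow> clinear (\<lambda>x. - f x)"
  by (rule clinearI) (simp_all add: clinear_add clinear_scale)

lemma clinear_scaleC_right [clin]: "clinear f \<Longrightarrow> clinear (\<lambda>x. c *\<^sub>C f x)"
  by (rule clinearI) (simp_all add: clinear_add clinear_scale scaleC_add_right mult.commute)

lemma clinear_scaleC_left [clin]: "clinear f \<Longrightarrow> clinear (\<lambda>x. f x *\<^sub>C v)"
  by (rule clinearI) (simp_all add: clinear_add clinear_scale scaleC_add_left)

lemma clinear_mult_left [clin]:
  "clinear f \<Longrightarrow> clinear (\<lambda>x. f x * (b :: 'b::complex_algebra_1))"
  by (rule clinearI) (simp_all add: clinear_add clinear_scale distrib_right mult_scaleC_left)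

lemma clinear_mult_right [clin]:
  "clinear f \<Longrightarrow> clinear (\<lambda>x. (b :: 'b::complex_algebra_1) * f x)"
  by (rule clinearI) (simp_all add: clinear_add clinear_scale distrib_left mult_scaleC_right)

lemma clinear_sum' [clin]:
  "(\<And>i. i \<in> I \<Longrightarrow> clinear (\<lambda>x. f i x)) \<Longrightarrow> clinear (\<lambda>x. \<Sum>i\<in>I. f i x)"
  by (rule clinearI)
    (simp_all add: clinear_add clinear_scale sum.distrib complex_vector.scale_sum_right)

section \<open>Maps out of tensor products\<close>

lemma elementary_tensor_add_left: "(x + x') \<otimes> y = x \<otimes> y + x' \<otimes> y"
  by transfer (simp add: tensor_eq.add_left)

lemma elementary_tensor_add_right: "x \<otimes> (y + y') = x \<otimes> y + x \<otimes> y'"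
  by transfer (simp add: tensor_eq.add_right)

lemma elementary_tensor_scale_left: "(c *\<^sub>C x) \<otimes> y = c *\<^sub>C (x \<otimes> y)"
  by transfer (simp add: tensor_eq.refl)

lemma elementary_tensor_scale_right: "x \<otimes> (c *\<^sub>C y) = c *\<^sub>C (x \<otimes> y)"
  by transfer (simp, rule tensor_eq.sym, rule tensor_eq.scale)

lemma clinear_tensor_left [clin]: "clinear f \<Longrightarrow> clinear (\<lambda>x. f x \<otimes> b)"
  by (rule clinearI)
    (simp_all add: clinear_add clinear_scale elementary_tensor_add_left elementary_tensor_scale_left)

lemma clinear_tensor_right [clin]: "clinear f \<Longrightarrow> clinear (\<lambda>x. b \<otimes> f x)"
  by (rule clinearI)
    (simp_all add: clinear_add clinear_scale elementary_tensor_add_right elementary_tensor_scale_right)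

text \<open>Holds for arbitrary \<open>B\<close>, since \<open>tensor_lift B t\<close> is a sum over the list representing \<open>t\<close>.\<close>

lemma tensor_lift_push:
  assumes "clinear g"
  shows "g (tensor_lift B t) = tensor_lift (\<lambda>x y. g (B x y)) t"
proof -
  have "g (\<Sum>(x, y)\<leftarrow>u. B x y) = (\<Sum>(x, y)\<leftarrow>u. g (B x y))" for u
    by (induction u) (auto simp: clinear_0[OF assms] clinear_add[OF assms])
  then show ?thesis
    by (simp add: tensor_lift_def)
qed

lemma tensor_lift_plus:
  "tensor_lift (\<lambda>x y. B x y + B' x y) t = tensor_lift B t + tensor_lift B' t"
proof -
  have "(\<Sum>(x, y)\<leftarrow>u. B x y + B' x y) = (\<Sum>(x, y)\<leftarrow>u. B x y) + (\<Sum>(x, y)\<leftarrow>u. B' x y)" for u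
    by (induction u) (auto simp: algebra_simps)
  then show ?thesis
    by (simp add: tensor_lift_def)
qed

lemma tensor_lift_zero:
  fixes t :: "('a::complex_vector, 'b::complex_vector) tensor"
  shows "tensor_lift (\<lambda>x y. 0 :: 'c::complex_vector) t = 0"
proof -
  have "(\<Sum>(x, y)\<leftarrow>u. 0) = (0::'c)" for u :: "('a \<times> 'b) list"
    by (induction u) auto
  then show ?thesis
    unfolding tensor_lift_def by blast
qed

lemma tensor_lift_scaleC: "tensor_lift (\<lambda>x y. c *\<^sub>C B x y) t = c *\<^sub>C tensor_lift B t"
  by (rule tensor_lift_push[symmetric]) (intro clin)

lemma tensor_lift_mult_left:
  "tensor_lift (\<lambda>x y. c * B x y) t = c * tensor_lift B t" for c :: "'c::complex_algebra_1"
  by (rule tensor_lift_push[symmetric]) (intro clin)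

lemma tensor_lift_mult_right:
  "tensor_lift (\<lambda>x y. B x y * c) t = tensor_lift B t * c" for c :: "'c::complex_algebra_1"
  by (rule tensor_lift_push[where g = "\<lambda>x. x * c", symmetric]) (intro clin)

lemma tensor_lift_scaleC_left: "tensor_lift (\<lambda>x y. B x y *\<^sub>C c) t = tensor_lift B t *\<^sub>C c"
  by (rule tensor_lift_push[where g = "\<lambda>x. x *\<^sub>C c", symmetric]) (intro clin)

lemma tensor_lift_sum:
  "tensor_lift (\<lambda>x y. \<Sum>i\<in>I. B i x y) t = (\<Sum>i\<in>I. tensor_lift (B i) t)"
  by (induction I rule: infinite_finite_induct)
    (simp_all add: tensor_lift_zero tensor_lift_plus)

text \<open>For a fixed tensor \<open>t\<close> the value is a sum of terms \<open>B a y z\<close>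
  over one fixed list, so linearity in the parameter \<open>a\<close> passes through term by
  term.\<close>

lemma clinear_tensor_lift_param [clin]:
  assumes "\<And>y z. clinear (\<lambda>a. B a y z)"
  shows "clinear (\<lambda>a. tensor_lift (\<lambda>y z. B a y z) t)"
  by (rule clinearI)
    (simp_all add: clinear_add[OF assms] clinear_scale[OF assms] tensor_lift_plus tensor_lift_scaleC)

lemma clinear_tensor_lift_arg [clin]:
  "cbilinear B \<Longrightarrow> clinear f \<Longrightarrow> clinear (\<lambda>a. tensor_lift B (f a))"
  by (rule clinear_comp[OF tensor_lift(2)])

text \<open>Both sides are double sums over the lists representing \<open>s\<close> and
  \<open>t\<close>, so this is the exchange of two finite sums. Sweedler sums of independent
  elements can thus be reordered freely.\<close>

lemma tensor_lift_swap:
  "tensor_lift (\<lambda>x y. tensor_lift (\<lambda>u v. F x y u v) s) t =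
   tensor_lift (\<lambda>u v. tensor_lift (\<lambda>x y. F x y u v) t) s"
proof -
  have "(\<Sum>(x, y)\<leftarrow>l. \<Sum>(u, v)\<leftarrow>k. F x y u v) = (\<Sum>(u, v)\<leftarrow>k. \<Sum>(x, y)\<leftarrow>l. F x y u v)" for l k
  proof (induction l)
    case Nil
    show ?case by (induction k) auto
  next
    case (Cons p l)
    have "(\<Sum>(u, v)\<leftarrow>k. F (fst p) (snd p) u v) + (\<Sum>(u, v)\<leftarrow>k. \<Sum>(x, y)\<leftarrow>l. F x y u v) =
      (\<Sum>(u, v)\<leftarrow>k. \<Sum>(x, y)\<leftarrow>p # l. F x y u v)"
      by (induction k) (auto simp: algebra_simps case_prod_beta)
    with Cons show ?case
      by (cases p) auto
  qed
  then show ?thesis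
    by (simp add: tensor_lift_def)
qed

lemma tensor_decomp:
  fixes t :: "('a::complex_vector, 'b::complex_vector) tensor"
  shows "\<exists>(n::nat) a b. t = (\<Sum>k<n. a k \<otimes> b k)"
proof -
  obtain u where u: "t = abs_tensor u"
    by (metis Quotient_abs_rep[OF Quotient_tensor])
  have "abs_tensor u = (\<Sum>k<length u. fst (u ! k) \<otimes> snd (u ! k))" for u :: "('a \<times> 'b) list"
  proof (induction u rule: rev_induct)
    case Nil
    then show ?case by (simp add: zero_tensor.abs_eq)
  next
    case (snoc p u)
    have "abs_tensor (u @ [p]) = abs_tensor u + fst p \<otimes> snd p"
      by (simp add: elementary_tensor.abs_eq plus_tensor.abs_eq)
    then show ?case by (simp add: snoc nth_append)
  qed
  from this[of u] show ?thesis unfolding u by (intro exI)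
qed

lemma tensor_ext:
  assumes "clinear f" and "clinear g" and "\<And>x y. f (x \<otimes> y) = g (x \<otimes> y)"
  shows "f t = g t"
proof -
  obtain n :: nat and a b where "t = (\<Sum>k<n. a k \<otimes> b k)"
    using tensor_decomp by blast
  then show ?thesis
    by (simp add: clinear_sum[OF assms(1)] clinear_sum[OF assms(2)] assms(3))
qed

lemma tensor_lift_decomp:
  assumes "cbilinear B"
  shows "tensor_lift B (\<Sum>k\<in>I. a k \<otimes> b k) = (\<Sum>k\<in>I. B (a k) (b k))"
  by (simp add: clinear_sum[OF tensor_lift(2)[OF assms]] tensor_lift(1)[OF assms])

lemma tensor_lift_elementary: "tensor_lift (\<lambda>x y. x \<otimes> y) t = t"
proof (rule tensor_ext[where t = t])
  show "clinear (tensor_lift (\<lambda>x y. x \<otimes> y))"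
    by (intro tensor_lift(2) clin)
next
  fix x y
  show "tensor_lift (\<lambda>x y. x \<otimes> y) (x \<otimes> y) = x \<otimes> y"
    by (rule tensor_lift(1)) (intro clin)
qed (rule clinear_id)

lemma tensor_lift_lift:
  assumes "cbilinear B"
  shows "tensor_lift B (tensor_lift (\<lambda>x y. f x y \<otimes> g x y) t) = tensor_lift (\<lambda>x y. B (f x y) (g x y)) t"
  by (simp add: tensor_lift_push[OF tensor_lift(2)[OF assms]] tensor_lift(1)[OF assms])

lemma tensor_lift_map:
  assumes "cbilinear B"
  shows "tensor_lift B (tensor_map f g t) = tensor_lift (\<lambda>x y. B (f x) (g y)) t"
  by (simp add: tensor_map_def tensor_lift_lift[OF assms])

lemma tensor_lift_act:
  assumes "cbilinear B"
  shows "tensor_lift B (tensor_act m m' s t) =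
    tensor_lift (\<lambda>x y. tensor_lift (\<lambda>x' y'. B (m x x') (m' y y')) t) s"
  by (simp add: tensor_act_def tensor_lift_push[OF tensor_lift(2)[OF assms]]
      tensor_lift(1)[OF assms])

lemma tensor_map_elementary:
  "clinear f \<Longrightarrow> clinear g \<Longrightarrow> tensor_map f g (x \<otimes> y) = f x \<otimes> g y"
  unfolding tensor_map_def
  by (subst tensor_lift(1)) (auto intro!: cbilinearI clinear_tensor_left clinear_tensor_right)

lemma clinear_tensor_map [clin]:
  assumes "clinear f" and "clinear g" and "clinear h"
  shows "clinear (\<lambda>x. tensor_map f g (h x))"
  unfolding tensor_map_def
  by (intro clin clinear_comp[OF assms(1)] clinear_comp[OF assms(2)] assms(3))

lemma cbilinear_left: "cbilinear m \<Longrightarrow> clinear f \<Longrightarrow> clinear (\<lambda>x. m (f x) y)"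
  unfolding cbilinear_def by (rule clinear_comp[where g = "\<lambda>x. m x y"]) auto

lemma cbilinear_right: "cbilinear m \<Longrightarrow> clinear f \<Longrightarrow> clinear (\<lambda>x. m y (f x))"
  unfolding cbilinear_def by (rule clinear_comp[where g = "\<lambda>x. m y x"]) auto

lemma cbilinear_tensor_act:
  assumes "cbilinear m" and "cbilinear m'"
  shows "cbilinear (tensor_act m m')"
  unfolding tensor_act_def
  by (intro clin cbilinear_left[OF assms(1)] cbilinear_left[OF assms(2)]
      cbilinear_right[OF assms(1)] cbilinear_right[OF assms(2)])

lemma tensor_act_elementary:
  assumes "cbilinear m" and "cbilinear m'"
  shows "tensor_act m m' (x \<otimes> y) (x' \<otimes> y') = m x x' \<otimes> m' y y'"
  unfolding tensor_act_def
  by (subst tensor_lift(1), (intro clin cbilinear_left[OF assms(1)] cbilinear_left[OF assms(2)]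
      cbilinear_right[OF assms(1)] cbilinear_right[OF assms(2)])[1])+ simp

lemma cbilinear_mult: "cbilinear ((*) :: 'a::complex_algebra_1 \<Rightarrow> 'a \<Rightarrow> 'a)"
  by (intro clin)

lemma cbilinear_act_mult:
  "cbilinear (tensor_act ((*) :: 'a::complex_algebra_1 \<Rightarrow> _) ((*) :: 'b::complex_algebra_1 \<Rightarrow> _))"
  by (intro cbilinear_tensor_act cbilinear_mult)

section \<open>Hopf algebras\<close>

text \<open>The multiplication \<open>m\<close> of the tensor square stays open: nothing in this
  locale expands the coproduct of a product, so the results hold for \<open>A\<close> and for the
  graded Hopf algebra \<open>C\<close> alike.\<close>

locale hopf =
  fixes m and A :: "'a::complex_algebra_1 hopf_struct"
  assumes hopf_axioms: "hopf_axioms m A"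
begin

abbreviation swe :: "('a \<Rightarrow> 'a \<Rightarrow> 'b::complex_vector) \<Rightarrow> 'a \<Rightarrow> 'b"
  where "swe B x \<equiv> tensor_lift B (comul A x)"

lemma comul_lin [clin]: "clinear f \<Longrightarrow> clinear (\<lambda>x. comul A (f x))"
  and counit_lin [clin]: "clinear f \<Longrightarrow> clinear (\<lambda>x. counit A (f x))"
  and antipode_lin [clin]: "clinear f \<Longrightarrow> clinear (\<lambda>x. antipode A (f x))"
  using hopf_axioms
  by (simp_all add: hopf_axioms_def clinear_comp[of "comul A"] clinear_comp[of "counit A"]
      clinear_comp[of "antipode A"])

lemma comul_clinear: "clinear (comul A)" and counit_clinear: "clinear (counit A)"
  and antipode_clinear: "clinear (antipode A)"
  using hopf_axioms by (auto simp: hopf_axioms_def)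

lemma counit_one [simp]: "counit A 1 = 1"
  and counit_mult [simp]: "counit A (x * y) = counit A x * counit A y"
  and comul_one: "comul A 1 = 1 \<otimes> 1"
  and comul_mult: "comul A (x * y) = m (comul A x) (comul A y)"
  using hopf_axioms by (auto simp: hopf_axioms_def)

lemma counit_left:
  assumes "clinear f" shows "swe (\<lambda>y z. counit A y *\<^sub>C f z) x = f x"
proof -
  have "swe (\<lambda>y z. counit A y *\<^sub>C z) x = x"
    using hopf_axioms by (auto simp: hopf_axioms_def)
  then have "f (swe (\<lambda>y z. counit A y *\<^sub>C z) x) = f x" by simp
  then show ?thesis
    by (simp add: tensor_lift_push[OF assms] clinear_scale[OF assms])
qed

lemma counit_right:
  assumes "clinear f" shows "swe (\<lambda>y z. counit A z *\<^sub>C f y) x = f x"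
proof -
  have "swe (\<lambda>y z. counit A z *\<^sub>C y) x = x"
    using hopf_axioms by (auto simp: hopf_axioms_def)
  then have "f (swe (\<lambda>y z. counit A z *\<^sub>C y) x) = f x" by simp
  then show ?thesis
    by (simp add: tensor_lift_push[OF assms] clinear_scale[OF assms])
qed

lemma antipode_left: "swe (\<lambda>y z. antipode A y * z) x = counit A x *\<^sub>C 1"
  and antipode_right: "swe (\<lambda>y z. y * antipode A z) x = counit A x *\<^sub>C 1"
  using hopf_axioms by (auto simp: hopf_axioms_def)

text \<open>Both sides are the trilinear map \<open>h\<close> evaluated at the threefold coproduct
  of \<open>c\<close>. The map \<open>?T\<close> evaluates \<open>h\<close> on tensors bracketed to
  the right, and \<open>tensor_assoc\<close> rebrackets the other side.\<close>

lemma coassoc: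
  assumes "\<And>x y. clinear (\<lambda>z. h x y z)" and "\<And>x z. clinear (\<lambda>y. h x y z)"
    and "\<And>y z. clinear (\<lambda>x. h x y z)"
  shows "swe (\<lambda>a z. swe (\<lambda>x y. h x y z) a) c = swe (\<lambda>x b. swe (\<lambda>y z. h x y z) b) c"
proof -
  have bil: "cbilinear (\<lambda>x y. h x y z)" "cbilinear (\<lambda>y z. h x y z)" for x z
    by (auto intro!: cbilinearI assms)
  have bil3: "cbilinear (\<lambda>x. tensor_lift (\<lambda>y z. h x y z))"
    by (intro clin bil assms)
  have bil2: "cbilinear (\<lambda>x y. x \<otimes> (y \<otimes> z))" for z :: 'a
    by (intro clin)
  let ?T = "tensor_lift (\<lambda>x t. tensor_lift (\<lambda>y z. h x y z) t)"
  have "tensor_assoc (tensor_map (comul A) id (comul A c)) = tensor_map id (comul A) (comul A c)"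
    using hopf_axioms by (auto simp: hopf_axioms_def)
  then have "?T (tensor_assoc (tensor_map (comul A) id (comul A c))) =
      ?T (tensor_map id (comul A) (comul A c))" by simp
  also have "?T (tensor_map id (comul A) (comul A c)) = swe (\<lambda>x b. swe (\<lambda>y z. h x y z) b) c"
    by (simp add: tensor_lift_map[OF bil3])
  also have "?T (tensor_assoc s) = tensor_lift (\<lambda>u z. tensor_lift (\<lambda>x y. h x y z) u) s" for s
    unfolding tensor_assoc_def
    by (simp add: tensor_lift_push[OF tensor_lift(2)[OF bil3]] tensor_lift(1)[OF bil3]
        tensor_lift(1)[OF bil(2)])
  also have "tensor_lift (\<lambda>u z. tensor_lift (\<lambda>x y. h x y z) u) (tensor_map (comul A) id (comul A c))
      = swe (\<lambda>a z. swe (\<lambda>x y. h x y z) a) c"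
    by (subst tensor_lift_map) (auto intro!: cbilinearI assms clin bil)
  finally show ?thesis .
qed

text \<open>With convolution products, \<open>f = f (g h) = (f g) h = u h\<close>; for
  \<open>u\<close> the unit this is the uniqueness of convolution inverses. The product
  \<open>mu\<close> is an explicit argument because it will also be the multiplication of the tensor
  square, which is not an instance of an algebra class.\<close>

lemma conv_inverse_unique:
  fixes mu :: "'b::complex_vector \<Rightarrow> 'b \<Rightarrow> 'b"
  assumes mu: "cbilinear mu" and assoc: "\<And>x y z. mu (mu x y) z = mu x (mu y z)"
    and unit: "\<And>x. mu x e = x"
    and lin: "clinear f" "clinear g" "clinear h"
    and fg: "\<And>x. swe (\<lambda>y z. mu (f y) (g z)) x = counit A x *\<^sub>C u"
    and gh: "\<And>x. swe (\<lambda>y z. mu (g y) (h z)) x = counit A x *\<^sub>C e"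
  shows "f x = mu u (h x)"
proof -
  note [clin] = cbilinear_left[OF mu] cbilinear_right[OF mu]
    clinear_comp[OF lin(1)] clinear_comp[OF lin(2)] clinear_comp[OF lin(3)]
  have s: "mu (c *\<^sub>C x) y = c *\<^sub>C mu x y" "mu x (c *\<^sub>C y) = c *\<^sub>C mu x y" for c x y
    using clinear_scale[OF cbilinear_left[OF mu clinear_id]]
      clinear_scale[OF cbilinear_right[OF mu clinear_id]] by simp_all
  have push: "mu a (tensor_lift B t) = tensor_lift (\<lambda>x y. mu a (B x y)) t"
    "mu (tensor_lift B t) a = tensor_lift (\<lambda>x y. mu (B x y) a) t" for a B and t :: "('a, 'a) tensor"
    by (rule tensor_lift_push[OF cbilinear_right[OF mu clinear_id]]
        tensor_lift_push[OF cbilinear_left[OF mu clinear_id]])+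
  have "f x = swe (\<lambda>y z. counit A z *\<^sub>C f y) x"
    by (rule counit_right[OF lin(1), symmetric])
  also have "\<dots> = swe (\<lambda>y b. mu (f y) (swe (\<lambda>z w. mu (g z) (h w)) b)) x"
    by (simp only: gh s unit)
  also have "\<dots> = swe (\<lambda>y b. swe (\<lambda>z w. mu (f y) (mu (g z) (h w))) b) x"
    by (simp only: push)
  also have "\<dots> = swe (\<lambda>a w. swe (\<lambda>y z. mu (f y) (mu (g z) (h w))) a) x"
    by (rule coassoc[symmetric]) (intro clin)+
  also have "\<dots> = swe (\<lambda>a w. mu (swe (\<lambda>y z. mu (f y) (g z)) a) (h w)) x"
    by (simp only: push assoc)
  also have "\<dots> = mu u (h x)"
    by (subst fg) (simp only: s counit_left[OF cbilinear_right[OF mu lin(3)]])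
  finally show ?thesis .
qed

text \<open>The convolution argument with the identity map in the middle: the trailing factor
  \<open>z\<close> is cancelled at the price of an antipode.\<close>

lemma conv_cancel:
  assumes "clinear g" and "\<And>x. swe (\<lambda>y z. g y * z) x = counit A x *\<^sub>C c"
  shows "g x = c * antipode A x"
  by (rule conv_inverse_unique[where mu = "(*)" and f = g and g = "\<lambda>x. x" and h = "antipode A"
        and x = x and u = c and e = 1])
    (simp_all add: assms cbilinear_mult clinear_id mult.assoc antipode_right antipode_clinear)

lemma antipode_one: "antipode A 1 = 1"
proof -
  have "swe (\<lambda>y z. antipode A y * z) 1 = antipode A 1 * 1"
    unfolding comul_one by (rule tensor_lift(1)) (intro clin)
  then show ?thesis
    by (simp add: antipode_left scaleC_one)
qed

end

lemma less_2_cases_iff': "(p::nat) < 2 \<longleftrightarrow> p = 0 \<or> p = Suc 0"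
  by auto

lemma sum_lessThan_2: "(\<Sum>p<2. g p) = g 0 + g (Suc 0)"
  by (simp add: numeral_2_eq_2)

lemma scaleC_simps [simp]:
  "1 *\<^sub>C x = x" "0 *\<^sub>C x = 0" "c *\<^sub>C 0 = (0::'a)" "(- 1) *\<^sub>C x = - x"
  for x :: "'a::complex_vector"
  by (simp_all add: scaleC_one complex_vector.scale_zero_right)

lemma tensor_lift_tensor_right: "tensor_lift (\<lambda>x y. a \<otimes> B x y) t = a \<otimes> tensor_lift B t"
  by (rule tensor_lift_push[symmetric]) (intro clin)

lemma tensor_lift_tensor_left: "tensor_lift (\<lambda>x y. B x y \<otimes> a) t = tensor_lift B t \<otimes> a"
  by (rule tensor_lift_push[where g = "\<lambda>s. s \<otimes> a", symmetric]) (intro clin)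

section \<open>Graded algebras: homogeneous parts and signs\<close>

locale graded_alg =
  fixes D :: "nat \<Rightarrow> 'a::complex_algebra_1 set"
  assumes graded: "z2_graded_algebra D"
begin

lemma subspace: "p < 2 \<Longrightarrow> module.subspace scaleC (D p)"
  using graded by (auto simp: z2_graded_algebra_def z2_grading_def)

lemma D_add: "p < 2 \<Longrightarrow> x \<in> D p \<Longrightarrow> y \<in> D p \<Longrightarrow> x + y \<in> D p"
  and D_scale: "p < 2 \<Longrightarrow> x \<in> D p \<Longrightarrow> c *\<^sub>C x \<in> D p"
  and D_zero: "p < 2 \<Longrightarrow> 0 \<in> D p"
  using subspace[of p]
  by (auto simp: complex_vector.subspace_def)

lemma D_mult: "p < 2 \<Longrightarrow> q < 2 \<Longrightarrow> x \<in> D p \<Longrightarrow> y \<in> D q \<Longrightarrow> x * y \<in> D ((p + q) mod 2)"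
  using graded by (auto simp: z2_graded_algebra_def)

lemma ex1_part: "\<exists>!y. y \<in> D 0 \<and> x - y \<in> D (Suc 0)"
  using graded by (auto simp: z2_graded_algebra_def z2_grading_def)

abbreviation part where "part \<equiv> z2_part D"

lemma part_0: "part 0 x \<in> D 0" "x - part 0 x \<in> D (Suc 0)"
  using theI'[OF ex1_part[of x]] by (auto simp: z2_part_def)

lemma part_0_unique: "y \<in> D 0 \<Longrightarrow> x - y \<in> D (Suc 0) \<Longrightarrow> part 0 x = y"
  using ex1_part[of x] part_0[of x] by blast

lemma part_1: "part (Suc 0) x = x - part 0 x"
proof -
  have "(THE y. y \<in> D (Suc 0) \<and> x - y \<in> D 0) = x - part 0 x"
  proof (rule the_equality)
    fix y assume "y \<in> D (Suc 0) \<and> x - y \<in> D 0"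
    then have "part 0 x = x - y" by (intro part_0_unique) auto
    then show "y = x - part 0 x" by simp
  qed (use part_0 in auto)
  then show ?thesis by (simp add: z2_part_def)
qed

lemma part_mem: "p < 2 \<Longrightarrow> part p x \<in> D p"
  using part_0[of x] part_1[of x] by (auto simp: less_2_cases_iff')

lemma part_sum: "part 0 x + part (Suc 0) x = x"
  by (simp add: part_1)

lemma part_unique: "y \<in> D 0 \<Longrightarrow> z \<in> D (Suc 0) \<Longrightarrow> part 0 (y + z) = y \<and> part (Suc 0) (y + z) = z"
  using part_0_unique[of y "y + z"] part_1[of "y + z"] by auto

lemma part_homogeneous:
  assumes "p < 2" and "q < 2" and "x \<in> D p"
  shows "part q x = (if p = q then x else 0)"
  using assms part_unique[of x 0] part_unique[of 0 x] D_zero[of 0] D_zero[of "Suc 0"]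
  by (auto simp: less_2_cases_iff')

lemma part_clinear: "p < 2 \<Longrightarrow> clinear (part p)"
proof -
  have add: "part 0 (x + y) = part 0 x + part 0 y \<and> part (Suc 0) (x + y) = part (Suc 0) x + part (Suc 0) y" for x y
  proof -
    have "x + y = (part 0 x + part 0 y) + (part (Suc 0) x + part (Suc 0) y)"
      using part_sum[of x] part_sum[of y] by (metis add.assoc add.left_commute)
    then show ?thesis
      using part_unique[of "part 0 x + part 0 y" "part (Suc 0) x + part (Suc 0) y"]
      by (simp add: D_add part_mem)
  qed
  have scale: "part 0 (c *\<^sub>C x) = c *\<^sub>C part 0 x \<and> part (Suc 0) (c *\<^sub>C x) = c *\<^sub>C part (Suc 0) x" for c x
  proof -
    have "c *\<^sub>C x = c *\<^sub>C part 0 x + c *\<^sub>C part (Suc 0) x"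
      by (metis part_sum scaleC_add_right)
    then show ?thesis
      using part_unique[of "c *\<^sub>C part 0 x" "c *\<^sub>C part (Suc 0) x"] by (simp add: D_scale part_mem)
  qed
  assume "p < 2"
  then show ?thesis
    using add scale by (intro clinearI) (auto simp: less_2_cases_iff')
qed

lemma part_lin [clin]: "p < 2 \<Longrightarrow> clinear f \<Longrightarrow> clinear (\<lambda>x. part p (f x))"
  by (rule clinear_comp[OF part_clinear])

text \<open>Multiplication by the sign \<open>(-1) ^ (p * q)\<close> on elements of degree
  \<open>p\<close>, that is, the \<open>q\<close>-th power of the parity automorphism. As an
  involutive algebra automorphism it can be moved through products and undone, which a sign
  depending on a Sweedler leg cannot.\<close>

definition sgn_part :: "nat \<Rightarrow> 'a \<Rightarrow> 'a"
  where "sgn_part q x = (\<Sum>p<2. (-1) ^ (p * q) *\<^sub>C part p x)"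

lemma sgn_part_eq: "sgn_part q x = part 0 x + (-1) ^ q *\<^sub>C part (Suc 0) x"
  by (simp add: sgn_part_def sum_lessThan_2)

lemma sgn_part_clinear: "clinear (sgn_part q)"
  unfolding sgn_part_def[abs_def] by (intro clin) auto

lemma sgn_part_homogeneous:
  "p < 2 \<Longrightarrow> x \<in> D p \<Longrightarrow> sgn_part q x = (-1) ^ (p * q) *\<^sub>C x"
  by (auto simp: sgn_part_eq part_homogeneous less_2_cases_iff')

lemma sgn_part_sgn_part: "sgn_part q (sgn_part q x) = x"
proof -
  show ?thesis
    unfolding sgn_part_eq[of q x]
    using part_unique[of "part 0 x" "(-1) ^ q *\<^sub>C part (Suc 0) x"] part_sum[of x]
    by (simp add: sgn_part_eq part_mem D_scale)
qed

lemma sgn_part_mult: "sgn_part q (x * y) = sgn_part q x * sgn_part q y"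
proof -
  note parts = part_mem[of 0 x, simplified] part_mem[of "Suc 0" x, simplified]
    part_mem[of 0 y, simplified] part_mem[of "Suc 0" y, simplified]
  have "x * y = (part 0 x + part (Suc 0) x) * (part 0 y + part (Suc 0) y)"
    by (simp add: part_sum)
  also have "\<dots> = (part 0 x * part 0 y + part (Suc 0) x * part (Suc 0) y) +
      (part 0 x * part (Suc 0) y + part (Suc 0) x * part 0 y)"
    by (simp add: algebra_simps)
  finally have xy: "x * y = \<dots>" .
  have "part 0 x * part 0 y \<in> D 0" "part (Suc 0) x * part (Suc 0) y \<in> D 0"
    "part 0 x * part (Suc 0) y \<in> D (Suc 0)" "part (Suc 0) x * part 0 y \<in> D (Suc 0)"
    using D_mult[of 0 0, OF _ _ parts(1,3)] D_mult[of "Suc 0" "Suc 0", OF _ _ parts(2,4)]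
      D_mult[of 0 "Suc 0", OF _ _ parts(1,4)] D_mult[of "Suc 0" 0, OF _ _ parts(2,3)] by simp_all
  then have "part 0 (x * y) = part 0 x * part 0 y + part (Suc 0) x * part (Suc 0) y \<and>
      part (Suc 0) (x * y) = part 0 x * part (Suc 0) y + part (Suc 0) x * part 0 y"
    unfolding xy by (intro part_unique D_add) auto
  then show ?thesis
    by (simp add: sgn_part_eq algebra_simps mult_scaleC_left mult_scaleC_right scaleC_add_right)
qed

end

locale graded_hopf = graded_alg D + hopf "graded_tensor_mult D" A
  for D :: "nat \<Rightarrow> 'a::complex_algebra_1 set" and A +
  assumes antipode_degree: "p < 2 \<Longrightarrow> x \<in> D p \<Longrightarrow> antipode A x \<in> D p"
begin

text \<open>
  Two one-sided cancellations: for \<open>F x y = \<plusminus> S(x\<^sub>(\<^sub>1\<^sub>) y) x\<^sub>(\<^sub>2\<^sub>)\<close>, the antipode axiom at \<open>x y\<close> gives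
  \<open>F x y = \<epsilon>(x) S(y)\<close> by cancelling \<open>y\<^sub>(\<^sub>2\<^sub>)\<close>, and cancelling \<open>x\<^sub>(\<^sub>2\<^sub>)\<close> gives the claim. So only
  single coproducts occur, and no signs for the tensor square are needed.
\<close>

lemma antipode_graded_mult:
  assumes p: "p < 2" "x \<in> D p" and q: "q < 2" "y \<in> D q"
  shows "antipode A (x * y) = (-1) ^ (p * q) *\<^sub>C (antipode A y * antipode A x)"
proof -
  let ?S = "antipode A"
  define F where "F x y = swe (\<lambda>u v. \<Sum>p<2. \<Sum>q<2. (-1) ^ (p * q) *\<^sub>C
    (?S (u * part q y) * part p v)) x" for x y
  have F_lin: "clinear (\<lambda>y. F x y)" for x
    unfolding F_def by (intro clin) auto
  have "swe (\<lambda>y z. F x y * z) w = counit A w *\<^sub>C (counit A x *\<^sub>C 1)" for x w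
  proof -
    have bil: "cbilinear (\<lambda>y z. ?S y * z)" by (intro clin)
    have push: "tensor_lift (\<lambda>y z. ?S y * z) (tensor_lift B t) =
        tensor_lift (\<lambda>a b. tensor_lift (\<lambda>y z. ?S y * z) (B a b)) t" for B and t :: "('a, 'a) tensor"
      by (rule tensor_lift_push[OF tensor_lift(2)[OF bil]])
    have "counit A w *\<^sub>C (counit A x *\<^sub>C 1) = swe (\<lambda>y z. ?S y * z) (x * w)"
      by (simp add: antipode_left scaleC_scaleC mult.commute)
    also have "\<dots> = swe (\<lambda>u v. swe (\<lambda>y z. \<Sum>p<2. \<Sum>q<2. (-1) ^ (p * q) *\<^sub>C
        (?S (u * part q y) * (part p v * z))) w) x"
      unfolding comul_mult graded_tensor_mult_def push
      by (simp add: clinear_sum[OF tensor_lift(2)[OF bil]] clinear_scale[OF tensor_lift(2)[OF bil]]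
          tensor_lift(1)[OF bil])
    also have "\<dots> = swe (\<lambda>y z. F x y * z) w"
    proof -
      have "F x y * z = swe (\<lambda>u v. \<Sum>p<2. \<Sum>q<2. (-1) ^ (p * q) *\<^sub>C
          (?S (u * part q y) * (part p v * z))) x" for y z
        unfolding F_def tensor_lift_mult_right[symmetric]
        by (simp add: sum_distrib_right mult_scaleC_left mult.assoc)
      then show ?thesis
        by (simp only:) (rule tensor_lift_swap)
    qed
    finally show ?thesis ..
  qed
  from conv_cancel[OF F_lin this] have F: "F x y = counit A x *\<^sub>C ?S y" for x y
    by (simp add: mult_scaleC_left)
  have lin: "clinear (\<lambda>x. sgn_part q (?S (x * y)))"
    by (intro clinear_comp[OF sgn_part_clinear] clin)
  have "swe (\<lambda>u v. sgn_part q (?S (u * y)) * v) x = counit A x *\<^sub>C sgn_part q (?S y)" for x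
  proof -
    \<comment> \<open>Since \<open>y\<close> has degree \<open>q\<close>, only one part of it
      survives and the sign becomes \<open>sgn_part q\<close> on the leg \<open>v\<close>. Applying
      \<open>sgn_part q\<close> to the whole equation moves the sign to the other factor and leaves
      a bare \<open>v\<close> to cancel.\<close>
    have "F x y = swe (\<lambda>u v. ?S (u * y) * sgn_part q v) x"
      unfolding F_def sgn_part_def
      using q by (auto simp: part_homogeneous sum_lessThan_2 less_2_cases_iff' clinear_0[OF antipode_clinear]
         algebra_simps mult_scaleC_right)
    then have "swe (\<lambda>u v. ?S (u * y) * sgn_part q v) x = counit A x *\<^sub>C ?S y"
      by (simp add: F)
    from arg_cong[OF this, of "sgn_part q"] show ?thesis
      by (simp add: tensor_lift_push[OF sgn_part_clinear] sgn_part_mult sgn_part_sgn_part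
          clinear_scale[OF sgn_part_clinear])
  qed
  from arg_cong[OF conv_cancel[OF lin this, of x], of "sgn_part q"]
  have "?S (x * y) = ?S y * sgn_part q (?S x)"
    by (simp add: sgn_part_mult sgn_part_sgn_part)
  then show ?thesis
    using p by (simp add: sgn_part_homogeneous antipode_degree mult_scaleC_right)
qed

end

text \<open>An ungraded Hopf algebra is a graded one that is concentrated in even degree.\<close>

lemma hopf_algebra_antipode_mult:
  fixes A :: "'a::complex_algebra_1 hopf_struct"
  assumes "hopf_algebra A"
  shows "antipode A (x * y) = antipode A y * antipode A x"
proof -
  have hopf: "Defs.hopf_axioms (tensor_act (*) (*)) A"
    using assms by (simp add: hopf_algebra_def)
  then have lin: "clinear (antipode A)"
    by (simp add: hopf_axioms_def)
  define D :: "nat \<Rightarrow> 'a set" where "D = (\<lambda>p. if p = 0 then UNIV else {0})"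
  interpret D: graded_alg D
    by unfold_locales
      (auto simp: D_def z2_graded_algebra_def z2_grading_def complex_vector.subspace_UNIV
        complex_vector.subspace_single_0)
  have part: "z2_part D 0 x = x" "z2_part D (Suc 0) x = 0" for x
    using D.part_homogeneous[of 0 _ x] by (simp_all add: D_def)
  have "graded_tensor_mult D = tensor_act (*) (*)"
    by (intro ext)
      (simp add: graded_tensor_mult_def tensor_act_def sum_lessThan_2 part
        clinear_0[OF clinear_tensor_left[OF clinear_id]]
        clinear_0[OF clinear_tensor_right[OF clinear_id]])
  then interpret graded_hopf D A
    using hopf clinear_0[OF lin]
    by unfold_locales (auto simp: D_def)
  show ?thesis
    using antipode_graded_mult[of 0 x 0 y] by (simp add: D_def)
qed

section \<open>The antipode, its inverse and the coproduct\<close>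

locale hopf_bij =
  fixes A :: "'a::complex_algebra_1 hopf_struct"
  assumes hopf_algebra: "hopf_algebra A" and bij: "bij (antipode A)"
begin

sublocale hopf "tensor_act (*) (*)" A
  using hopf_algebra by unfold_locales (simp add: hopf_algebra_def)

abbreviation S where "S \<equiv> antipode A"
abbreviation T where "T \<equiv> inv (antipode A)"
abbreviation \<epsilon> where "\<epsilon> \<equiv> counit A"

lemma swe_mult:
  assumes "cbilinear B"
  shows "swe B (x * y) = swe (\<lambda>u v. swe (\<lambda>u' v'. B (u * u') (v * v')) y) x"
  unfolding comul_mult by (rule tensor_lift_act[OF assms])

lemma swe_one: "cbilinear B \<Longrightarrow> swe B 1 = B 1 1"
  unfolding comul_one by (rule tensor_lift(1))

lemmas antipode_mult = hopf_algebra_antipode_mult[OF hopf_algebra]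

text \<open>In the convolution algebra of maps from \<open>A\<close> to the tensor square,
  \<open>comul A\<close> has the left inverse \<open>comul A (S x)\<close>, by applying the
  coproduct to the antipode axiom, and the right inverse on the other side, by a direct computation.
  The two must agree.\<close>

lemma comul_antipode: "comul A (S x) = swe (\<lambda>y z. S z \<otimes> S y) x"
proof -
  let ?m = "tensor_act (*) (*) :: ('a, 'a) tensor \<Rightarrow> _"
  have [clin]: "clinear f \<Longrightarrow> clinear (\<lambda>x. ?m (f x) t)" "clinear f \<Longrightarrow> clinear (\<lambda>x. ?m t (f x))" for f t
    by (auto intro: cbilinear_left[OF cbilinear_act_mult] cbilinear_right[OF cbilinear_act_mult])
  note el = tensor_act_elementary[OF cbilinear_mult cbilinear_mult]
  have assoc: "?m (?m s t) u = ?m s (?m t u)" for s t u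
  proof (rule tensor_ext[where t = s])
    fix x y show "?m (?m (x \<otimes> y) t) u = ?m (x \<otimes> y) (?m t u)"
    proof (rule tensor_ext[where t = t])
      fix x' y' show "?m (?m (x \<otimes> y) (x' \<otimes> y')) u = ?m (x \<otimes> y) (?m (x' \<otimes> y') u)"
        by (rule tensor_ext[where t = u]) (intro clin, intro clin, simp add: el mult.assoc)
    qed (intro clin)+
  qed (intro clin)+
  have unit: "?m t (1 \<otimes> 1) = t" for t
    by (rule tensor_ext[where t = t]) (intro clin, intro clin, simp add: el)
  have "comul A (S x) = ?m (1 \<otimes> 1) (swe (\<lambda>y z. S z \<otimes> S y) x)"
  proof (rule conv_inverse_unique[where f = "\<lambda>x. comul A (S x)" and g = "comul A"
        and h = "\<lambda>x. swe (\<lambda>y z. S z \<otimes> S y) x" and mu = ?m and u = "1 \<otimes> 1" and e = "1 \<otimes> 1" and x = x])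
    fix x
    have "swe (\<lambda>y z. ?m (comul A (S y)) (comul A z)) x = comul A (swe (\<lambda>y z. S y * z) x)"
      by (subst tensor_lift_push[OF comul_clinear]) (simp only: comul_mult)
    then show "swe (\<lambda>y z. ?m (comul A (S y)) (comul A z)) x = \<epsilon> x *\<^sub>C (1 \<otimes> 1)"
      by (simp add: antipode_left clinear_scale[OF comul_clinear] comul_one)
    have act: "?m (comul A y) (swe (\<lambda>u v. S v \<otimes> S u) z) =
        swe (\<lambda>y1 y2. swe (\<lambda>u v. (y1 * S v) \<otimes> (y2 * S u)) z) y" for y z
    proof -
      have "tensor_lift (\<lambda>x' y'. (y1 * x') \<otimes> (y2 * y')) (swe (\<lambda>u v. S v \<otimes> S u) z) =
          swe (\<lambda>u v. (y1 * S v) \<otimes> (y2 * S u)) z" for y1 y2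
        by (rule tensor_lift_lift) (intro clin)
      then show ?thesis
        by (simp only: tensor_act_def)
    qed
    \<comment> \<open>The innermost pair \<open>y2 * S u\<close> has adjacent legs and collapses to
      a counit; after that only \<open>y1 * S b\<close> remains for the outer sum.\<close>
    have inner: "swe (\<lambda>y2 z. swe (\<lambda>u v. (y1 * S v) \<otimes> (y2 * S u)) z) b = (y1 * S b) \<otimes> 1" for y1 b
    proof -
      have "swe (\<lambda>y2 z. swe (\<lambda>u v. (y1 * S v) \<otimes> (y2 * S u)) z) b =
          swe (\<lambda>c v. swe (\<lambda>y2 u. (y1 * S v) \<otimes> (y2 * S u)) c) b"
        by (rule coassoc[symmetric]) (intro clin)+
      also have "\<dots> = swe (\<lambda>c v. (y1 * S v) \<otimes> swe (\<lambda>y2 u. y2 * S u) c) b"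
        by (simp only: tensor_lift_tensor_right)
      also have "\<dots> = swe (\<lambda>c v. \<epsilon> c *\<^sub>C ((y1 * S v) \<otimes> 1)) b"
        by (simp add: antipode_right elementary_tensor_scale_right)
      also have "\<dots> = (y1 * S b) \<otimes> 1"
        by (rule counit_left) (intro clin)
      finally show ?thesis .
    qed
    have "swe (\<lambda>y z. ?m (comul A y) (swe (\<lambda>u v. S v \<otimes> S u) z)) x =
        swe (\<lambda>y z. swe (\<lambda>y1 y2. swe (\<lambda>u v. (y1 * S v) \<otimes> (y2 * S u)) z) y) x"
      by (simp only: act)
    also have "\<dots> = swe (\<lambda>y1 b. swe (\<lambda>y2 z. swe (\<lambda>u v. (y1 * S v) \<otimes> (y2 * S u)) z) b) x"
      by (rule coassoc) (intro clin)+
    also have "\<dots> = swe (\<lambda>y1 b. y1 * S b) x \<otimes> 1"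
      unfolding inner by (rule tensor_lift_tensor_left)
    also have "\<dots> = \<epsilon> x *\<^sub>C (1 \<otimes> 1)"
      by (simp add: antipode_right elementary_tensor_scale_left)
    finally show "swe (\<lambda>y z. ?m (comul A y) (swe (\<lambda>u v. S v \<otimes> S u) z)) x = \<epsilon> x *\<^sub>C (1 \<otimes> 1)" .
  qed (intro clin cbilinear_act_mult comul_clinear assoc unit)+
  moreover have "?m (1 \<otimes> 1) t = t" for t
    by (rule tensor_ext[where t = t]) (intro clin, intro clin, simp add: el)
  ultimately show ?thesis by simp
qed

lemma S_T [simp]: "S (T x) = x" and T_S [simp]: "T (S x) = x"
  using bij by (simp_all add: bij_is_surj surj_f_inv_f bij_is_inj)

lemma T_clinear: "clinear T"
  by (rule clinearI)
    (metis S_T T_S clinear_add[OF antipode_clinear], metis S_T T_S clinear_scale[OF antipode_clinear])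

lemma T_lin [clin]: "clinear f \<Longrightarrow> clinear (\<lambda>x. T (f x))"
  by (rule clinear_comp[OF T_clinear])

lemma T_mult: "T (x * y) = T y * T x"
  by (metis S_T T_S antipode_mult)

lemma T_one [simp]: "T 1 = 1"
  by (metis T_S antipode_one)

lemma counit_antipode: "\<epsilon> (S x) = \<epsilon> x"
proof -
  have "\<epsilon> (S x) = swe (\<lambda>y z. \<epsilon> z *\<^sub>C \<epsilon> (S y)) x"
    by (rule counit_right[symmetric]) (intro clin)
  also have "\<dots> = \<epsilon> (swe (\<lambda>y z. S y * z) x)"
    by (simp add: tensor_lift_push[OF counit_clinear] mult.commute)
  finally show ?thesis
    by (simp add: antipode_left clinear_scale[OF counit_clinear])
qed

lemma counit_T [simp]: "\<epsilon> (T x) = \<epsilon> x"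
  by (metis S_T counit_antipode)

text \<open>The right-hand side at \<open>S (T x)\<close> is computed by
  \<open>comul_antipode\<close>, where \<open>T\<close> and \<open>S\<close> cancel in both
  legs.\<close>

lemma comul_T: "comul A (T x) = swe (\<lambda>y z. T z \<otimes> T y) x"
proof -
  have "swe (\<lambda>y z. T z \<otimes> T y) (S (T x)) = comul A (T x)"
    unfolding comul_antipode
    by (subst tensor_lift_lift) (intro clin, simp add: tensor_lift_elementary)
  then show ?thesis by simp
qed

text \<open>Applying \<open>T\<close> to an antipode axiom reverses the product: \<open>T\<close> is
  an antipode for the opposite coproduct, which explains the exchanged order of the legs.\<close>

lemma T_left: "swe (\<lambda>y z. T z * y) x = \<epsilon> x *\<^sub>C 1"
proof -
  have "swe (\<lambda>y z. T z * y) x = T (swe (\<lambda>y z. S y * z) x)"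
    by (simp add: tensor_lift_push[OF T_clinear] T_mult)
  then show ?thesis
    by (simp add: antipode_left clinear_scale[OF T_clinear])
qed

lemma T_right: "swe (\<lambda>y z. z * T y) x = \<epsilon> x *\<^sub>C 1"
proof -
  have "swe (\<lambda>y z. z * T y) x = T (swe (\<lambda>y z. y * S z) x)"
    by (simp add: tensor_lift_push[OF T_clinear] T_mult)
  then show ?thesis
    by (simp add: antipode_right clinear_scale[OF T_clinear])
qed

end

section \<open>Bicovariant calculi\<close>

lemma sum_delta_scaleC:
  fixes g :: "'i \<Rightarrow> 'a::complex_vector"
  assumes "finite I" and "j \<in> I"
  shows "(\<Sum>k\<in>I. (if k = j then 1 else 0) *\<^sub>C g k) = g j"
    and "(\<Sum>k\<in>I. (if j = k then 1 else 0) *\<^sub>C g k) = g j"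
proof -
  have "(if k = j then 1 else 0) *\<^sub>C g k = (if k = j then g k else 0)"
    "(if j = k then 1 else 0) *\<^sub>C g k = (if j = k then g k else 0)" for k
    by auto
  then show "(\<Sum>k\<in>I. (if k = j then 1 else 0) *\<^sub>C g k) = g j"
    "(\<Sum>k\<in>I. (if j = k then 1 else 0) *\<^sub>C g k) = g j"
    using assms by simp_all
qed

lemma sum_delta_mult:
  fixes g :: "'i \<Rightarrow> complex"
  assumes "finite I" and "j \<in> I"
  shows "(\<Sum>k\<in>I. (if k = j then 1 else 0) * g k) = g j"
    and "(\<Sum>k\<in>I. (if j = k then 1 else 0) * g k) = g j"
    and "(\<Sum>k\<in>I. g k * (if k = j then 1 else 0)) = g j"
    and "(\<Sum>k\<in>I. g k * (if j = k then 1 else 0)) = g j"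
  using sum_delta_scaleC[OF assms, of g] by (simp_all add: mult.commute)

lemma sum_swap3: "(\<Sum>p\<in>A. \<Sum>a\<in>B. \<Sum>b\<in>C. F p a b) = (\<Sum>a\<in>B. \<Sum>b\<in>C. \<Sum>p\<in>A. F p a b)"
  by (subst sum.swap) (simp add: sum.swap[of _ A])

lemma sum_swap4:
  "(\<Sum>p\<in>A. \<Sum>q\<in>B. \<Sum>a\<in>C. \<Sum>b\<in>E. F p q a b) = (\<Sum>a\<in>C. \<Sum>b\<in>E. \<Sum>p\<in>A. \<Sum>q\<in>B. F p q a b)"
  by (simp only: sum_swap3[of _ B] sum_swap3[of _ A])

lemma cspan_is_sum:
  fixes b :: "nat \<Rightarrow> 'a::complex_vector"
  assumes "x \<in> cspan (b ` {1..N})"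
  shows "\<exists>c. x = (\<Sum>k=1..N. c k *\<^sub>C b k)"
  using assms
proof (induction rule: complex_vector.span_induct_alt)
  case base
  have "0 = (\<Sum>k=1..N. 0 *\<^sub>C b k)" by simp
  then show ?case by (intro exI[of _ "\<lambda>_. 0"])
next
  case (step c x y)
  then obtain e j where e: "y = (\<Sum>k=1..N. e k *\<^sub>C b k)" and j: "x = b j" "j \<in> {1..N}" by auto
  have "c *\<^sub>C x + y = (\<Sum>k=1..N. (c * (if k = j then 1 else 0) + e k) *\<^sub>C b k)"
    unfolding scaleC_add_left sum.distrib e scaleC_scaleC[symmetric] complex_vector.scale_sum_right[symmetric]
    using sum_delta_scaleC(1)[OF _ j(2), of b] j by simp
  then show ?case by (intro exI)
qed

locale calculus = hopf_bij A
  for A :: "'a::complex_algebra_1 hopf_struct" +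
  fixes G :: "('a, 'g::complex_vector) calculus_struct" and N :: nat and \<omega> :: "nat \<Rightarrow> 'g"
    and f :: "nat \<Rightarrow> nat \<Rightarrow> 'a \<Rightarrow> complex" and J :: "nat \<Rightarrow> nat \<Rightarrow> 'a" and X :: "nat \<Rightarrow> 'a \<Rightarrow> complex"
  assumes bicovariant: "bicovariant_calculus A G"
    and data: "calculus_data A G N \<omega> f J X"
begin

declare One_nat_def [simp del] and atLeastAtMost_iff [simp del]

abbreviation lm (infixr "\<cdot>" 75) where "x \<cdot> \<gamma> \<equiv> lmult G x \<gamma>"
abbreviation rm (infixl "\<star>" 75) where "\<gamma> \<star> x \<equiv> rmult G \<gamma> x"
abbreviation D where "D \<equiv> diff G"
abbreviation lc where "lc \<equiv> lcoact G"
abbreviation rc where "rc \<equiv> rcoact G"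
abbreviation \<sigma> where "\<sigma> \<equiv> braid_coeff f J"

lemma lm_bilinear: "cbilinear (lmult G)" and rm_bilinear: "cbilinear (rmult G)"
  and lm_one [simp]: "1 \<cdot> \<gamma> = \<gamma>" and rm_one [simp]: "\<gamma> \<star> 1 = \<gamma>"
  and lm_mult: "(x * y) \<cdot> \<gamma> = x \<cdot> y \<cdot> \<gamma>" and rm_mult: "\<gamma> \<star> (x * y) = \<gamma> \<star> x \<star> y"
  and lm_rm: "(x \<cdot> \<gamma>) \<star> y = x \<cdot> (\<gamma> \<star> y)"
  using bicovariant by (auto simp: bicovariant_calculus_def bimodule_def)

lemmas lm_lin [clin] = cbilinear_left[OF lm_bilinear] cbilinear_right[OF lm_bilinear]
lemmas rm_lin [clin] = cbilinear_left[OF rm_bilinear] cbilinear_right[OF rm_bilinear]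

lemma D_clinear: "clinear D" and lc_clinear: "clinear lc" and rc_clinear: "clinear rc"
  using bicovariant by (auto simp: bicovariant_calculus_def left_comodule_def right_comodule_def)

lemmas D_lin [clin] = clinear_comp[OF D_clinear]
lemmas lc_lin [clin] = clinear_comp[OF lc_clinear]
lemmas rc_lin [clin] = clinear_comp[OF rc_clinear]

lemma Leibniz: "D (x * y) = D x \<star> y + x \<cdot> D y"
  using bicovariant by (auto simp: bicovariant_calculus_def)

lemma D_one [simp]: "D 1 = 0"
  using Leibniz[of 1 1] by simp

lemma forms_ext:
  assumes "clinear g" and "clinear h" and "\<And>x y. g (x \<cdot> D y) = h (x \<cdot> D y)"
  shows "g \<gamma> = h \<gamma>"
proof -
  obtain n :: nat and x y where "\<gamma> = (\<Sum>k<n. x k \<cdot> D (y k))"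
    using bicovariant unfolding bicovariant_calculus_def by blast
  then show ?thesis
    by (simp add: clinear_sum[OF assms(1)] clinear_sum[OF assms(2)] assms(3))
qed

text \<open>The covariance axiom read through an arbitrary bilinear map out of the tensor product;
  covariance is used in this form throughout.\<close>

lemma lift_lc_D:
  assumes "cbilinear B"
  shows "tensor_lift B (lc (x \<cdot> D y)) = swe (\<lambda>x1 x2. swe (\<lambda>y1 y2. B (x1 * y1) (x2 \<cdot> D y2)) y) x"
proof -
  have "lc (x \<cdot> D y) = tensor_act (*) (lmult G) (comul A x) (tensor_map id D (comul A y))"
    using bicovariant by (auto simp: bicovariant_calculus_def)
  moreover have "tensor_lift (\<lambda>y1 y2. B (x1 * y1) (x2 \<cdot> y2)) (tensor_map id D (comul A y)) =
      swe (\<lambda>y1 y2. B (x1 * id y1) (x2 \<cdot> D y2)) y" for x1 x2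
    by (rule tensor_lift_map) (intro clin cbilinear_left[OF assms] cbilinear_right[OF assms])
  ultimately show ?thesis
    by (simp add: tensor_lift_act[OF assms])
qed

lemma lift_rc_D:
  assumes "cbilinear B"
  shows "tensor_lift B (rc (x \<cdot> D y)) = swe (\<lambda>x1 x2. swe (\<lambda>y1 y2. B (x1 \<cdot> D y1) (x2 * y2)) y) x"
proof -
  have "rc (x \<cdot> D y) = tensor_act (lmult G) (*) (comul A x) (tensor_map D id (comul A y))"
    using bicovariant by (auto simp: bicovariant_calculus_def)
  moreover have "tensor_lift (\<lambda>y1 y2. B (x1 \<cdot> y1) (x2 * y2)) (tensor_map D id (comul A y)) =
      swe (\<lambda>y1 y2. B (x1 \<cdot> D y1) (x2 * id y2)) y" for x1 x2
    by (rule tensor_lift_map) (intro clin cbilinear_left[OF assms] cbilinear_right[OF assms])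
  ultimately show ?thesis
    by (simp add: tensor_lift_act[OF assms])
qed

text \<open>The left-invariant part of \<open>dy\<close>. In these terms
  \<open>calculus_ideal\<close> is the kernel of \<open>Q\<close> inside the kernel of the
  counit.\<close>

definition Q :: "'a \<Rightarrow> 'g" where "Q y = swe (\<lambda>u v. S u \<cdot> D v) y"

lemma Q_clinear: "clinear Q"
  unfolding Q_def by (intro clin)

text \<open>Both \<open>Q\<close> and \<open>Y\<close> vanish at 1, so replacing \<open>y\<close> by
  \<open>y - \<epsilon> y *\<^sub>C 1\<close> changes neither value and moves the argument into the
  kernel of the counit, hence into the ideal.\<close>

lemma tangent_vanishes:
  assumes Y: "Y \<in> tangent_space A G" and "Q y = 0"
  shows "Y y = 0"
proof -
  have lin: "clinear Y" "Y 1 = 0" using Y by (auto simp: tangent_space_def)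
  have "Q 1 = 0"
    unfolding Q_def by (subst swe_one) (intro clin, simp add: antipode_one)
  then have "Q (y - \<epsilon> y *\<^sub>C 1) = 0"
    by (simp add: clinear_diff[OF Q_clinear] clinear_scale[OF Q_clinear] assms)
  moreover have "\<epsilon> (y - \<epsilon> y *\<^sub>C 1) = 0"
    by (simp add: clinear_diff[OF counit_clinear] clinear_scale[OF counit_clinear])
  ultimately have "Y (y - \<epsilon> y *\<^sub>C 1) = 0"
    using Y by (auto simp: tangent_space_def calculus_ideal_def Q_def)
  then show ?thesis
    by (simp add: clinear_diff[OF lin(1)] clinear_scale[OF lin(1)] lin(2))
qed

text \<open>The pairing is a definite description, so a functional with this property must be
  exhibited. A form is projected to its left-invariant part by \<open>proj\<close>, which sends
  \<open>x dy\<close> to \<open>\<epsilon> x *\<^sub>C Q y\<close>; a linear right inverse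
  \<open>g\<close> of \<open>Q\<close> picks a preimage, and \<open>Y\<close> does not depend on
  that choice by \<open>tangent_vanishes\<close>. Uniqueness holds because the elements
  \<open>x dy\<close> span the forms.\<close>

lemma tangent_pairing:
  assumes Y: "Y \<in> tangent_space A G"
  shows "clinear (tangent_pairing A G Y)" and "tangent_pairing A G Y (x \<cdot> D y) = \<epsilon> x * Y y"
proof -
  have lin: "clinear Y" using Y by (auto simp: tangent_space_def)
  obtain g where g: "clinear g" "\<And>y. Q (g (Q y)) = Q y"
    using complex_vector_pair.linear_exists_right_inverse_on[OF Q_clinear complex_vector.subspace_UNIV]
    by auto
  define proj where "proj \<gamma> = tensor_lift (\<lambda>a \<beta>. S a \<cdot> \<beta>) (lc \<gamma>)" for \<gamma>
  define \<phi> where "\<phi> \<gamma> = Y (g (proj \<gamma>))" for \<gamma>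
  have proj_lin: "clinear proj"
    unfolding proj_def[abs_def] by (intro clin)
  have proj: "proj (x \<cdot> D y) = \<epsilon> x *\<^sub>C Q y" for x y
  proof -
    have "proj (x \<cdot> D y) = swe (\<lambda>x1 x2. swe (\<lambda>y1 y2. S (x1 * y1) \<cdot> x2 \<cdot> D y2) y) x"
      unfolding proj_def by (rule lift_lc_D) (intro clin)
    also have "\<dots> = swe (\<lambda>x1 x2. swe (\<lambda>y1 y2. S y1 \<cdot> ((S x1 * x2) \<cdot> D y2)) y) x"
      by (simp add: antipode_mult lm_mult)
    also have "\<dots> = swe (\<lambda>y1 y2. S y1 \<cdot> (swe (\<lambda>x1 x2. S x1 * x2) x \<cdot> D y2)) y"
    proof -
      have "a \<cdot> (swe B x \<cdot> \<gamma>) = swe (\<lambda>u v. a \<cdot> (B u v \<cdot> \<gamma>)) x" for a \<gamma> and B :: "'a \<Rightarrow> 'a \<Rightarrow> 'a"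
        by (rule tensor_lift_push[where g = "\<lambda>s. a \<cdot> (s \<cdot> \<gamma>)"]) (intro clin)
      then show ?thesis
        by (simp only:) (rule tensor_lift_swap)
    qed
    also have "\<dots> = swe (\<lambda>y1 y2. \<epsilon> x *\<^sub>C (S y1 \<cdot> D y2)) y"
      by (simp add: antipode_left clinear_scale[OF lm_lin(1)[OF clinear_id]]
          clinear_scale[OF lm_lin(2)[OF clinear_id]])
    finally show ?thesis
      by (simp add: tensor_lift_scaleC Q_def)
  qed
  have \<phi>_lin: "clinear \<phi>"
    unfolding \<phi>_def[abs_def] by (intro clinear_comp[OF lin] clinear_comp[OF g(1)] proj_lin)
  have \<phi>: "\<phi> (x \<cdot> D y) = \<epsilon> x * Y y" for x y
  proof -
    have "Y (g (Q y) - y) = 0"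
      by (rule tangent_vanishes[OF Y]) (simp add: clinear_diff[OF Q_clinear] g)
    then show ?thesis
      by (simp add: \<phi>_def proj clinear_diff[OF lin] clinear_scale[OF g(1)] clinear_scale[OF lin])
  qed
  have "tangent_pairing A G Y = \<phi>"
    unfolding tangent_pairing_def
  proof (rule the_equality)
    fix \<psi> assume "clinear \<psi> \<and> (\<forall>x y. \<psi> (x \<cdot> D y) = \<epsilon> x * Y y)"
    then have "\<psi> \<gamma> = \<phi> \<gamma>" for \<gamma>
      using forms_ext[of \<psi> \<phi>] \<phi>_lin \<phi> by metis
    then show "\<psi> = \<phi>" ..
  qed (use \<phi>_lin \<phi> in auto)
  with \<phi>_lin \<phi> show "clinear (tangent_pairing A G Y)" "tangent_pairing A G Y (x \<cdot> D y) = \<epsilon> x * Y y"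
    by auto
qed

section \<open>Tangent functionals and left-invariant forms as dual bases\<close>

abbreviation I where "I \<equiv> {1..N}"

definition \<phi> where "\<phi> j = tangent_pairing A G (X j)"

lemma X_tangent: "i \<in> I \<Longrightarrow> X i \<in> tangent_space A G"
  using data complex_vector.span_base[of "X i" "X ` I"]
  by (auto simp: calculus_data_def is_basis_def)

lemma X_clinear: "i \<in> I \<Longrightarrow> clinear (X i)" and X_one [simp]: "i \<in> I \<Longrightarrow> X i 1 = 0"
  using X_tangent by (auto simp: tangent_space_def)

lemma f_clinear: "i \<in> I \<Longrightarrow> j \<in> I \<Longrightarrow> clinear (f i j)"
  using data by (auto simp: calculus_data_def hopf_dual_def)

lemma \<phi>_clinear: "j \<in> I \<Longrightarrow> clinear (\<phi> j)" and \<phi>_D: "j \<in> I \<Longrightarrow> \<phi> j (x \<cdot> D y) = \<epsilon> x * X j y"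
  using tangent_pairing[OF X_tangent] by (auto simp: \<phi>_def)

lemma \<phi>_omega: "i \<in> I \<Longrightarrow> j \<in> I \<Longrightarrow> \<phi> j (\<omega> i) = (if j = i then 1 else 0)"
  using data by (auto simp: calculus_data_def \<phi>_def)

lemma sum_\<phi>_omega:
  fixes g :: "nat \<Rightarrow> 'b::complex_vector"
  assumes "j \<in> I"
  shows "(\<Sum>l=1..N. \<phi> j (\<omega> l) *\<^sub>C g l) = g j"
proof -
  have "(\<Sum>l=1..N. \<phi> j (\<omega> l) *\<^sub>C g l) = (\<Sum>l=1..N. (if j = l then 1 else 0) *\<^sub>C g l)"
    by (rule sum.cong) (simp_all add: \<phi>_omega assms)
  then show ?thesis
    using assms by (simp add: sum_delta_scaleC)
qed

lemmas X_lin [clin] = clinear_comp[OF X_clinear]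
lemmas f_lin [clin] = clinear_comp[OF f_clinear]
lemmas \<phi>_lin [clin] = clinear_comp[OF \<phi>_clinear]

lemma \<phi>_D1: "j \<in> I \<Longrightarrow> \<phi> j (D y) = X j y"
  using \<phi>_D[of j 1 y] by simp

lemma \<phi>_lm: "j \<in> I \<Longrightarrow> \<phi> j (a \<cdot> \<gamma>) = \<epsilon> a * \<phi> j \<gamma>"
  by (rule forms_ext[where \<gamma> = \<gamma>])
    (intro clin | simp add: \<phi>_D lm_mult[symmetric])+

lemma omega_left_invariant: "i \<in> I \<Longrightarrow> lc (\<omega> i) = 1 \<otimes> \<omega> i"
  using data complex_vector.span_base[of "\<omega> i" "\<omega> ` I"]
  by (auto simp: calculus_data_def is_basis_def left_invariant_def)

lemma left_invariant_expand:
  assumes "lc \<gamma> = 1 \<otimes> \<gamma>"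
  shows "\<gamma> = (\<Sum>k=1..N. \<phi> k \<gamma> *\<^sub>C \<omega> k)"
proof -
  have "\<gamma> \<in> cspan (\<omega> ` I)"
    using data assms by (auto simp: calculus_data_def is_basis_def left_invariant_def)
  then obtain c where c: "\<gamma> = (\<Sum>k=1..N. c k *\<^sub>C \<omega> k)"
    using cspan_is_sum by blast
  have "\<phi> j \<gamma> = c j" if "j \<in> I" for j
    using that unfolding c
    by (simp add: clinear_sum[OF \<phi>_clinear] clinear_scale[OF \<phi>_clinear] \<phi>_omega sum_delta_mult)
  then have "(\<Sum>k=1..N. \<phi> k \<gamma> *\<^sub>C \<omega> k) = (\<Sum>k=1..N. c k *\<^sub>C \<omega> k)"
    by (intro sum.cong) auto
  with c show ?thesis by simp
qed

text \<open>With four Sweedler legs, the coaction of \<open>S(y1) dy2\<close> is the tensor of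
  \<open>S(y2) y3\<close> with \<open>S(y1) dy4\<close>, since \<open>S\<close> reverses the
  coproduct. The first factor collapses to a counit.\<close>

lemma Q_left_invariant: "lc (Q y) = 1 \<otimes> Q y"
proof -
  have lc_SD: "lc (S u \<cdot> D v) = swe (\<lambda>v1 v2. swe (\<lambda>u1 u2. (S u2 * v1) \<otimes> (S u1 \<cdot> D v2)) u) v" for u v
  proof -
    have "lc (S u \<cdot> D v) = tensor_lift (\<lambda>x y. x \<otimes> y) (lc (S u \<cdot> D v))"
      by (simp add: tensor_lift_elementary)
    also have "\<dots> = swe (\<lambda>u1 u2. swe (\<lambda>v1 v2. (u1 * v1) \<otimes> (u2 \<cdot> D v2)) v) (S u)"
      by (rule lift_lc_D) (intro clin)
    also have "\<dots> = swe (\<lambda>u1 u2. swe (\<lambda>v1 v2. (S u2 * v1) \<otimes> (S u1 \<cdot> D v2)) v) u"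
      unfolding comul_antipode by (rule tensor_lift_lift) (intro clin)
    also have "\<dots> = swe (\<lambda>v1 v2. swe (\<lambda>u1 u2. (S u2 * v1) \<otimes> (S u1 \<cdot> D v2)) u) v"
      by (rule tensor_lift_swap)
    finally show ?thesis .
  qed
  have "lc (Q y) = swe (\<lambda>u v. swe (\<lambda>v1 v2. swe (\<lambda>u1 u2. (S u2 * v1) \<otimes> (S u1 \<cdot> D v2)) u) v) y"
    unfolding Q_def by (subst tensor_lift_push[OF lc_clinear]) (simp only: lc_SD)
  also have "\<dots> = swe (\<lambda>u v2. swe (\<lambda>u' v1. swe (\<lambda>u1 u2. (S u2 * v1) \<otimes> (S u1 \<cdot> D v2)) u') u) y"
    by (rule coassoc[symmetric]) (intro clin)+
  also have "\<dots> = swe (\<lambda>u v2. swe (\<lambda>u1 w. swe (\<lambda>u2 v1. (S u2 * v1) \<otimes> (S u1 \<cdot> D v2)) w) u) y"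
  proof -
    have "swe (\<lambda>u' v1. swe (\<lambda>u1 u2. (S u2 * v1) \<otimes> (S u1 \<cdot> D v2)) u') u =
        swe (\<lambda>u1 w. swe (\<lambda>u2 v1. (S u2 * v1) \<otimes> (S u1 \<cdot> D v2)) w) u" for u v2
      by (rule coassoc) (intro clin)+
    then show ?thesis by (simp only:)
  qed
  also have "\<dots> = swe (\<lambda>u v2. swe (\<lambda>u1 w. \<epsilon> w *\<^sub>C (1 \<otimes> (S u1 \<cdot> D v2))) u) y"
    by (simp only: tensor_lift_tensor_left antipode_left elementary_tensor_scale_left)
  also have "\<dots> = swe (\<lambda>u v2. 1 \<otimes> (S u \<cdot> D v2)) y"
  proof -
    have "swe (\<lambda>u1 w. \<epsilon> w *\<^sub>C ((1::'a) \<otimes> (S u1 \<cdot> D v2))) u = 1 \<otimes> (S u \<cdot> D v2)" for u v2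
      by (rule counit_right) (intro clin)
    then show ?thesis by (simp only:)
  qed
  also have "\<dots> = 1 \<otimes> Q y"
    by (simp only: tensor_lift_tensor_right Q_def)
  finally show ?thesis .
qed

text \<open>\<open>Q y\<close> is left-invariant, so its coefficients are its pairings with the
  \<open>X k\<close>; these are \<open>X k y\<close> because \<open>S\<close> preserves the
  counit.\<close>

lemma Q_expand: "Q y = (\<Sum>k=1..N. X k y *\<^sub>C \<omega> k)"
proof -
  have "\<phi> k (Q y) = X k y" if "k \<in> I" for k
  proof -
    have "\<phi> k (Q y) = swe (\<lambda>u v. \<epsilon> u *\<^sub>C X k v) y"
      unfolding Q_def using that
      by (simp add: tensor_lift_push[OF \<phi>_clinear] \<phi>_D counit_antipode)
    also have "\<dots> = X k y"
      by (rule counit_left) (rule X_clinear[OF that])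
    finally show ?thesis .
  qed
  then show ?thesis
    by (subst left_invariant_expand[OF Q_left_invariant]) (intro sum.cong, auto)
qed

abbreviation la (infixr "\<triangleright>" 80) where "h \<triangleright> x \<equiv> left_act A h x"

lemma la_clinear: assumes "clinear h" shows "clinear (left_act A h)"
  unfolding left_act_def by (intro clin clinear_comp[OF assms])

lemma eps_la: "clinear h \<Longrightarrow> \<epsilon> (h \<triangleright> x) = h x"
proof -
  assume h: "clinear h"
  have "\<epsilon> (h \<triangleright> x) = swe (\<lambda>u v. \<epsilon> u *\<^sub>C h v) x"
    unfolding left_act_def
    by (simp add: tensor_lift_push[OF counit_clinear] clinear_scale[OF counit_clinear] mult.commute)
  then show ?thesis using counit_left[OF h, of x] by simp
qed

lemma func_la: "clinear g \<Longrightarrow> g (h \<triangleright> x) = conv A g h x"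
  unfolding left_act_def conv_def
  by (simp add: tensor_lift_push[of g] clinear_scale[of g] mult.commute)

text \<open>Inserting the antipode axiom in front of \<open>dx\<close> gives
  \<open>x1 S(x2) dx3\<close>, which is \<open>x1\<close> times \<open>Q\<close> of
  \<open>x2\<close>. The coefficients of \<open>Q\<close> then act on the second leg, and this is
  the left action of \<open>X k\<close>.\<close>

lemma D_expand: "D x = (\<Sum>k=1..N. (X k \<triangleright> x) \<cdot> \<omega> k)"
proof -
  have "D x = swe (\<lambda>w z. \<epsilon> w *\<^sub>C D z) x"
    by (rule counit_left[OF D_clinear, symmetric])
  also have "\<dots> = swe (\<lambda>w z. swe (\<lambda>u v. (u * S v) \<cdot> D z) w) x"
  proof -
    have "swe (\<lambda>u v. (u * S v) \<cdot> D z) w = swe (\<lambda>u v. u * S v) w \<cdot> D z" for w z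
      by (rule tensor_lift_push[where g = "\<lambda>s. s \<cdot> D z", symmetric]) (intro clin)
    then show ?thesis
      by (simp add: antipode_right clinear_scale[OF lm_lin(1)[OF clinear_id]])
  qed
  also have "\<dots> = swe (\<lambda>u w. swe (\<lambda>v z. (u * S v) \<cdot> D z) w) x"
    by (rule coassoc) (intro clin)+
  also have "\<dots> = swe (\<lambda>u w. u \<cdot> Q w) x"
    unfolding Q_def by (simp add: tensor_lift_push[OF lm_lin(2)[OF clinear_id]] lm_mult)
  also have "\<dots> = swe (\<lambda>u w. \<Sum>k=1..N. (X k w *\<^sub>C u) \<cdot> \<omega> k) x"
    unfolding Q_expand
    by (simp add: clinear_sum[OF lm_lin(2)[OF clinear_id]] clinear_scale[OF lm_lin(2)[OF clinear_id]]
        clinear_scale[OF lm_lin(1)[OF clinear_id]])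
  also have "\<dots> = (\<Sum>k=1..N. (X k \<triangleright> x) \<cdot> \<omega> k)"
  proof -
    have "swe (\<lambda>u w. (X k w *\<^sub>C u) \<cdot> \<omega> k) x = (X k \<triangleright> x) \<cdot> \<omega> k" for k
      unfolding left_act_def
      by (rule tensor_lift_push[where g = "\<lambda>s. s \<cdot> \<omega> k", symmetric]) (intro clin)
    then show ?thesis
      by (simp only: tensor_lift_sum)
  qed
  finally show ?thesis .
qed

section \<open>Coactions of products of functions and forms\<close>

lemma lift_lc_lm:
  assumes "cbilinear B"
  shows "tensor_lift B (lc (a \<cdot> \<gamma>)) =
    swe (\<lambda>a1 a2. tensor_lift (\<lambda>b \<beta>. B (a1 * b) (a2 \<cdot> \<beta>)) (lc \<gamma>)) a"
proof (rule forms_ext[where \<gamma> = \<gamma>])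
  note [clin] = cbilinear_left[OF assms] cbilinear_right[OF assms]
  show "clinear (\<lambda>\<gamma>. tensor_lift B (lc (a \<cdot> \<gamma>)))"
    "clinear (\<lambda>\<gamma>. swe (\<lambda>a1 a2. tensor_lift (\<lambda>b \<beta>. B (a1 * b) (a2 \<cdot> \<beta>)) (lc \<gamma>)) a)"
    by (intro clin assms)+
  fix x y
  have "tensor_lift B (lc (a \<cdot> x \<cdot> D y)) =
      swe (\<lambda>x1 x2. swe (\<lambda>y1 y2. B (x1 * y1) (x2 \<cdot> D y2)) y) (a * x)"
    unfolding lm_mult[symmetric] by (rule lift_lc_D[OF assms])
  also have "\<dots> = swe (\<lambda>a1 a2. swe (\<lambda>x1 x2. swe (\<lambda>y1 y2. B (a1 * x1 * y1) ((a2 * x2) \<cdot> D y2)) y) x) a"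
    by (rule swe_mult) (intro clin)
  also have "\<dots> = swe (\<lambda>a1 a2. tensor_lift (\<lambda>b \<beta>. B (a1 * b) (a2 \<cdot> \<beta>)) (lc (x \<cdot> D y))) a"
  proof -
    have "tensor_lift (\<lambda>b \<beta>. B (a1 * b) (a2 \<cdot> \<beta>)) (lc (x \<cdot> D y)) =
        swe (\<lambda>x1 x2. swe (\<lambda>y1 y2. B (a1 * (x1 * y1)) (a2 \<cdot> x2 \<cdot> D y2)) y) x" for a1 a2
      by (rule lift_lc_D) (intro clin)
    then show ?thesis
      by (simp only: mult.assoc lm_mult)
  qed
  finally show "tensor_lift B (lc (a \<cdot> x \<cdot> D y)) =
    swe (\<lambda>a1 a2. tensor_lift (\<lambda>b \<beta>. B (a1 * b) (a2 \<cdot> \<beta>)) (lc (x \<cdot> D y))) a" .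
qed

lemma lift_rc_lm:
  assumes "cbilinear B"
  shows "tensor_lift B (rc (a \<cdot> \<gamma>)) =
    swe (\<lambda>a1 a2. tensor_lift (\<lambda>\<beta> b. B (a1 \<cdot> \<beta>) (a2 * b)) (rc \<gamma>)) a"
proof (rule forms_ext[where \<gamma> = \<gamma>])
  note [clin] = cbilinear_left[OF assms] cbilinear_right[OF assms]
  show "clinear (\<lambda>\<gamma>. tensor_lift B (rc (a \<cdot> \<gamma>)))"
    "clinear (\<lambda>\<gamma>. swe (\<lambda>a1 a2. tensor_lift (\<lambda>\<beta> b. B (a1 \<cdot> \<beta>) (a2 * b)) (rc \<gamma>)) a)"
    by (intro clin assms)+
  fix x y
  have "tensor_lift B (rc (a \<cdot> x \<cdot> D y)) =
      swe (\<lambda>x1 x2. swe (\<lambda>y1 y2. B (x1 \<cdot> D y1) (x2 * y2)) y) (a * x)"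
    unfolding lm_mult[symmetric] by (rule lift_rc_D[OF assms])
  also have "\<dots> = swe (\<lambda>a1 a2. swe (\<lambda>x1 x2. swe (\<lambda>y1 y2. B ((a1 * x1) \<cdot> D y1) (a2 * x2 * y2)) y) x) a"
    by (rule swe_mult) (intro clin)
  also have "\<dots> = swe (\<lambda>a1 a2. tensor_lift (\<lambda>\<beta> b. B (a1 \<cdot> \<beta>) (a2 * b)) (rc (x \<cdot> D y))) a"
  proof -
    have "tensor_lift (\<lambda>\<beta> b. B (a1 \<cdot> \<beta>) (a2 * b)) (rc (x \<cdot> D y)) =
        swe (\<lambda>x1 x2. swe (\<lambda>y1 y2. B (a1 \<cdot> x1 \<cdot> D y1) (a2 * (x2 * y2))) y) x" for a1 a2
      by (rule lift_rc_D) (intro clin)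
    then show ?thesis
      by (simp only: mult.assoc lm_mult)
  qed
  finally show "tensor_lift B (rc (a \<cdot> x \<cdot> D y)) =
    swe (\<lambda>a1 a2. tensor_lift (\<lambda>\<beta> b. B (a1 \<cdot> \<beta>) (a2 * b)) (rc (x \<cdot> D y))) a" .
qed

text \<open>Covariance is prescribed for left multiples only. Right multiples reduce to them by the
  Leibniz rule: \<open>(x dy) z = x d(yz) - xy dz\<close>, and the coaction of the last two terms is
  known.\<close>

lemma lift_rc_rm:
  assumes "cbilinear B"
  shows "tensor_lift B (rc (\<gamma> \<star> z)) =
    tensor_lift (\<lambda>\<beta> b. swe (\<lambda>z1 z2. B (\<beta> \<star> z1) (b * z2)) z) (rc \<gamma>)"
proof (rule forms_ext[where \<gamma> = \<gamma>])
  note [clin] = cbilinear_left[OF assms] cbilinear_right[OF assms]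
  show "clinear (\<lambda>\<gamma>. tensor_lift B (rc (\<gamma> \<star> z)))"
    "clinear (\<lambda>\<gamma>. tensor_lift (\<lambda>\<beta> b. swe (\<lambda>z1 z2. B (\<beta> \<star> z1) (b * z2)) z) (rc \<gamma>))"
    by (intro clin assms)+
  fix x y
  have "x \<cdot> D (y * z) = (x \<cdot> D y) \<star> z + (x * y) \<cdot> D z"
    by (simp add: Leibniz clinear_add[OF lm_lin(2)[OF clinear_id]] lm_rm lm_mult)
  then have split: "(x \<cdot> D y) \<star> z = x \<cdot> D (y * z) - (x * y) \<cdot> D z"
    by simp
  have "tensor_lift B (rc (x \<cdot> D (y * z))) =
      swe (\<lambda>x1 x2. swe (\<lambda>w1 w2. B (x1 \<cdot> D w1) (x2 * w2)) (y * z)) x"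
    by (rule lift_rc_D[OF assms])
  also have "\<dots> = swe (\<lambda>x1 x2. swe (\<lambda>y1 y2. swe (\<lambda>z1 z2.
      B (x1 \<cdot> D (y1 * z1)) (x2 * (y2 * z2))) z) y) x"
  proof -
    have "swe (\<lambda>w1 w2. B (x1 \<cdot> D w1) (x2 * w2)) (y * z) =
        swe (\<lambda>y1 y2. swe (\<lambda>z1 z2. B (x1 \<cdot> D (y1 * z1)) (x2 * (y2 * z2))) z) y" for x1 x2
      by (rule swe_mult) (intro clin)
    then show ?thesis by (simp only:)
  qed
  also have "\<dots> = swe (\<lambda>x1 x2. swe (\<lambda>y1 y2. swe (\<lambda>z1 z2.
      B ((x1 \<cdot> D y1) \<star> z1) (x2 * y2 * z2)) z) y) x +
      swe (\<lambda>x1 x2. swe (\<lambda>y1 y2. swe (\<lambda>z1 z2. B ((x1 * y1) \<cdot> D z1) (x2 * y2 * z2)) z) y) x"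
    by (simp add: Leibniz clinear_add[OF lm_lin(2)[OF clinear_id]] lm_rm lm_mult mult.assoc
        clinear_add[OF cbilinear_left[OF assms clinear_id]] tensor_lift_plus)
  also have "swe (\<lambda>x1 x2. swe (\<lambda>y1 y2. swe (\<lambda>z1 z2. B ((x1 * y1) \<cdot> D z1) (x2 * y2 * z2)) z) y) x =
      swe (\<lambda>w1 w2. swe (\<lambda>z1 z2. B (w1 \<cdot> D z1) (w2 * z2)) z) (x * y)"
    by (rule swe_mult[symmetric]) (intro clin)
  also have "\<dots> = tensor_lift B (rc ((x * y) \<cdot> D z))"
    by (rule lift_rc_D[OF assms, symmetric])
  also have "swe (\<lambda>x1 x2. swe (\<lambda>y1 y2. swe (\<lambda>z1 z2. B ((x1 \<cdot> D y1) \<star> z1) (x2 * y2 * z2)) z) y) x =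
      tensor_lift (\<lambda>\<beta> b. swe (\<lambda>z1 z2. B (\<beta> \<star> z1) (b * z2)) z) (rc (x \<cdot> D y))"
    by (rule lift_rc_D[symmetric]) (intro clin)
  finally show "tensor_lift B (rc ((x \<cdot> D y) \<star> z)) =
      tensor_lift (\<lambda>\<beta> b. swe (\<lambda>z1 z2. B (\<beta> \<star> z1) (b * z2)) z) (rc (x \<cdot> D y))"
    by (simp add: split clinear_diff[OF rc_clinear] clinear_diff[OF tensor_lift(2)[OF assms]])
qed

text \<open>The functional \<open>\<phi> j\<close> applied to the form leg of the left coaction. It
  reads off the left coefficient of \<open>\<omega> j\<close> and so makes the
  \<open>\<omega> k\<close> independent over \<open>A\<close>, which allows comparison of
  coefficients below.\<close>

definition coord where "coord j \<gamma> = tensor_lift (\<lambda>a \<beta>. \<phi> j \<beta> *\<^sub>C a) (lc \<gamma>)"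

lemma coord_clinear: "j \<in> I \<Longrightarrow> clinear (coord j)"
  unfolding coord_def[abs_def] by (intro clin)

lemma coord_omega:
  assumes "j \<in> I" and "k \<in> I"
  shows "coord j (a \<cdot> \<omega> k) = (if j = k then a else 0)"
proof -
  have "coord j (a \<cdot> \<omega> k) = swe (\<lambda>a1 a2. tensor_lift (\<lambda>b \<beta>. \<phi> j (a2 \<cdot> \<beta>) *\<^sub>C (a1 * b)) (lc (\<omega> k))) a"
    unfolding coord_def by (intro lift_lc_lm clin assms)
  also have "\<dots> = swe (\<lambda>a1 a2. \<epsilon> a2 *\<^sub>C ((if j = k then 1 else 0) *\<^sub>C a1)) a"
  proof -
    have "tensor_lift (\<lambda>b \<beta>. \<phi> j (a2 \<cdot> \<beta>) *\<^sub>C (a1 * b)) (1 \<otimes> \<omega> k) = \<phi> j (a2 \<cdot> \<omega> k) *\<^sub>C (a1 * 1)" for a1 a2 :: 'a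
      by (intro tensor_lift(1) clin assms)
    then show ?thesis
      using assms by (simp add: omega_left_invariant \<phi>_lm \<phi>_omega scaleC_scaleC)
  qed
  also have "\<dots> = (if j = k then 1 else 0) *\<^sub>C a"
    by (rule counit_right) (intro clin)
  finally show ?thesis by simp
qed

lemma coord_sum_omega: "j \<in> I \<Longrightarrow> coord j (\<Sum>k=1..N. a k \<cdot> \<omega> k) = a j"
  by (simp add: clinear_sum[OF coord_clinear] coord_omega)

lemma omega_rm: "i \<in> I \<Longrightarrow> \<omega> i \<star> x = (\<Sum>j=1..N. (f i j \<triangleright> x) \<cdot> \<omega> j)"
  using data by (auto simp: calculus_data_def)

lemma forms_expand: "\<exists>a. \<gamma> = (\<Sum>k=1..N. a k \<cdot> \<omega> k)"
proof -
  have "\<gamma> = (\<Sum>k=1..N. coord k \<gamma> \<cdot> \<omega> k)"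
  proof (rule forms_ext[where \<gamma> = \<gamma>])
    show "clinear (\<lambda>\<gamma>. \<Sum>k=1..N. coord k \<gamma> \<cdot> \<omega> k)"
      by (intro clin coord_clinear)
    fix x y
    have "x \<cdot> D y = (\<Sum>k=1..N. (x * (X k \<triangleright> y)) \<cdot> \<omega> k)"
      by (subst D_expand) (simp add: clinear_sum[OF lm_lin(2)[OF clinear_id]] lm_mult)
    then show "x \<cdot> D y = (\<Sum>k=1..N. coord k (x \<cdot> D y) \<cdot> \<omega> k)"
      by (simp add: coord_sum_omega)
  qed (rule clinear_id)
  then show ?thesis by (intro exI)
qed

lemma \<phi>_rm: "j \<in> I \<Longrightarrow> k \<in> I \<Longrightarrow> \<phi> j (\<omega> k \<star> y) = f k j y"
  by (simp add: omega_rm clinear_sum[OF \<phi>_clinear] \<phi>_lm eps_la[OF f_clinear] \<phi>_omega sum_delta_mult)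

text \<open>Associativity of right multiplication,
  \<open>\<omega>\<^sub>i (xy) = (\<omega>\<^sub>i x) y\<close>, compared coefficientwise; the
  counit then turns the action of \<open>f i j\<close> into its value.\<close>

lemma f_mult:
  assumes i: "i \<in> I" and j: "j \<in> I"
  shows "f i j (x * y) = (\<Sum>k=1..N. f i k x * f k j y)"
proof -
  have "(\<Sum>j=1..N. (f i j \<triangleright> (x * y)) \<cdot> \<omega> j) = \<omega> i \<star> x \<star> y"
    by (simp only: omega_rm[OF i, symmetric] rm_mult)
  also have "\<dots> = (\<Sum>k=1..N. (f i k \<triangleright> x) \<cdot> (\<Sum>j=1..N. (f k j \<triangleright> y) \<cdot> \<omega> j))"
    using i by (simp add: omega_rm clinear_sum[OF rm_lin(1)[OF clinear_id]] lm_rm)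
  also have "\<dots> = (\<Sum>k=1..N. \<Sum>j=1..N. ((f i k \<triangleright> x) * (f k j \<triangleright> y)) \<cdot> \<omega> j)"
    by (simp add: clinear_sum[OF lm_lin(2)[OF clinear_id]] lm_mult)
  also have "\<dots> = (\<Sum>j=1..N. (\<Sum>k=1..N. (f i k \<triangleright> x) * (f k j \<triangleright> y)) \<cdot> \<omega> j)"
    by (subst sum.swap) (simp add: clinear_sum[OF lm_lin(1)[OF clinear_id]])
  finally have "f i j \<triangleright> (x * y) = (\<Sum>k=1..N. (f i k \<triangleright> x) * (f k j \<triangleright> y))"
    using coord_sum_omega[OF j, of "\<lambda>j. f i j \<triangleright> (x * y)"]
      coord_sum_omega[OF j, of "\<lambda>j. \<Sum>k=1..N. (f i k \<triangleright> x) * (f k j \<triangleright> y)"] by simp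
  from arg_cong[OF this, of \<epsilon>] show ?thesis
    using i j by (simp add: clinear_sum[OF counit_clinear] eps_la[OF f_clinear])
qed

lemma f_one:
  assumes i: "i \<in> I" and j: "j \<in> I"
  shows "f i j 1 = (if i = j then 1 else 0)"
proof -
  have "\<omega> i = (\<Sum>j=1..N. (f i j \<triangleright> 1) \<cdot> \<omega> j)"
    using omega_rm[OF i, of 1] by simp
  then have "\<phi> j (\<omega> i) = f i j 1"
    using i j
    by (simp add: clinear_sum[OF \<phi>_clinear] \<phi>_lm eps_la[OF f_clinear] \<phi>_omega sum_delta_mult)
  then show ?thesis using i j by (auto simp: \<phi>_omega split: if_splits)
qed

text \<open>The Leibniz rule paired with \<open>X i\<close>: in \<open>dx y\<close> the function
  \<open>y\<close> must pass to the left of \<open>\<omega> j\<close>, which brings in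
  \<open>f j i\<close>.\<close>

lemma X_mult:
  assumes i: "i \<in> I"
  shows "X i (x * y) = \<epsilon> x * X i y + (\<Sum>j=1..N. X j x * f j i y)"
proof -
  have "D (x * y) = (\<Sum>j=1..N. (X j \<triangleright> x) \<cdot> (\<omega> j \<star> y)) + x \<cdot> D y"
    unfolding Leibniz by (subst D_expand[of x]) (simp add: clinear_sum[OF rm_lin(1)[OF clinear_id]] lm_rm)
  then have "\<phi> i (D (x * y)) = (\<Sum>j=1..N. X j x * \<phi> i (\<omega> j \<star> y)) + \<epsilon> x * X i y"
    using i by (simp add: clinear_add[OF \<phi>_clinear] clinear_sum[OF \<phi>_clinear] \<phi>_lm \<phi>_D1 eps_la[OF X_clinear])
  then show ?thesis
    using i by (simp add: \<phi>_D1 \<phi>_rm)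
qed

section \<open>The matrix of the right coaction and right covariance\<close>

lemma rc_omega: "i \<in> I \<Longrightarrow> rc (\<omega> i) = (\<Sum>j=1..N. \<omega> j \<otimes> J j i)"
  using data by (auto simp: calculus_data_def)

text \<open>Coassociativity of the right coaction at \<open>\<omega> i\<close>. The map
  \<open>?P\<close> extracts the component along \<open>\<omega> j\<close> from the first tensor
  factor.\<close>

lemma comul_J:
  assumes i: "i \<in> I" and j: "j \<in> I"
  shows "comul A (J j i) = (\<Sum>k=1..N. J j k \<otimes> J k i)"
proof -
  let ?P = "tensor_lift (\<lambda>\<beta> s. \<phi> j \<beta> *\<^sub>C s) :: ('g, ('a, 'a) tensor) tensor \<Rightarrow> ('a, 'a) tensor"
  have bil: "cbilinear (\<lambda>\<beta> s. \<phi> j \<beta> *\<^sub>C s)" for s :: "('a, 'a) tensor"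
    by (intro clin j)
  have P: "clinear ?P" by (rule tensor_lift(2)[OF bil])
  have assoc: "?P (tensor_assoc ((\<beta> \<otimes> x) \<otimes> y)) = \<phi> j \<beta> *\<^sub>C (x \<otimes> y)" for \<beta> x y
    unfolding tensor_assoc_def
    by (subst tensor_lift(1), (intro clin)[1], subst tensor_lift(1), (intro clin)[1])
      (rule tensor_lift(1)[OF bil])
  have assoc_lin: "clinear (\<lambda>s. ?P (tensor_assoc (s \<otimes> y)))" for y
    unfolding tensor_assoc_def by (intro clin clinear_comp[OF P])
  have assoc_lin': "clinear (\<lambda>s. ?P (tensor_assoc s))"
    unfolding tensor_assoc_def by (intro clin clinear_comp[OF P])
  have "?P (tensor_assoc (tensor_map rc id (rc (\<omega> i)))) = ?P (tensor_map id (comul A) (rc (\<omega> i)))"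
    using bicovariant by (simp add: bicovariant_calculus_def right_comodule_def)
  moreover have "?P (tensor_map id (comul A) (rc (\<omega> i))) = comul A (J j i)"
  proof -
    have "?P (tensor_map id (comul A) (rc (\<omega> i))) = (\<Sum>k=1..N. \<phi> j (\<omega> k) *\<^sub>C comul A (J k i))"
      unfolding tensor_lift_map[OF bil] rc_omega[OF i]
      by (subst tensor_lift_decomp) (intro clin clinear_comp[OF \<phi>_clinear[OF j]], simp)
    also have "\<dots> = comul A (J j i)"
      using j by (simp add: \<phi>_omega sum_delta_scaleC)
    finally show ?thesis .
  qed
  moreover have "?P (tensor_assoc (tensor_map rc id (rc (\<omega> i)))) = (\<Sum>k=1..N. J j k \<otimes> J k i)"
  proof -
    have "tensor_map rc id (rc (\<omega> i)) = (\<Sum>k=1..N. rc (\<omega> k) \<otimes> J k i)"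
      unfolding rc_omega[OF i]
      by (simp add: clinear_sum[OF clinear_tensor_map[OF rc_clinear clinear_id' clinear_id]]
         tensor_map_elementary[OF rc_clinear clinear_id'])
    then have "?P (tensor_assoc (tensor_map rc id (rc (\<omega> i)))) =
        (\<Sum>k=1..N. \<Sum>l=1..N. \<phi> j (\<omega> l) *\<^sub>C (J l k \<otimes> J k i))"
      by (simp add: clinear_sum[OF assoc_lin'] rc_omega clinear_sum[OF assoc_lin] assoc)
    also have "\<dots> = (\<Sum>k=1..N. J j k \<otimes> J k i)"
      by (simp only: sum_\<phi>_omega[OF j])
    finally show ?thesis .
  qed
  ultimately show ?thesis by simp
qed

lemma eps_J:
  assumes i: "i \<in> I" and j: "j \<in> I"
  shows "\<epsilon> (J j i) = (if j = i then 1 else 0)"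
proof -
  have "tensor_lift (\<lambda>\<beta> x. \<epsilon> x *\<^sub>C \<beta>) (rc (\<omega> i)) = \<omega> i"
    using bicovariant by (simp add: bicovariant_calculus_def right_comodule_def)
  moreover have "tensor_lift (\<lambda>\<beta> x. \<epsilon> x *\<^sub>C \<beta>) (rc (\<omega> i)) = (\<Sum>k=1..N. \<epsilon> (J k i) *\<^sub>C \<omega> k)"
    unfolding rc_omega[OF i] by (rule tensor_lift_decomp) (intro clin)
  ultimately have "\<phi> j (\<omega> i) = \<phi> j (\<Sum>k=1..N. \<epsilon> (J k i) *\<^sub>C \<omega> k)" by simp
  then show ?thesis
    using i j by (simp add: clinear_sum[OF \<phi>_clinear] clinear_scale[OF \<phi>_clinear] \<phi>_omega sum_delta_mult)
qed

text \<open>Applying \<open>\<phi> j\<close> to the form leg of the right coaction turns covariance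
  statements about forms into identities in \<open>A\<close>, with the entries of \<open>J\<close>
  appearing as right factors.\<close>

lemma lift_phi_rc_omega:
  assumes i: "i \<in> I" and j: "j \<in> I"
  shows "tensor_lift (\<lambda>\<beta> x. \<phi> j \<beta> *\<^sub>C x) (rc (a \<cdot> \<omega> i)) = a * J j i"
proof -
  have "tensor_lift (\<lambda>\<beta> x. \<phi> j \<beta> *\<^sub>C x) (rc (a \<cdot> \<omega> i)) =
      swe (\<lambda>a1 a2. tensor_lift (\<lambda>\<beta> b. \<phi> j (a1 \<cdot> \<beta>) *\<^sub>C (a2 * b)) (rc (\<omega> i))) a"
    by (intro lift_rc_lm clin j)
  also have "\<dots> = swe (\<lambda>a1 a2. \<epsilon> a1 *\<^sub>C (a2 * J j i)) a"
  proof -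
    have "tensor_lift (\<lambda>\<beta> b. \<phi> j (a1 \<cdot> \<beta>) *\<^sub>C (a2 * b)) (\<Sum>k=1..N. \<omega> k \<otimes> J k i) =
        (\<Sum>k=1..N. \<phi> j (a1 \<cdot> \<omega> k) *\<^sub>C (a2 * J k i))" for a1 a2
      by (intro tensor_lift_decomp clin j)
    then show ?thesis
      by (simp only: rc_omega[OF i] \<phi>_lm[OF j] scaleC_scaleC[symmetric] sum_\<phi>_omega[OF j]
          complex_vector.scale_sum_right[symmetric])
  qed
  also have "\<dots> = a * J j i"
    by (rule counit_left) (intro clin)
  finally show ?thesis .
qed

text \<open>The \<open>j\<close>-th components of both sides of the right covariance of \<open>d\<close>.\<close>

lemma X_J:
  assumes j: "j \<in> I"
  shows "(\<Sum>k=1..N. (X k \<triangleright> x) * J j k) = swe (\<lambda>u v. X j u *\<^sub>C v) x"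
proof -
  let ?K = "\<lambda>\<gamma>. tensor_lift (\<lambda>\<beta> x. \<phi> j \<beta> *\<^sub>C x) (rc \<gamma>)"
  have lin: "clinear ?K" by (intro clin j)
  have "?K (1 \<cdot> D x) = swe (\<lambda>a1 a2. swe (\<lambda>u v. \<phi> j (a1 \<cdot> D u) *\<^sub>C (a2 * v)) x) 1"
    by (intro lift_rc_D clin j)
  also have "\<dots> = swe (\<lambda>u v. \<phi> j (1 \<cdot> D u) *\<^sub>C (1 * v)) x"
    by (intro swe_one clin j)
  finally have "?K (D x) = swe (\<lambda>u v. X j u *\<^sub>C v) x"
    using j by (simp add: \<phi>_D1)
  moreover have "?K (D x) = (\<Sum>k=1..N. (X k \<triangleright> x) * J j k)"
    using j by (subst D_expand) (simp add: clinear_sum[OF lin] lift_phi_rc_omega)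
  ultimately show ?thesis by simp
qed

text \<open>The component along \<open>\<omega> j\<close> of the right coaction of
  \<open>\<omega>\<^sub>i x\<close>, computed twice: after \<open>x\<close> has been moved to the
  left by \<open>omega_rm\<close>, and directly by \<open>lift_rc_rm\<close>.\<close>

lemma f_J:
  assumes i: "i \<in> I" and j: "j \<in> I"
  shows "(\<Sum>l=1..N. (f i l \<triangleright> x) * J j l) = (\<Sum>k=1..N. swe (\<lambda>x1 x2. f k j x1 *\<^sub>C (J k i * x2)) x)"
proof -
  let ?K = "\<lambda>\<gamma>. tensor_lift (\<lambda>\<beta> x. \<phi> j \<beta> *\<^sub>C x) (rc \<gamma>)"
  have lin: "clinear ?K" by (intro clin j)
  have "?K (\<omega> i \<star> x) = (\<Sum>l=1..N. (f i l \<triangleright> x) * J j l)"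
    using i j by (simp add: omega_rm clinear_sum[OF lin] lift_phi_rc_omega)
  moreover have "?K (\<omega> i \<star> x) = (\<Sum>k=1..N. swe (\<lambda>x1 x2. f k j x1 *\<^sub>C (J k i * x2)) x)"
  proof -
    have "?K (\<omega> i \<star> x) = tensor_lift (\<lambda>\<beta> b. swe (\<lambda>x1 x2. \<phi> j (\<beta> \<star> x1) *\<^sub>C (b * x2)) x) (rc (\<omega> i))"
      by (intro lift_rc_rm clin j)
    also have "\<dots> = (\<Sum>k=1..N. swe (\<lambda>x1 x2. \<phi> j (\<omega> k \<star> x1) *\<^sub>C (J k i * x2)) x)"
      unfolding rc_omega[OF i] by (intro tensor_lift_decomp clin j)
    also have "\<dots> = (\<Sum>k=1..N. swe (\<lambda>x1 x2. f k j x1 *\<^sub>C (J k i * x2)) x)"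
      by (rule sum.cong) (simp_all add: \<phi>_rm j)
    finally show ?thesis .
  qed
  ultimately show ?thesis by simp
qed

section \<open>Relations between the functionals\<close>

lemma tensor_lift_mult_middle:
  fixes c :: complex
  shows "tensor_lift (\<lambda>x y. a x * (c * b y)) t = c * tensor_lift (\<lambda>x y. a x * b y) t"
  unfolding tensor_lift_mult_left[symmetric] by (simp only: mult.left_commute)

text \<open>The functional \<open>f n q\<close> is applied to both sides of \<open>f_J\<close>.
  Multiplicativity splits each product, and the factors at entries of \<open>J\<close> are the braid
  coefficients.\<close>

lemma braid_f_f:
  assumes "n \<in> I" "m \<in> I" "p \<in> I" "q \<in> I"
  shows "(\<Sum>i=1..N. \<Sum>j=1..N. \<sigma> i j n m * conv A (f i p) (f j q) x) =
    (\<Sum>i=1..N. \<Sum>j=1..N. conv A (f n i) (f m j) x * \<sigma> p q i j)"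
proof -
  have "f n q (\<Sum>l=1..N. (f m l \<triangleright> x) * J p l) =
      f n q (\<Sum>k=1..N. swe (\<lambda>x1 x2. f k p x1 *\<^sub>C (J k m * x2)) x)"
    using f_J[OF assms(2,3), of x] by simp
  moreover have "f n q (\<Sum>l=1..N. (f m l \<triangleright> x) * J p l) =
      (\<Sum>l=1..N. \<Sum>r=1..N. conv A (f n r) (f m l) x * \<sigma> p q r l)"
    using assms by (simp add: clinear_sum[OF f_clinear] f_mult func_la[OF f_clinear] braid_coeff_def)
  moreover have "f n q (\<Sum>k=1..N. swe (\<lambda>x1 x2. f k p x1 *\<^sub>C (J k m * x2)) x) =
      (\<Sum>k=1..N. \<Sum>r=1..N. \<sigma> k r n m * conv A (f k p) (f r q) x)"
    using assms
    by (simp add: clinear_sum[OF f_clinear] tensor_lift_push[OF f_clinear] clinear_scale[OF f_clinear] f_mult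
        braid_coeff_def conv_def sum_distrib_left tensor_lift_sum tensor_lift_mult_middle)
  ultimately show ?thesis
    by (simp add: sum.swap[of "\<lambda>l r. conv A (f n r) (f m l) x * \<sigma> p q r l"])
qed

text \<open>Here \<open>X b\<close> is applied to both sides of \<open>f_J\<close>. Its twisted
  Leibniz rule yields two terms on each side: the values of \<open>X\<close> and \<open>f\<close> at
  entries of \<open>J\<close> are the structure and braid coefficients, and the counit of
  \<open>J\<close> selects the isolated term.\<close>

lemma mixed_relation:
  assumes "i \<in> I" "b \<in> I" "k \<in> I"
  shows "(\<Sum>r=1..N. \<Sum>c=1..N. struct_coeff X J r c i * conv A (f r k) (f c b) x) + conv A (f i k) (X b) x =
    (\<Sum>c=1..N. \<Sum>l=1..N. \<sigma> k b c l * conv A (X c) (f i l) x) +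
    (\<Sum>l=1..N. struct_coeff X J k b l * f i l x)"
proof -
  have "X b (\<Sum>l=1..N. (f i l \<triangleright> x) * J k l) =
      X b (\<Sum>r=1..N. swe (\<lambda>x1 x2. f r k x1 *\<^sub>C (J r i * x2)) x)"
    using f_J[OF assms(1,3), of x] by simp
  moreover have "X b (\<Sum>l=1..N. (f i l \<triangleright> x) * J k l) =
      (\<Sum>l=1..N. struct_coeff X J k b l * f i l x) +
      (\<Sum>l=1..N. \<Sum>c=1..N. \<sigma> k b c l * conv A (X c) (f i l) x)"
    using assms by (simp add: clinear_sum[OF X_clinear] X_mult func_la[OF X_clinear] eps_la[OF f_clinear]
        braid_coeff_def struct_coeff_def sum.distrib mult.commute)
  moreover have "X b (\<Sum>r=1..N. swe (\<lambda>x1 x2. f r k x1 *\<^sub>C (J r i * x2)) x) =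
      (\<Sum>r=1..N. \<epsilon> (J r i) * conv A (f r k) (X b) x) +
      (\<Sum>r=1..N. \<Sum>c=1..N. struct_coeff X J r c i * conv A (f r k) (f c b) x)"
    using assms
    by (simp add: clinear_sum[OF X_clinear] tensor_lift_push[OF X_clinear] clinear_scale[OF X_clinear] X_mult
        struct_coeff_def conv_def sum_distrib_left tensor_lift_sum tensor_lift_mult_middle
        distrib_left sum.distrib tensor_lift_plus)
  moreover have "(\<Sum>r=1..N. \<epsilon> (J r i) * conv A (f r k) (X b) x) = conv A (f i k) (X b) x"
    using assms by (simp add: eps_J sum_delta_mult)
  ultimately show ?thesis
    by (simp add: sum.swap[of "\<lambda>l c. \<sigma> k b c l * conv A (X c) (f i l) x"] add.commute)
qed

text \<open>Writing \<open>\<omega> j\<close> as a sum of terms \<open>x dy\<close>, the functional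
  sends \<open>h\<close> to the sum of the numbers \<open>\<epsilon> x * h y\<close>. At
  \<open>X i\<close> this is the pairing of \<open>X i\<close> with
  \<open>\<omega> j\<close>.\<close>

lemma dual_functional:
  assumes "j \<in> I"
  shows "\<exists>g :: ('a \<Rightarrow> complex) \<Rightarrow> complex. clinear g \<and> (\<forall>i\<in>I. g (X i) = (if i = j then 1 else 0))"
proof -
  obtain n :: nat and x y where xy: "\<omega> j = (\<Sum>k<n. x k \<cdot> D (y k))"
    using bicovariant unfolding bicovariant_calculus_def by blast
  define g where "g h = (\<Sum>k<n. \<epsilon> (x k) * h (y k))" for h :: "'a \<Rightarrow> complex"
  have "clinear g"
    unfolding g_def
    by (rule clinearI) (simp_all add: plus_fun_def scaleC_fun_def distrib_left sum.distrib sum_distrib_left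
        mult.left_commute)
  moreover have "g (X i) = (if i = j then 1 else 0)" if "i \<in> I" for i
  proof -
    have "\<phi> i (\<omega> j) = g (X i)"
      unfolding xy g_def using that by (simp add: clinear_sum[OF \<phi>_clinear] \<phi>_D)
    then show ?thesis using that assms by (simp add: \<phi>_omega)
  qed
  ultimately show ?thesis by blast
qed

text \<open>Products of dual functionals separate the tensors \<open>X k \<otimes> X l\<close>. This
  turns an equation between elements of the tensor square of the tangent space into equations
  between coefficient arrays.\<close>

lemma X_tensor_coeffs:
  assumes "(\<Sum>k=1..N. \<Sum>l=1..N. b k l *\<^sub>C (X k \<otimes> X l)) = (\<Sum>k=1..N. \<Sum>l=1..N. c k l *\<^sub>C (X k \<otimes> X l))"
    and "i \<in> I" and "j \<in> I"
  shows "b i j = c i j"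
proof -
  obtain g :: "('a \<Rightarrow> complex) \<Rightarrow> complex" and h :: "('a \<Rightarrow> complex) \<Rightarrow> complex"
    where g: "clinear g" "\<forall>k\<in>I. g (X k) = (if k = i then 1 else 0)"
    and h: "clinear h" "\<forall>k\<in>I. h (X k) = (if k = j then 1 else 0)"
    using dual_functional[OF assms(2)] dual_functional[OF assms(3)] by blast
  have bil: "cbilinear (\<lambda>x y. g x * h y)"
    by (intro clin clinear_comp[OF g(1)] clinear_comp[OF h(1)])
  let ?T = "tensor_lift (\<lambda>x y. g x * h y)"
  have "?T (\<Sum>k=1..N. \<Sum>l=1..N. b k l *\<^sub>C (X k \<otimes> X l)) = b i j" for b
  proof -
    have "?T (\<Sum>k=1..N. \<Sum>l=1..N. b k l *\<^sub>C (X k \<otimes> X l)) = (\<Sum>k=1..N. \<Sum>l=1..N. b k l *\<^sub>C (g (X k) * h (X l)))"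
      by (simp add: clinear_sum[OF tensor_lift(2)[OF bil]] clinear_scale[OF tensor_lift(2)[OF bil]] tensor_lift(1)[OF bil])
    also have "\<dots> = (\<Sum>k=1..N. (if k = i then 1 else 0) *\<^sub>C (\<Sum>l=1..N. (if l = j then 1 else 0) *\<^sub>C b k l))"
      using g(2) h(2) by (intro sum.cong HOL.refl) (simp add: sum_distrib_left mult.commute)
    also have "\<dots> = b i j"
      using assms(2,3) by (simp only: sum_delta_scaleC finite_atLeastAtMost)
    finally show ?thesis .
  qed
  from this[of b] this[of c] show ?thesis by (simp only: assms(1))
qed

end

section \<open>Algebras given by generators and relations\<close>

lemma free_eval_superset:
  assumes "finite S" and "Poly_Mapping.keys p \<subseteq> S"
  shows "free_eval v p = (\<Sum>w\<in>S. Poly_Mapping.lookup p w *\<^sub>C prod_list (map v (letters w)))"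
  unfolding free_eval_def
  by (rule sum.mono_neutral_left) (use assms in \<open>auto simp: in_keys_iff\<close>)

lemma free_eval_add: "free_eval v (p + q) = free_eval v p + free_eval v q"
proof -
  let ?S = "Poly_Mapping.keys p \<union> Poly_Mapping.keys q"
  have "free_eval v r = (\<Sum>w\<in>?S. Poly_Mapping.lookup r w *\<^sub>C prod_list (map v (letters w)))"
    if "r = p \<or> r = q \<or> r = p + q" for r
    using that keys_add[of p q] by (intro free_eval_superset) auto
  then show ?thesis
    by (simp add: lookup_add scaleC_add_left sum.distrib)
qed

lemma free_eval_zero [simp]: "free_eval v 0 = 0"
  by (simp add: free_eval_def)

lemma free_eval_uminus: "free_eval v (- p) = - free_eval v p"
  using free_eval_add[of v p "- p"] by (simp add: eq_neg_iff_add_eq_0 add.commute)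

lemma free_eval_diff: "free_eval v (p - q) = free_eval v p - free_eval v q"
  using free_eval_add[of v p "- q"] by (simp add: free_eval_uminus)

lemma free_eval_sum: "free_eval v (\<Sum>i\<in>I. p i) = (\<Sum>i\<in>I. free_eval v (p i))"
  by (induction I rule: infinite_finite_induct) (simp_all add: free_eval_add)

lemma free_eval_single:
  "free_eval v (Poly_Mapping.single w c) = c *\<^sub>C prod_list (map v (letters w))"
  by (cases "c = 0") (simp_all add: free_eval_def)

lemma free_algebra_induct:
  fixes p :: "'x free_algebra"
  assumes "P 0" and "\<And>p w c. P p \<Longrightarrow> P (p + Poly_Mapping.single w c)"
  shows "P p"
proof (induction p rule: update_induct)
  case (update p w c)
  have "Poly_Mapping.update w c p = p + Poly_Mapping.single w c"
    using update by (intro poly_mapping_eqI) (auto simp: lookup_update lookup_add lookup_single in_keys_iff when_def)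
  with update assms(2) show ?case by simp
qed (rule assms(1))

lemma free_eval_mult: "free_eval v (p * q) = free_eval v p * free_eval v q"
proof (induction p rule: free_algebra_induct)
  case (2 p w c)
  have "free_eval v (Poly_Mapping.single w c * q) = free_eval v (Poly_Mapping.single w c) * free_eval v q"
  proof (induction q rule: free_algebra_induct)
    case (2 q u e)
    then show ?case
      by (simp add: distrib_left free_eval_add mult_single free_eval_single plus_word_def
          mult_scaleC_left mult_scaleC_right scaleC_scaleC)
  qed simp
  with 2 show ?case
    by (simp add: distrib_right free_eval_add)
qed simp

lemma free_eval_gen [simp]: "free_eval v (gen x) = v x"
  by (simp add: gen_def free_eval_single scaleC_one)

lemma free_eval_scalar [simp]: "free_eval v (scalar c) = c *\<^sub>C 1"
  by (simp add: scalar_def free_eval_single zero_word_def)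

lemma free_eval_one [simp]: "free_eval v 1 = 1"
  by (simp add: single_one[symmetric] free_eval_single zero_word_def scaleC_one del: single_one)

lemma gen_in_free_on [simp]: "x \<in> S \<Longrightarrow> gen x \<in> free_on S"
  by (simp add: gen_def free_on_def)

lemma one_in_free_on [simp]: "1 \<in> free_on S"
  by (simp add: free_on_def zero_word_def)

lemma add_in_free_on: "p \<in> free_on S \<Longrightarrow> q \<in> free_on S \<Longrightarrow> p + q \<in> free_on S"
  using keys_add[of p q] by (auto simp: free_on_def)

lemma uminus_in_free_on: "p \<in> free_on S \<Longrightarrow> - p \<in> free_on S"
  by (simp add: free_on_def)

lemma mult_in_free_on: "p \<in> free_on S \<Longrightarrow> q \<in> free_on S \<Longrightarrow> p * q \<in> free_on S"
  using keys_mult[of p q] by (fastforce simp: free_on_def plus_word_def)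

lemma single_in_free_on: "p \<in> free_on S \<Longrightarrow> Poly_Mapping.single 0 c * p \<in> free_on S"
  by (rule mult_in_free_on) (auto simp: free_on_def zero_word_def)

lemma presented_relation:
  assumes "presented_by v S R" and "r \<in> R"
  shows "free_eval v r = 0"
proof -
  have "r \<in> two_sided_ideal (free_on S) R"
    unfolding two_sided_ideal_def using assms(2)
    by (intro CollectI exI[of _ 1] exI[of _ "\<lambda>_. 1"] exI[of _ "\<lambda>_. r"]) simp
  with assms(1) show ?thesis by (auto simp: presented_by_def)
qed

lemma presented_span:
  assumes "presented_by v S R"
  shows "x \<in> cspan {prod_list (map v w) |w. set w \<subseteq> S}"
proof -
  obtain p where "p \<in> free_on S" "x = free_eval v p"
    using assms by (auto simp: presented_by_def)
  then show ?thesis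
    unfolding free_eval_def free_on_def
    by (simp, intro complex_vector.span_sum complex_vector.span_scale complex_vector.span_base) auto
qed

lemma presented_induct [consumes 1, case_names one add scale mult]:
  assumes "presented_by v S R" and "P 1" and add: "\<And>x y. P x \<Longrightarrow> P y \<Longrightarrow> P (x + y)"
    and scale: "\<And>c x. P x \<Longrightarrow> P (c *\<^sub>C x)" and mult: "\<And>s x. s \<in> S \<Longrightarrow> P x \<Longrightarrow> P (v s * x)"
  shows "P x"
proof -
  have word: "P (prod_list (map v w))" if "set w \<subseteq> S" for w
    using that by (induction w) (auto intro: assms(2) mult)
  have zero: "P 0"
    using scale[OF assms(2), of 0] unfolding scaleC_simps(2) .
  show ?thesis
    using presented_span[OF assms(1), of x]
  proof (induction rule: complex_vector.span_induct_alt)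
    case base
    show ?case by (rule zero)
  next
    case (step c x y)
    from step(1) have "P x" by (elim CollectE exE conjE) (simp only: word)
    then show ?case by (rule add[OF scale step(2)])
  qed
qed

text \<open>The universal property of a presentation. The map is \<open>free_eval v'\<close> of a
  chosen preimage; two preimages differ by an element of the ideal generated by the relations, and
  \<open>v'\<close> annihilates that ideal.\<close>

lemma presented_hom:
  assumes pres: "presented_by v S R" and rel: "\<And>r. r \<in> R \<Longrightarrow> free_eval v' r = 0"
  shows "\<exists>h. algebra_hom h \<and> (\<forall>s\<in>S. h (v s) = v' s)"
proof -
  define rep where "rep x = (SOME p. p \<in> free_on S \<and> free_eval v p = x)" for x
  have rep: "rep x \<in> free_on S" "free_eval v (rep x) = x" for x
  proof -
    have "x \<in> free_eval v ` free_on S"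
      using pres by (simp add: presented_by_def)
    then have "\<exists>p. p \<in> free_on S \<and> free_eval v p = x"
      by auto
    from someI_ex[OF this] show "rep x \<in> free_on S" "free_eval v (rep x) = x"
      by (auto simp: rep_def)
  qed
  define h where "h x = free_eval v' (rep x)" for x
  have h: "h (free_eval v p) = free_eval v' p" if "p \<in> free_on S" for p
  proof -
    let ?q = "rep (free_eval v p) - p"
    have "?q \<in> free_on S"
      using add_in_free_on[OF rep(1) uminus_in_free_on[OF that]] by simp
    moreover have "free_eval v ?q = 0"
      by (simp add: free_eval_diff rep)
    ultimately have "?q \<in> two_sided_ideal (free_on S) R"
      using pres by (auto simp: presented_by_def)
    then obtain n :: nat and a r b where "\<And>k. k < n \<Longrightarrow> r k \<in> R" "?q = (\<Sum>k<n. a k * r k * b k)"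
      unfolding two_sided_ideal_def by blast
    then have "free_eval v' ?q = 0"
      by (simp add: free_eval_sum free_eval_mult rel)
    then show ?thesis
      by (simp add: h_def free_eval_diff)
  qed
  have "algebra_hom h"
    unfolding algebra_hom_def
  proof (intro conjI allI)
    show "clinear h"
    proof (rule clinearI)
      fix x y c
      show "h (x + y) = h x + h y"
        using h[OF add_in_free_on[OF rep(1)[of x] rep(1)[of y]]]
        by (simp add: free_eval_add rep(2) h_def[of x] h_def[of y])
      show "h (c *\<^sub>C x) = c *\<^sub>C h x"
        using h[OF single_in_free_on[OF rep(1)[of x], of c]]
        by (simp add: free_eval_mult free_eval_single rep(2) zero_word_def mult_scaleC_left h_def[of x])
    qed
    show "h 1 = 1" using h[of 1] by simp
    show "h (x * y) = h x * h y" for x y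
      using h[OF mult_in_free_on[OF rep(1)[of x] rep(1)[of y]]]
      by (simp add: free_eval_mult rep(2) h_def[of x] h_def[of y])
  qed
  moreover have "h (v s) = v' s" if "s \<in> S" for s
    using h[of "gen s"] that by simp
  ultimately show ?thesis by blast
qed

section \<open>The exterior algebra\<close>

locale exterior = calculus A G N \<omega> f J X
  for A :: "'a::complex_algebra_1 hopf_struct"
    and G :: "('a, 'g::complex_vector) calculus_struct" and N \<omega> f J X +
  fixes jA :: "'a \<Rightarrow> 't::complex_algebra_1" and jG :: "'g \<Rightarrow> 't"
    and \<pi> :: "'t \<Rightarrow> 'w::complex_algebra_1" and d :: "'w \<Rightarrow> 'w"
    and \<Lambda> :: "'w \<Rightarrow> ('a, 'w) tensor" and iR :: "nat \<Rightarrow> 'w \<Rightarrow> 'w"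
  assumes tensor_algebra: "is_tensor_algebra G jA jG"
    and \<pi>_hom: "algebra_hom \<pi>" and \<pi>_surj: "surj \<pi>"
    and derivative: "is_exterior_derivative G (ext_degree jA jG \<pi>) (\<pi> \<circ> jA) (\<pi> \<circ> jG) d"
    and coaction: "is_ext_lcoact A (\<pi> \<circ> jA) d \<Lambda>"
    and inner: "is_right_inner_derivative A G N \<omega> f J (ext_degree jA jG \<pi>) (\<pi> \<circ> jA) (\<pi> \<circ> jG) \<Lambda> iR"
begin

definition iA :: "'a \<Rightarrow> 'w" where "iA x = \<pi> (jA x)"
definition iG :: "'g \<Rightarrow> 'w" where "iG \<gamma> = \<pi> (jG \<gamma>)"
abbreviation W where "W \<equiv> ext_degree jA jG \<pi>"

lemma \<pi>_clinear: "clinear \<pi>" and \<pi>_one: "\<pi> 1 = 1" and \<pi>_mult: "\<pi> (x * y) = \<pi> x * \<pi> y"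
  using \<pi>_hom by (auto simp: algebra_hom_def)

lemma tensor_relation:
  assumes "r \<in> tensor_algebra_relations G"
  shows "free_eval (case_sum jA jG) r = 0"
  using tensor_algebra assms unfolding is_tensor_algebra_def by (rule presented_relation)

lemma jA_one: "jA 1 = 1"
proof -
  have "gen (Inl 1) - 1 \<in> tensor_algebra_relations G"
    by (simp add: tensor_algebra_relations_def)
  from tensor_relation[OF this] show ?thesis by (simp add: free_eval_diff)
qed

lemma jA_add: "jA (x + y) = jA x + jA y"
proof -
  have "gen (Inl (x + y)) - gen (Inl x) - gen (Inl y) \<in> tensor_algebra_relations G"
    unfolding tensor_algebra_relations_def by blast
  from tensor_relation[OF this] show ?thesis by (simp add: free_eval_diff diff_eq_eq add.commute)
qed

lemma jA_scale: "jA (c *\<^sub>C x) = c *\<^sub>C jA x"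
proof -
  have "gen (Inl (c *\<^sub>C x)) - scalar c * gen (Inl x) \<in> tensor_algebra_relations G"
    unfolding tensor_algebra_relations_def by blast
  from tensor_relation[OF this] show ?thesis
    by (simp add: free_eval_diff free_eval_mult mult_scaleC_left)
qed

lemma jA_mult: "jA (x * y) = jA x * jA y"
proof -
  have "gen (Inl (x * y)) - gen (Inl x) * gen (Inl y) \<in> tensor_algebra_relations G"
    unfolding tensor_algebra_relations_def by blast
  from tensor_relation[OF this] show ?thesis by (simp add: free_eval_diff free_eval_mult)
qed

lemma jG_add: "jG (x + y) = jG x + jG y"
proof -
  have "gen (Inr (x + y)) - gen (Inr x) - gen (Inr y) \<in> tensor_algebra_relations G"
    unfolding tensor_algebra_relations_def by blast
  from tensor_relation[OF this] show ?thesis by (simp add: free_eval_diff diff_eq_eq add.commute)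
qed

lemma jG_lm: "jG (x \<cdot> \<gamma>) = jA x * jG \<gamma>"
proof -
  have "gen (Inr (x \<cdot> \<gamma>)) - gen (Inl x) * gen (Inr \<gamma>) \<in> tensor_algebra_relations G"
    unfolding tensor_algebra_relations_def by blast
  from tensor_relation[OF this] show ?thesis by (simp add: free_eval_diff free_eval_mult)
qed

lemma jG_rm: "jG (\<gamma> \<star> x) = jG \<gamma> * jA x"
proof -
  have "gen (Inr (\<gamma> \<star> x)) - gen (Inr \<gamma>) * gen (Inl x) \<in> tensor_algebra_relations G"
    unfolding tensor_algebra_relations_def by blast
  from tensor_relation[OF this] show ?thesis by (simp add: free_eval_diff free_eval_mult)
qed

lemma jG_scale: "jG (c *\<^sub>C \<gamma>) = c *\<^sub>C jG \<gamma>"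
proof -
  have "c *\<^sub>C \<gamma> = (c *\<^sub>C 1) \<cdot> \<gamma>"
    by (simp add: clinear_scale[OF lm_lin(1)[OF clinear_id]])
  then show ?thesis by (simp add: jG_lm jA_scale jA_one mult_scaleC_left)
qed

lemma iA_clinear: "clinear iA"
  unfolding iA_def[abs_def] by (intro clinear_comp[OF \<pi>_clinear] clinearI jA_add jA_scale)

lemma iG_clinear: "clinear iG"
  unfolding iG_def[abs_def] by (intro clinear_comp[OF \<pi>_clinear] clinearI jG_add jG_scale)

lemmas iA_lin [clin] = clinear_comp[OF iA_clinear]
lemmas iG_lin [clin] = clinear_comp[OF iG_clinear]

lemma iA_one [simp]: "iA 1 = 1"
  by (simp add: iA_def jA_one \<pi>_one)

lemma iA_mult: "iA (x * y) = iA x * iA y"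
  by (simp add: iA_def jA_mult \<pi>_mult)

lemma iG_lm: "iG (x \<cdot> \<gamma>) = iA x * iG \<gamma>" and iG_rm: "iG (\<gamma> \<star> x) = iG \<gamma> * iA x"
  by (simp_all add: iA_def iG_def jG_lm jG_rm \<pi>_mult)

lemma \<pi>_prod: "\<pi> (jA x * prod_list (map jG \<gamma>s)) = iA x * prod_list (map iG \<gamma>s)"
proof -
  have "\<pi> (prod_list (map jG \<gamma>s)) = prod_list (map iG \<gamma>s)"
    by (induction \<gamma>s) (simp_all add: \<pi>_one \<pi>_mult iG_def)
  then show ?thesis by (simp add: \<pi>_mult iA_def)
qed

section \<open>Homogeneous components and inductions along products\<close>

lemma W_eq: "W n = cspan {iA x * prod_list (map iG \<gamma>s) |x \<gamma>s. length \<gamma>s = n}"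
proof -
  have "W n = cspan (\<pi> ` {jA x * prod_list (map jG \<gamma>s) |x \<gamma>s. length \<gamma>s = n})"
    unfolding ext_degree_def tensor_power_def
    by (rule complex_vector_pair.linear_span_image[OF \<pi>_clinear, symmetric])
  also have "\<pi> ` {jA x * prod_list (map jG \<gamma>s) |x \<gamma>s. length \<gamma>s = n} =
      {iA x * prod_list (map iG \<gamma>s) |x \<gamma>s. length \<gamma>s = n}"
    by (auto simp: \<pi>_prod[symmetric] image_def)
  finally show ?thesis .
qed

lemma W_subspace: "module.subspace scaleC (W n)"
  unfolding W_eq by (rule complex_vector.subspace_span)

lemmas W_add = complex_vector.subspace_add[OF W_subspace]
  and W_scale = complex_vector.subspace_scale[OF W_subspace]
  and W_zero = complex_vector.subspace_0[OF W_subspace]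
  and W_sum = complex_vector.subspace_sum[OF W_subspace]
  and W_neg = complex_vector.subspace_neg[OF W_subspace]

lemma W_base: "length \<gamma>s = n \<Longrightarrow> iA x * prod_list (map iG \<gamma>s) \<in> W n"
  unfolding W_eq by (rule complex_vector.span_base) blast

lemma iA_W: "iA x \<in> W 0"
  using W_base[of "[]" 0 x] by simp

lemma iG_W: "iG \<gamma> \<in> W (Suc 0)"
  using W_base[of "[\<gamma>]" "Suc 0" 1] by simp

lemma W_span_induct [consumes 1, case_names base add scale]:
  assumes "\<alpha> \<in> W n" and "\<And>x \<gamma>s. length \<gamma>s = n \<Longrightarrow> P (iA x * prod_list (map iG \<gamma>s))"
    and "\<And>\<alpha> \<beta>. P \<alpha> \<Longrightarrow> P \<beta> \<Longrightarrow> P (\<alpha> + \<beta>)" and "\<And>c \<alpha>. P \<alpha> \<Longrightarrow> P (c *\<^sub>C \<alpha>)"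
  shows "P \<alpha>"
  using assms(1) unfolding W_eq
proof (induction rule: complex_vector.span_induct_alt)
  case base
  \<comment> \<open>Some product of \<open>n\<close> one-forms always exists, so \<open>P 0\<close>
    follows by scaling it with 0.\<close>
  have "length (replicate n 0) = n" by simp
  from assms(4)[OF assms(2)[OF this], of 0 undefined] show ?case unfolding scaleC_simps(2) .
next
  case (step c x y)
  from step(1) have "P x" by (elim CollectE exE conjE) (simp only: assms(2))
  then show ?case by (rule assms(3)[OF assms(4) step(2)])
qed

lemma iG_mult_W: "\<alpha> \<in> W n \<Longrightarrow> iG \<gamma> * \<alpha> \<in> W (Suc n)"
proof (induction rule: W_span_induct)
  case (base x \<gamma>s)
  have "iG \<gamma> * (iA x * prod_list (map iG \<gamma>s)) = iA 1 * prod_list (map iG (\<gamma> \<star> x # \<gamma>s))"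
    by (simp add: iG_rm mult.assoc)
  then show ?case using W_base[of "\<gamma> \<star> x # \<gamma>s" "Suc n" 1] base by simp
qed (simp_all add: distrib_left mult_scaleC_right W_add W_scale)

lemma W_induct [consumes 1, case_names iA iG add scale]:
  assumes "\<alpha> \<in> W n" and iA: "\<And>x. P 0 (iA x)"
    and iG: "\<And>n \<gamma> \<alpha>. \<alpha> \<in> W n \<Longrightarrow> P n \<alpha> \<Longrightarrow> P (Suc n) (iG \<gamma> * \<alpha>)"
    and add: "\<And>n \<alpha> \<beta>. P n \<alpha> \<Longrightarrow> P n \<beta> \<Longrightarrow> P n (\<alpha> + \<beta>)"
    and scale: "\<And>n c \<alpha>. P n \<alpha> \<Longrightarrow> P n (c *\<^sub>C \<alpha>)"
  shows "P n \<alpha>"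
  using assms(1)
proof (induction rule: W_span_induct)
  case (base x \<gamma>s)
  then show ?case
  proof (induction \<gamma>s arbitrary: x n)
    case Nil
    then show ?case using iA[of x] by simp
  next
    case (Cons \<gamma> \<gamma>s)
    have "iA 1 * prod_list (map iG \<gamma>s) \<in> W (length \<gamma>s)"
      by (rule W_base) simp
    \<comment> \<open>The coefficient \<open>x\<close> is absorbed into the first one-form, so the
      remaining product has coefficient 1.\<close>
    from iG[OF this Cons.IH[OF HOL.refl], of "x \<cdot> \<gamma>"] Cons.prems show ?case
      by (auto simp: iG_lm mult.assoc)
  qed
qed (fact add scale)+

text \<open>Every form is the image of an element of the tensor algebra, and there each element
  arises from 1 by linear operations and left multiplication with generators.\<close>

lemma gen_induct [case_names one add scale iA iG]:
  assumes one: "P 1" and add: "\<And>\<alpha> \<beta>. P \<alpha> \<Longrightarrow> P \<beta> \<Longrightarrow> P (\<alpha> + \<beta>)"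
    and scale: "\<And>c \<alpha>. P \<alpha> \<Longrightarrow> P (c *\<^sub>C \<alpha>)" and iA: "\<And>x \<alpha>. P \<alpha> \<Longrightarrow> P (iA x * \<alpha>)"
    and iG: "\<And>\<gamma> \<alpha>. P \<alpha> \<Longrightarrow> P (iG \<gamma> * \<alpha>)"
  shows "P \<alpha>"
proof -
  obtain t where t: "\<alpha> = \<pi> t"
    using \<pi>_surj by (auto simp: surj_def)
  have "P (\<pi> t)"
    using tensor_algebra[unfolded is_tensor_algebra_def]
  proof (induction t rule: presented_induct)
    case one
    show ?case unfolding \<pi>_one by (rule assms(1))
  next
    case (add x y)
    then show ?case unfolding clinear_add[OF \<pi>_clinear] by (rule assms(2))
  next
    case (scale c x)
    then show ?case unfolding clinear_scale[OF \<pi>_clinear] by (rule assms(3))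
  next
    case (mult s x)
    then show ?case
      using assms(4)[OF mult(2)] assms(5)[OF mult(2)]
      by (cases s) (simp_all add: \<pi>_mult iA_def iG_def)
  qed
  with t show ?thesis by simp
qed

lemma d_clinear: "clinear d" and d_iA: "d (iA x) = iG (D x)"
  and d_W: "\<alpha> \<in> W n \<Longrightarrow> d \<alpha> \<in> W (Suc n)"
  and d_mult: "\<alpha> \<in> W n \<Longrightarrow> d (\<alpha> * \<beta>) = d \<alpha> * \<beta> + (-1) ^ n *\<^sub>C (\<alpha> * d \<beta>)"
  and d_d [simp]: "d (d \<alpha>) = 0"
  using derivative by (auto simp: is_exterior_derivative_def iA_def iG_def)

lemmas d_lin [clin] = clinear_comp[OF d_clinear]

lemma d_iA_mult: "d (iA x * \<beta>) = iG (D x) * \<beta> + iA x * d \<beta>"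
  using d_mult[OF iA_W] by (simp add: d_iA)

section \<open>Multiplicativity of the left coaction\<close>

lemma \<Lambda>_clinear: "clinear \<Lambda>"
  using coaction by (auto simp: is_ext_lcoact_def left_comodule_def)

lemmas \<Lambda>_lin [clin] = clinear_comp[OF \<Lambda>_clinear]

lemma lift_\<Lambda>_iA:
  assumes "cbilinear B"
  shows "tensor_lift B (\<Lambda> (iA x)) = swe (\<lambda>x1 x2. B x1 (iA x2)) x"
proof -
  have "\<Lambda> (iA x) = tensor_map id iA (comul A x)"
    using coaction by (auto simp: is_ext_lcoact_def iA_def[abs_def] comp_def)
  then show ?thesis
    by (simp add: tensor_lift_map[OF assms])
qed

lemma lift_\<Lambda>_iA_d:
  assumes "cbilinear B"
  shows "tensor_lift B (\<Lambda> (iA x * d \<alpha>)) =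
    swe (\<lambda>x1 x2. tensor_lift (\<lambda>a \<beta>. B (x1 * a) (iA x2 * d \<beta>)) (\<Lambda> \<alpha>)) x"
proof -
  note [clin] = cbilinear_left[OF assms] cbilinear_right[OF assms]
  have "\<Lambda> (iA x * d \<alpha>) =
      tensor_act (*) (\<lambda>y \<beta>. iA y * \<beta>) (comul A x) (tensor_map id d (\<Lambda> \<alpha>))"
    using coaction by (auto simp: is_ext_lcoact_def iA_def[abs_def] comp_def)
  moreover have "tensor_lift (\<lambda>a \<beta>. B (x1 * a) (iA x2 * \<beta>)) (tensor_map id d (\<Lambda> \<alpha>)) =
      tensor_lift (\<lambda>a \<beta>. B (x1 * id a) (iA x2 * d \<beta>)) (\<Lambda> \<alpha>)" for x1 x2
    by (rule tensor_lift_map) (intro clin)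
  ultimately show ?thesis
    by (simp add: tensor_lift_act[OF assms])
qed

lemma lift_\<Lambda>_d:
  assumes "cbilinear B"
  shows "tensor_lift B (\<Lambda> (d \<alpha>)) = tensor_lift (\<lambda>a \<beta>. B a (d \<beta>)) (\<Lambda> \<alpha>)"
proof -
  note [clin] = cbilinear_left[OF assms] cbilinear_right[OF assms]
  have "tensor_lift B (\<Lambda> (iA 1 * d \<alpha>)) =
      swe (\<lambda>x1 x2. tensor_lift (\<lambda>a \<beta>. B (x1 * a) (iA x2 * d \<beta>)) (\<Lambda> \<alpha>)) 1"
    by (rule lift_\<Lambda>_iA_d[OF assms])
  also have "\<dots> = tensor_lift (\<lambda>a \<beta>. B (1 * a) (iA 1 * d \<beta>)) (\<Lambda> \<alpha>)"
    by (rule swe_one) (intro clin)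
  finally show ?thesis by simp
qed

text \<open>These are the elements on which the coaction is prescribed, so they must be shown to
  span. Their span contains 1 and is closed under left multiplication by functions and by exact
  one-forms, the latter because \<open>dy \<beta> = d(y \<beta>) - y d\<beta>\<close>.\<close>

lemma exact_span:
  assumes "\<And>x. P (iA x)" and "\<And>x \<alpha>. P (iA x * d \<alpha>)"
    and "\<And>\<alpha> \<beta>. P \<alpha> \<Longrightarrow> P \<beta> \<Longrightarrow> P (\<alpha> + \<beta>)"
  shows "P \<alpha>"
proof -
  define R where "R = {iA x |x. True} \<union> {iA x * d \<alpha> |x \<alpha>. True}"
  have R: "(\<exists>x. \<beta> = iA x) \<or> (\<exists>x \<gamma>. \<beta> = iA x * d \<gamma>)" if "\<beta> \<in> R" for \<beta>
    using that by (auto simp: R_def)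
  have closed: "h \<beta> \<in> cspan R" if "\<beta> \<in> cspan R" "clinear h" "\<And>\<alpha>. \<alpha> \<in> R \<Longrightarrow> h \<alpha> \<in> cspan R" for h \<beta>
    using that(1)
    by (induction rule: complex_vector.span_induct_alt)
      (simp_all add: clinear_0[OF that(2)] clinear_add[OF that(2)] clinear_scale[OF that(2)]
        complex_vector.span_zero complex_vector.span_add complex_vector.span_scale that(3))
  have base1: "iA x \<in> cspan R" for x
    by (rule complex_vector.span_base) (auto simp: R_def)
  have base2: "iA x * d \<alpha> \<in> cspan R" for x \<alpha>
    by (rule complex_vector.span_base) (auto simp: R_def)
  have mult_iA: "iA x * \<beta> \<in> cspan R" if "\<beta> \<in> cspan R" for x \<beta>
    using that
  proof (rule closed)
    fix \<alpha> assume "\<alpha> \<in> R"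
    from R[OF this] show "iA x * \<alpha> \<in> cspan R"
      by (auto simp: mult.assoc[symmetric] iA_mult[symmetric] base1 base2)
  qed (intro clin)
  have mult_iGD: "iG (D y) * \<beta> \<in> cspan R" for y \<beta>
  proof -
    have "iG (D y) * \<beta> = iA 1 * d (iA y * \<beta>) - iA y * d \<beta>"
      by (simp add: d_iA_mult)
    then show ?thesis
      by (simp only: complex_vector.span_diff base2)
  qed
  have "\<alpha> \<in> cspan R"
  proof (induction \<alpha> rule: gen_induct)
    case one
    show ?case using base1[of 1] by simp
  next
    case (iG \<gamma> \<beta>)
    obtain n :: nat and x y where "\<gamma> = (\<Sum>k<n. x k \<cdot> D (y k))"
      using bicovariant unfolding bicovariant_calculus_def by blast
    then have "iG \<gamma> * \<beta> = (\<Sum>k<n. iA (x k) * (iG (D (y k)) * \<beta>))"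
      by (simp add: clinear_sum[OF iG_clinear] sum_distrib_right iG_lm mult.assoc)
    then show ?case
      by (simp only: complex_vector.span_sum mult_iA mult_iGD)
  qed (simp_all add: complex_vector.span_add complex_vector.span_scale mult_iA)
  then show ?thesis
  proof (induction rule: complex_vector.span_induct_alt)
    case base
    show ?case using assms(1)[of 0] by (simp add: clinear_0[OF iA_clinear])
  next
    case (step c x y)
    have "P (c *\<^sub>C x)"
      using R[OF step(1)] assms(1,2)
      by (auto simp: clinear_scale[OF iA_clinear, symmetric] mult_scaleC_left[symmetric])
    then show ?case using step(2) by (rule assms(3))
  qed
qed

text \<open>Left multiplication by a function preserves the two kinds of elements on which the
  coaction is prescribed, so multiplicativity of the coproduct suffices.\<close>

lemma lift_\<Lambda>_iA_mult:
  assumes "cbilinear B"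
  shows "tensor_lift B (\<Lambda> (iA x * \<beta>)) =
    swe (\<lambda>x1 x2. tensor_lift (\<lambda>b \<beta>. B (x1 * b) (iA x2 * \<beta>)) (\<Lambda> \<beta>)) x"
proof (induction \<beta> rule: exact_span)
  note [clin] = cbilinear_left[OF assms] cbilinear_right[OF assms]
  {
    case (1 y)
    have "tensor_lift (\<lambda>b \<beta>. B (x1 * b) (iA x2 * \<beta>)) (\<Lambda> (iA y)) =
        swe (\<lambda>y1 y2. B (x1 * y1) (iA x2 * iA y2)) y" for x1 x2
      by (rule lift_\<Lambda>_iA) (intro clin)
    moreover have "swe (\<lambda>w1 w2. B w1 (iA w2)) (x * y) =
        swe (\<lambda>x1 x2. swe (\<lambda>y1 y2. B (x1 * y1) (iA (x2 * y2))) y) x"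
      by (rule swe_mult) (intro clin)
    ultimately show ?case
      by (simp only: iA_mult[symmetric] lift_\<Lambda>_iA[OF assms])
  next
    case (2 y \<alpha>)
    have "tensor_lift (\<lambda>b \<beta>. B (x1 * b) (iA x2 * \<beta>)) (\<Lambda> (iA y * d \<alpha>)) =
        swe (\<lambda>y1 y2. tensor_lift (\<lambda>a \<beta>. B (x1 * (y1 * a)) (iA x2 * (iA y2 * d \<beta>))) (\<Lambda> \<alpha>)) y" for x1 x2
      by (rule lift_\<Lambda>_iA_d) (intro clin)
    moreover have "swe (\<lambda>w1 w2. tensor_lift (\<lambda>a \<beta>. B (w1 * a) (iA w2 * d \<beta>)) (\<Lambda> \<alpha>)) (x * y) =
        swe (\<lambda>x1 x2. swe (\<lambda>y1 y2. tensor_lift (\<lambda>a \<beta>. B (x1 * y1 * a) (iA (x2 * y2) * d \<beta>)) (\<Lambda> \<alpha>)) y) x"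
      by (rule swe_mult) (intro clin)
    moreover have "tensor_lift B (\<Lambda> (iA x * (iA y * d \<alpha>))) =
        swe (\<lambda>w1 w2. tensor_lift (\<lambda>a \<beta>. B (w1 * a) (iA w2 * d \<beta>)) (\<Lambda> \<alpha>)) (x * y)"
      using lift_\<Lambda>_iA_d[OF assms, of "x * y" \<alpha>] by (simp only: iA_mult mult.assoc)
    ultimately show ?case
      by (simp only: iA_mult mult.assoc)
  next
    case (3 \<alpha> \<beta>)
    have add: "tensor_lift B' (\<Lambda> (\<alpha> + \<beta>)) = tensor_lift B' (\<Lambda> \<alpha>) + tensor_lift B' (\<Lambda> \<beta>)"
      if "cbilinear B'" for B' :: "'a \<Rightarrow> 'w \<Rightarrow> 'b" and \<alpha> \<beta>
      by (simp add: clinear_add[OF \<Lambda>_clinear] clinear_add[OF tensor_lift(2)[OF that]])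
    have "cbilinear (\<lambda>b \<beta>. B (x1 * b) (iA x2 * \<beta>))" for x1 x2
      by (intro clin)
    with 3 show ?case
      by (simp add: distrib_left add[OF assms] add tensor_lift_plus)
  }
qed

text \<open>The same rewriting \<open>dy \<beta> = d(y \<beta>) - y d\<beta>\<close> reduces a left
  factor \<open>dy\<close> to compatibility of the coaction with \<open>d\<close> and with
  functions.\<close>

lemma lift_\<Lambda>_iGD_mult:
  assumes "cbilinear B"
  shows "tensor_lift B (\<Lambda> (iG (D y) * \<beta>)) =
    swe (\<lambda>y1 y2. tensor_lift (\<lambda>b \<beta>. B (y1 * b) (iG (D y2) * \<beta>)) (\<Lambda> \<beta>)) y"
proof -
  note [clin] = cbilinear_left[OF assms] cbilinear_right[OF assms]
  have split: "iG (D y) * \<beta> = d (iA y * \<beta>) - iA y * d \<beta>" for y \<beta>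
    by (simp add: d_iA_mult)
  have "tensor_lift B (\<Lambda> (d (iA y * \<beta>))) = tensor_lift (\<lambda>a \<beta>. B a (d \<beta>)) (\<Lambda> (iA y * \<beta>))"
    by (rule lift_\<Lambda>_d[OF assms])
  also have "\<dots> = swe (\<lambda>y1 y2. tensor_lift (\<lambda>b \<beta>. B (y1 * b) (d (iA y2 * \<beta>))) (\<Lambda> \<beta>)) y"
    by (rule lift_\<Lambda>_iA_mult) (intro clin)
  finally have 1: "tensor_lift B (\<Lambda> (d (iA y * \<beta>))) = \<dots>" .
  have minus: "tensor_lift F t - tensor_lift F' t = tensor_lift (\<lambda>x y. F x y - F' x y) t"
    for F F' :: "'x::complex_vector \<Rightarrow> 'y::complex_vector \<Rightarrow> 'b" and t
    using tensor_lift_plus[of "\<lambda>x y. F x y - F' x y" F' t] by simp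
  show ?thesis
    unfolding split clinear_diff[OF \<Lambda>_clinear] clinear_diff[OF tensor_lift(2)[OF assms]] 1
      lift_\<Lambda>_iA_d[OF assms] minus clinear_diff[OF cbilinear_right[OF assms clinear_id]] ..
qed

lemma lift_\<Lambda>_iG:
  assumes "cbilinear B"
  shows "tensor_lift B (\<Lambda> (iG \<gamma>)) = tensor_lift (\<lambda>a \<beta>. B a (iG \<beta>)) (lc \<gamma>)"
proof (rule forms_ext[where \<gamma> = \<gamma>])
  note [clin] = cbilinear_left[OF assms] cbilinear_right[OF assms]
  show "clinear (\<lambda>\<gamma>. tensor_lift B (\<Lambda> (iG \<gamma>)))" "clinear (\<lambda>\<gamma>. tensor_lift (\<lambda>a \<beta>. B a (iG \<beta>)) (lc \<gamma>))"
    by (intro clin assms)+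
  fix x y
  have "tensor_lift B (\<Lambda> (iG (x \<cdot> D y))) =
      swe (\<lambda>x1 x2. tensor_lift (\<lambda>a \<beta>. B (x1 * a) (iA x2 * d \<beta>)) (\<Lambda> (iA y))) x"
    unfolding iG_lm d_iA[symmetric] by (rule lift_\<Lambda>_iA_d[OF assms])
  also have "\<dots> = swe (\<lambda>x1 x2. swe (\<lambda>y1 y2. B (x1 * y1) (iG (x2 \<cdot> D y2))) y) x"
  proof -
    have "tensor_lift (\<lambda>a \<beta>. B (x1 * a) (iA x2 * d \<beta>)) (\<Lambda> (iA y)) =
        swe (\<lambda>y1 y2. B (x1 * y1) (iA x2 * d (iA y2))) y" for x1 x2
      by (rule lift_\<Lambda>_iA) (intro clin)
    then show ?thesis by (simp only: iG_lm d_iA)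
  qed
  also have "\<dots> = tensor_lift (\<lambda>a \<beta>. B a (iG \<beta>)) (lc (x \<cdot> D y))"
    by (rule lift_lc_D[symmetric]) (intro clin)
  finally show "tensor_lift B (\<Lambda> (iG (x \<cdot> D y))) = tensor_lift (\<lambda>a \<beta>. B a (iG \<beta>)) (lc (x \<cdot> D y))" .
qed

text \<open>Induction on the left factor. The bilinear map is kept arbitrary because each generator
  that is split off is absorbed into it before the hypothesis is used.\<close>

lemma lift_\<Lambda>_mult:
  assumes "cbilinear B"
  shows "tensor_lift B (\<Lambda> (\<alpha> * \<beta>)) =
    tensor_lift (\<lambda>x \<alpha>. tensor_lift (\<lambda>y \<beta>. B (x * y) (\<alpha> * \<beta>)) (\<Lambda> \<beta>)) (\<Lambda> \<alpha>)"
  using assms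
proof (induction \<alpha> arbitrary: B \<beta> rule: gen_induct)
  case one
  note [clin] = cbilinear_left[OF one] cbilinear_right[OF one]
  have "tensor_lift (\<lambda>x \<alpha>. tensor_lift (\<lambda>y \<beta>. B (x * y) (\<alpha> * \<beta>)) (\<Lambda> \<beta>)) (\<Lambda> (iA 1)) =
      tensor_lift (\<lambda>y \<beta>. B (1 * y) (iA 1 * \<beta>)) (\<Lambda> \<beta>)"
    by (subst lift_\<Lambda>_iA, (intro clin)[1], subst swe_one) ((intro clin)[1], rule HOL.refl)
  then show ?case by simp
next
  case (add \<alpha> \<alpha>')
  note [clin] = cbilinear_left[OF add.prems] cbilinear_right[OF add.prems]
  have "cbilinear (\<lambda>x \<alpha>. tensor_lift (\<lambda>y \<beta>. B (x * y) (\<alpha> * \<beta>)) (\<Lambda> \<beta>))"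
    by (intro clin)
  from clinear_add[OF clinear_comp[OF tensor_lift(2)[OF this] \<Lambda>_clinear]]
  show ?case
    by (simp add: distrib_right clinear_add[OF \<Lambda>_clinear] clinear_add[OF tensor_lift(2)[OF add.prems]]
        add.IH[OF add.prems])
next
  case (scale c \<alpha>)
  note [clin] = cbilinear_left[OF scale.prems] cbilinear_right[OF scale.prems]
  have "cbilinear (\<lambda>x \<alpha>. tensor_lift (\<lambda>y \<beta>. B (x * y) (\<alpha> * \<beta>)) (\<Lambda> \<beta>))"
    by (intro clin)
  from clinear_scale[OF clinear_comp[OF tensor_lift(2)[OF this] \<Lambda>_clinear]]
  show ?case
    by (simp add: mult_scaleC_left clinear_scale[OF \<Lambda>_clinear] clinear_scale[OF tensor_lift(2)[OF scale.prems]]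
        scale.IH[OF scale.prems])
next
  case (iA x \<alpha>)
  note [clin] = cbilinear_left[OF iA.prems] cbilinear_right[OF iA.prems]
  have "tensor_lift B (\<Lambda> (iA x * (\<alpha> * \<beta>))) =
      swe (\<lambda>x1 x2. tensor_lift (\<lambda>b \<beta>. B (x1 * b) (iA x2 * \<beta>)) (\<Lambda> (\<alpha> * \<beta>))) x"
    by (rule lift_\<Lambda>_iA_mult[OF iA.prems])
  also have "\<dots> = swe (\<lambda>x1 x2. tensor_lift (\<lambda>a \<alpha>. tensor_lift (\<lambda>b \<beta>.
      B (x1 * (a * b)) (iA x2 * (\<alpha> * \<beta>))) (\<Lambda> \<beta>)) (\<Lambda> \<alpha>)) x"
  proof -
    have "tensor_lift (\<lambda>b \<beta>. B (x1 * b) (iA x2 * \<beta>)) (\<Lambda> (\<alpha> * \<beta>)) = tensor_lift (\<lambda>a \<alpha>.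
        tensor_lift (\<lambda>b \<beta>. B (x1 * (a * b)) (iA x2 * (\<alpha> * \<beta>))) (\<Lambda> \<beta>)) (\<Lambda> \<alpha>)" for x1 x2
      by (rule iA.IH) (intro clin)
    then show ?thesis by (simp only:)
  qed
  also have "\<dots> = swe (\<lambda>x1 x2. tensor_lift (\<lambda>a \<alpha>. tensor_lift (\<lambda>b \<beta>.
      B (x1 * a * b) (iA x2 * \<alpha> * \<beta>)) (\<Lambda> \<beta>)) (\<Lambda> \<alpha>)) x"
    by (simp only: mult.assoc)
  also have "\<dots> = tensor_lift (\<lambda>x \<alpha>. tensor_lift (\<lambda>y \<beta>. B (x * y) (\<alpha> * \<beta>)) (\<Lambda> \<beta>)) (\<Lambda> (iA x * \<alpha>))"
    by (rule lift_\<Lambda>_iA_mult[symmetric]) (intro clin)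
  finally show ?case by (simp only: mult.assoc)
next
  case (iG \<gamma> \<alpha>)
  note [clin] = cbilinear_left[OF iG.prems] cbilinear_right[OF iG.prems]
  show ?case
  proof (rule forms_ext[where \<gamma> = \<gamma>])
    show "clinear (\<lambda>\<gamma>. tensor_lift B (\<Lambda> (iG \<gamma> * \<alpha> * \<beta>)))"
      "clinear (\<lambda>\<gamma>. tensor_lift (\<lambda>x \<alpha>. tensor_lift (\<lambda>y \<beta>. B (x * y) (\<alpha> * \<beta>)) (\<Lambda> \<beta>)) (\<Lambda> (iG \<gamma> * \<alpha>)))"
      by (intro clin iG.prems)+
  next
    fix x y
    \<comment> \<open>Again for every bilinear map: the function \<open>x\<close> in front of
      \<open>dy\<close> is absorbed into the map when this is applied.\<close>
    have step: "tensor_lift B (\<Lambda> (iG (D y) * \<alpha> * \<beta>)) =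
      tensor_lift (\<lambda>x \<alpha>. tensor_lift (\<lambda>y \<beta>. B (x * y) (\<alpha> * \<beta>)) (\<Lambda> \<beta>)) (\<Lambda> (iG (D y) * \<alpha>))"
      if B: "cbilinear B" for B :: "'a \<Rightarrow> 'w \<Rightarrow> 'b"
    proof -
      note [clin] = cbilinear_left[OF B] cbilinear_right[OF B]
      have "tensor_lift B (\<Lambda> (iG (D y) * (\<alpha> * \<beta>))) =
          swe (\<lambda>x1 x2. tensor_lift (\<lambda>b \<beta>. B (x1 * b) (iG (D x2) * \<beta>)) (\<Lambda> (\<alpha> * \<beta>))) y"
        by (rule lift_\<Lambda>_iGD_mult[OF B])
      also have "\<dots> = swe (\<lambda>x1 x2. tensor_lift (\<lambda>a \<alpha>. tensor_lift (\<lambda>b \<beta>.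
          B (x1 * (a * b)) (iG (D x2) * (\<alpha> * \<beta>))) (\<Lambda> \<beta>)) (\<Lambda> \<alpha>)) y"
      proof -
        have "tensor_lift (\<lambda>b \<beta>. B (x1 * b) (iG (D x2) * \<beta>)) (\<Lambda> (\<alpha> * \<beta>)) = tensor_lift (\<lambda>a \<alpha>.
            tensor_lift (\<lambda>b \<beta>. B (x1 * (a * b)) (iG (D x2) * (\<alpha> * \<beta>))) (\<Lambda> \<beta>)) (\<Lambda> \<alpha>)" for x1 x2
          by (rule iG.IH) (intro clin)
        then show ?thesis by (simp only:)
      qed
      also have "\<dots> = swe (\<lambda>x1 x2. tensor_lift (\<lambda>a \<alpha>. tensor_lift (\<lambda>b \<beta>.
          B (x1 * a * b) (iG (D x2) * \<alpha> * \<beta>)) (\<Lambda> \<beta>)) (\<Lambda> \<alpha>)) y"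
        by (simp only: mult.assoc)
      also have "\<dots> = tensor_lift (\<lambda>x \<alpha>. tensor_lift (\<lambda>y \<beta>. B (x * y) (\<alpha> * \<beta>)) (\<Lambda> \<beta>)) (\<Lambda> (iG (D y) * \<alpha>))"
        by (rule lift_\<Lambda>_iGD_mult[symmetric]) (intro clin)
      finally show ?thesis by (simp only: mult.assoc)
    qed
    have "tensor_lift B (\<Lambda> (iA x * (iG (D y) * \<alpha> * \<beta>))) =
        swe (\<lambda>x1 x2. tensor_lift (\<lambda>b \<beta>. B (x1 * b) (iA x2 * \<beta>)) (\<Lambda> (iG (D y) * \<alpha> * \<beta>))) x"
      by (rule lift_\<Lambda>_iA_mult[OF iG.prems])
    also have "\<dots> = swe (\<lambda>x1 x2. tensor_lift (\<lambda>a \<alpha>. tensor_lift (\<lambda>b \<beta>.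
        B (x1 * (a * b)) (iA x2 * (\<alpha> * \<beta>))) (\<Lambda> \<beta>)) (\<Lambda> (iG (D y) * \<alpha>))) x"
    proof -
      have "tensor_lift (\<lambda>b \<beta>. B (x1 * b) (iA x2 * \<beta>)) (\<Lambda> (iG (D y) * \<alpha> * \<beta>)) = tensor_lift (\<lambda>a \<alpha>.
          tensor_lift (\<lambda>b \<beta>. B (x1 * (a * b)) (iA x2 * (\<alpha> * \<beta>))) (\<Lambda> \<beta>)) (\<Lambda> (iG (D y) * \<alpha>))" for x1 x2
        by (rule step) (intro clin)
      then show ?thesis by (simp only:)
    qed
    also have "\<dots> = swe (\<lambda>x1 x2. tensor_lift (\<lambda>a \<alpha>. tensor_lift (\<lambda>b \<beta>.
        B (x1 * a * b) (iA x2 * \<alpha> * \<beta>)) (\<Lambda> \<beta>)) (\<Lambda> (iG (D y) * \<alpha>))) x"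
      by (simp only: mult.assoc)
    also have "\<dots> = tensor_lift (\<lambda>x \<alpha>. tensor_lift (\<lambda>y \<beta>. B (x * y) (\<alpha> * \<beta>)) (\<Lambda> \<beta>)) (\<Lambda> (iA x * (iG (D y) * \<alpha>)))"
      by (rule lift_\<Lambda>_iA_mult[symmetric]) (intro clin)
    finally show "tensor_lift B (\<Lambda> (iG (x \<cdot> D y) * \<alpha> * \<beta>)) =
        tensor_lift (\<lambda>x \<alpha>. tensor_lift (\<lambda>y \<beta>. B (x * y) (\<alpha> * \<beta>)) (\<Lambda> \<beta>)) (\<Lambda> (iG (x \<cdot> D y) * \<alpha>))"
      by (simp only: iG_lm mult.assoc)
  qed
qed

subsection \<open>The operators\<close>

abbreviation ra (infixl "\<triangleleft>" 75) where "\<alpha> \<triangleleft> h \<equiv> right_act \<Lambda> \<alpha> h"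
abbreviation L where "L \<equiv> LR2 A f \<Lambda>"
text \<open>The operator belonging to \<open>X j\<close>, which is minus the operator of
  \<open>R\<^sub>j\<close>. Without the sign, \<open>X\<close> and \<open>f\<close> are treated
  alike: both act through composition with \<open>T\<close>.\<close>

definition Y where "Y j \<alpha> = \<alpha> \<triangleleft> (X j \<circ> T)"

lemma L_def: "L k j \<alpha> = \<alpha> \<triangleleft> (f k j \<circ> T)"
  by (simp add: LR2_def dual_antipode_inv_def)

lemma LR1_eq: "LR1 A X \<Lambda> j \<alpha> = - Y j \<alpha>"
proof -
  have "right_act \<Lambda> \<alpha> (- (X j \<circ> T)) = - right_act \<Lambda> \<alpha> (X j \<circ> T)"
    unfolding right_act_def tensor_lift_push[OF clinear_uminus]
    by (rule arg_cong[where f = "\<lambda>B. tensor_lift B (\<Lambda> \<alpha>)"], intro ext)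
      (simp add: complex_vector.scale_minus_left)
  then show ?thesis
    by (simp add: LR1_def dual_antipode_inv_def Y_def)
qed

lemma ra_bilinear: assumes "clinear h" shows "cbilinear (\<lambda>x \<beta>. h x *\<^sub>C \<beta>)"
  by (intro clin clinear_comp[OF assms])

lemma ra_clinear: "clinear h \<Longrightarrow> clinear (\<lambda>\<alpha>. \<alpha> \<triangleleft> h)"
  unfolding right_act_def by (intro clinear_tensor_lift_arg ra_bilinear \<Lambda>_clinear)

lemma ra_plus: "\<alpha> \<triangleleft> (\<lambda>x. g x + h x) = \<alpha> \<triangleleft> g + \<alpha> \<triangleleft> h"
  by (simp add: right_act_def scaleC_add_left tensor_lift_plus)

lemma ra_scale: "\<alpha> \<triangleleft> (\<lambda>x. c * h x) = c *\<^sub>C (\<alpha> \<triangleleft> h)"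
  unfolding right_act_def tensor_lift_scaleC[symmetric] scaleC_scaleC ..

lemma ra_sum: "\<alpha> \<triangleleft> (\<lambda>x. \<Sum>i\<in>K. h i x) = (\<Sum>i\<in>K. \<alpha> \<triangleleft> h i)"
  by (simp add: right_act_def complex_vector.scale_sum_left tensor_lift_sum)

lemma ra_eps [simp]: "\<alpha> \<triangleleft> \<epsilon> = \<alpha>"
  using coaction by (simp add: is_ext_lcoact_def left_comodule_def right_act_def)

text \<open>Coassociativity of the coaction makes \<open>\<triangleleft>\<close> a right action;
  \<open>?B\<close> evaluates both functionals at once.\<close>

lemma ra_ra:
  assumes g: "clinear g" and h: "clinear h"
  shows "\<alpha> \<triangleleft> g \<triangleleft> h = \<alpha> \<triangleleft> conv A g h"
proof -
  note [clin] = clinear_comp[OF g] clinear_comp[OF h]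
  let ?B = "\<lambda>x t. g x *\<^sub>C tensor_lift (\<lambda>y \<beta>. h y *\<^sub>C \<beta>) t"
  have B: "cbilinear ?B" for t :: "('a, 'w) tensor"
    by (intro clin)
  have B2: "cbilinear (\<lambda>x y. x \<otimes> (y \<otimes> \<beta>))" for \<beta> :: 'w
    by (intro clin)
  have "tensor_lift ?B (tensor_assoc (tensor_map (comul A) id (\<Lambda> \<alpha>))) = tensor_lift ?B (tensor_map id \<Lambda> (\<Lambda> \<alpha>))"
    using coaction by (simp add: is_ext_lcoact_def left_comodule_def)
  moreover have "tensor_lift ?B (tensor_map id \<Lambda> (\<Lambda> \<alpha>)) = \<alpha> \<triangleleft> g \<triangleleft> h"
    unfolding tensor_lift_map[OF B]
    by (simp add: right_act_def[of _ \<alpha> g] tensor_lift_push[OF ra_clinear[OF h]]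
        clinear_scale[OF ra_clinear[OF h]]) (simp add: right_act_def)
  moreover have "tensor_lift ?B (tensor_assoc (tensor_map (comul A) id (\<Lambda> \<alpha>))) = \<alpha> \<triangleleft> conv A g h"
  proof -
    have "tensor_lift ?B (tensor_assoc s) =
        tensor_lift (\<lambda>u \<beta>. tensor_lift (\<lambda>x y. g x *\<^sub>C h y *\<^sub>C \<beta>) u) s" for s :: "(('a, 'a) tensor, 'w) tensor"
      unfolding tensor_assoc_def
      by (simp add: tensor_lift_push[OF tensor_lift(2)[OF B]] tensor_lift(1)[OF B]
          tensor_lift(1)[OF ra_bilinear[OF h]])
    moreover have "tensor_lift (\<lambda>u \<beta>. tensor_lift (\<lambda>x y. g x *\<^sub>C h y *\<^sub>C \<beta>) u) (tensor_map (comul A) id (\<Lambda> \<alpha>)) =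
        tensor_lift (\<lambda>w \<beta>. swe (\<lambda>x y. g x *\<^sub>C h y *\<^sub>C id \<beta>) w) (\<Lambda> \<alpha>)"
      by (rule tensor_lift_map) (intro clin)
    ultimately show ?thesis
      by (simp add: right_act_def conv_def scaleC_scaleC tensor_lift_scaleC_left)
  qed
  ultimately show ?thesis by simp
qed

text \<open>The coaction is multiplicative, so a functional acts on a product of forms through its
  coproduct.\<close>

lemma ra_mult:
  assumes "clinear h" and "\<And>x y. h (x * y) = (\<Sum>k\<in>K. g k x * h' k y)"
  shows "(\<alpha> * \<beta>) \<triangleleft> h = (\<Sum>k\<in>K. (\<alpha> \<triangleleft> g k) * (\<beta> \<triangleleft> h' k))"
proof -
  have "(\<alpha> * \<beta>) \<triangleleft> h = tensor_lift (\<lambda>x \<alpha>. tensor_lift (\<lambda>y \<beta>. h (x * y) *\<^sub>C (\<alpha> * \<beta>)) (\<Lambda> \<beta>)) (\<Lambda> \<alpha>)"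
    unfolding right_act_def by (rule lift_\<Lambda>_mult[OF ra_bilinear[OF assms(1)]])
  also have "\<dots> = (\<Sum>k\<in>K. tensor_lift (\<lambda>x \<alpha>. tensor_lift (\<lambda>y \<beta>. (g k x *\<^sub>C \<alpha>) * (h' k y *\<^sub>C \<beta>)) (\<Lambda> \<beta>)) (\<Lambda> \<alpha>))"
    by (simp add: assms(2) complex_vector.scale_sum_left tensor_lift_sum mult_scaleC_left
        mult_scaleC_right scaleC_scaleC mult.commute)
  also have "\<dots> = (\<Sum>k\<in>K. (\<alpha> \<triangleleft> g k) * (\<beta> \<triangleleft> h' k))"
    by (simp add: tensor_lift_mult_left tensor_lift_mult_right right_act_def)
  finally show ?thesis .
qed

lemma ra_d: "clinear h \<Longrightarrow> d \<alpha> \<triangleleft> h = d (\<alpha> \<triangleleft> h)"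
  unfolding right_act_def
  by (simp add: lift_\<Lambda>_d[OF ra_bilinear] tensor_lift_push[OF d_clinear] clinear_scale[OF d_clinear])

lemma ra_iA: "clinear h \<Longrightarrow> iA x \<triangleleft> h = iA (swe (\<lambda>u v. h u *\<^sub>C v) x)"
  unfolding right_act_def
  by (simp add: lift_\<Lambda>_iA[OF ra_bilinear] tensor_lift_push[OF iA_clinear] clinear_scale[OF iA_clinear])

lemma ra_iG: "clinear h \<Longrightarrow> iG \<gamma> \<triangleleft> h = iG (tensor_lift (\<lambda>a \<beta>. h a *\<^sub>C \<beta>) (lc \<gamma>))"
  unfolding right_act_def
  by (simp add: lift_\<Lambda>_iG[OF ra_bilinear] tensor_lift_push[OF iG_clinear] clinear_scale[OF iG_clinear])

lemma ra_omega: "clinear h \<Longrightarrow> k \<in> I \<Longrightarrow> iG (\<omega> k) \<triangleleft> h = h 1 *\<^sub>C iG (\<omega> k)"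
  by (simp add: ra_iG omega_left_invariant tensor_lift(1)[OF ra_bilinear] clinear_scale[OF iG_clinear])

lemma ra_one: "clinear h \<Longrightarrow> 1 \<triangleleft> h = h 1 *\<^sub>C 1"
  using ra_iA[of h 1] swe_one[OF ra_bilinear[of h]] by (simp add: clinear_scale[OF iA_clinear])

lemma comp_T: "clinear h \<Longrightarrow> clinear (h \<circ> T)"
  unfolding comp_def by (rule clinear_comp[OF _ T_clinear])

lemma conv_T:
  assumes "clinear g" and "clinear h"
  shows "conv A (g \<circ> T) (h \<circ> T) = conv A h g \<circ> T"
proof
  fix x
  have "cbilinear (\<lambda>y z. h y * g z)"
    by (intro clin clinear_comp[OF assms(1)] clinear_comp[OF assms(2)])
  then show "conv A (g \<circ> T) (h \<circ> T) x = (conv A h g \<circ> T) x"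
    by (simp add: conv_def comul_T tensor_lift_lift mult.commute)
qed

text \<open>Composition with \<open>T\<close> reverses convolution products, and passing from a
  right action to composition of operators reverses them once more. Hence the operators attached to
  functionals multiply in the same order as the functionals.\<close>

lemma ra_T_ra_T: "clinear g \<Longrightarrow> clinear h \<Longrightarrow> \<alpha> \<triangleleft> (g \<circ> T) \<triangleleft> (h \<circ> T) = \<alpha> \<triangleleft> (conv A h g \<circ> T)"
  by (simp add: ra_ra comp_T conv_T)

lemma L_clinear: "k \<in> I \<Longrightarrow> j \<in> I \<Longrightarrow> clinear (L k j)"
  using ra_clinear[OF comp_T[OF f_clinear]] by (simp add: L_def[abs_def])

lemma Y_clinear: "j \<in> I \<Longrightarrow> clinear (Y j)"
  using ra_clinear[OF comp_T[OF X_clinear]] by (simp add: Y_def[abs_def])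

text \<open>The coproduct of \<open>f k j\<close> appears with its legs exchanged because
  \<open>T\<close> reverses products in \<open>A\<close>.\<close>

lemma L_mult: "k \<in> I \<Longrightarrow> j \<in> I \<Longrightarrow> L k j (\<alpha> * \<beta>) = (\<Sum>p=1..N. L p j \<alpha> * L k p \<beta>)"
  unfolding L_def by (rule ra_mult) (simp_all add: comp_T f_clinear T_mult f_mult mult.commute)

lemma Y_mult:
  assumes j: "j \<in> I"
  shows "Y j (\<alpha> * \<beta>) = Y j \<alpha> * \<beta> + (\<Sum>p=1..N. L p j \<alpha> * Y p \<beta>)"
proof -
  \<comment> \<open>The index 0 lies outside \<open>{1..N}\<close> and carries the additional
    coproduct term, in which the left factor sees \<open>X j \<circ> T\<close> and the right factor
    the counit.\<close>
  have "(\<alpha> * \<beta>) \<triangleleft> (X j \<circ> T) = (\<Sum>p\<in>insert 0 I. (\<alpha> \<triangleleft> (if p = 0 then X j \<circ> T else f p j \<circ> T)) *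
      (\<beta> \<triangleleft> (if p = 0 then \<epsilon> else X p \<circ> T)))"
  proof (rule ra_mult)
    show "clinear (X j \<circ> T)" by (intro comp_T X_clinear j)
    fix x y
    have "(\<Sum>p\<in>I. (if p = 0 then X j \<circ> T else f p j \<circ> T) x * (if p = 0 then \<epsilon> else X p \<circ> T) y) =
        (\<Sum>p\<in>I. f p j (T x) * X p (T y))"
      by (rule sum.cong) (auto simp: atLeastAtMost_iff)
    then show "(X j \<circ> T) (x * y) = (\<Sum>p\<in>insert 0 I. (if p = 0 then X j \<circ> T else f p j \<circ> T) x *
        (if p = 0 then \<epsilon> else X p \<circ> T) y)"
      using j by (simp add: T_mult X_mult atLeastAtMost_iff mult.commute)
  qed
  moreover have "(\<Sum>p\<in>I. (\<alpha> \<triangleleft> (if p = 0 then X j \<circ> T else f p j \<circ> T)) *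
      (\<beta> \<triangleleft> (if p = 0 then \<epsilon> else X p \<circ> T))) = (\<Sum>p\<in>I. L p j \<alpha> * Y p \<beta>)"
    by (rule sum.cong) (auto simp: atLeastAtMost_iff L_def Y_def)
  ultimately show ?thesis
    by (simp add: Y_def atLeastAtMost_iff)
qed

lemma L_omega: "k \<in> I \<Longrightarrow> j \<in> I \<Longrightarrow> l \<in> I \<Longrightarrow> L k j (iG (\<omega> l)) = (if k = j then iG (\<omega> l) else 0)"
  by (simp add: L_def ra_omega comp_T f_clinear f_one)

lemma Y_omega: "j \<in> I \<Longrightarrow> l \<in> I \<Longrightarrow> Y j (iG (\<omega> l)) = 0"
  by (simp add: Y_def ra_omega comp_T X_clinear)

lemma L_iA: "k \<in> I \<Longrightarrow> j \<in> I \<Longrightarrow> L k j (iA x) = iA (swe (\<lambda>u v. f k j (T u) *\<^sub>C v) x)"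
  by (simp add: L_def ra_iA comp_T f_clinear)

lemma Y_iA: "j \<in> I \<Longrightarrow> Y j (iA x) = iA (swe (\<lambda>u v. X j (T u) *\<^sub>C v) x)"
  by (simp add: Y_def ra_iA comp_T X_clinear)

lemma L_d: "k \<in> I \<Longrightarrow> j \<in> I \<Longrightarrow> L k j (d \<alpha>) = d (L k j \<alpha>)"
  by (simp add: L_def ra_d comp_T f_clinear)

lemma Y_d: "j \<in> I \<Longrightarrow> Y j (d \<alpha>) = d (Y j \<alpha>)"
  by (simp add: Y_def ra_d comp_T X_clinear)

lemma L_W: "\<alpha> \<in> W n \<Longrightarrow> \<forall>k\<in>I. \<forall>j\<in>I. L k j \<alpha> \<in> W n"
proof (induction rule: W_induct)
  case (iG n \<gamma> \<alpha>)
  have "L k j (iG \<gamma>) * \<beta> \<in> W (Suc n)" if "k \<in> I" "j \<in> I" "\<beta> \<in> W n" for k j \<beta>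
    using that by (simp add: L_def ra_iG comp_T f_clinear iG_mult_W)
  with iG show ?case by (auto simp: L_mult intro!: W_sum)
qed (simp_all add: L_iA iA_W clinear_add[OF L_clinear] clinear_scale[OF L_clinear] W_add W_scale)

lemma Y_W: "\<alpha> \<in> W n \<Longrightarrow> \<forall>j\<in>I. Y j \<alpha> \<in> W n"
proof (induction rule: W_induct)
  case (iG n \<gamma> \<alpha>)
  have "L k j (iG \<gamma>) * \<beta> \<in> W (Suc n)" if "k \<in> I" "j \<in> I" "\<beta> \<in> W n" for k j \<beta>
    using that by (simp add: L_def ra_iG comp_T f_clinear iG_mult_W)
  moreover have "Y j (iG \<gamma>) * \<beta> \<in> W (Suc n)" if "j \<in> I" "\<beta> \<in> W n" for j \<beta>
    using that by (simp add: Y_def ra_iG comp_T X_clinear iG_mult_W)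
  ultimately show ?case using iG by (auto simp: Y_mult intro!: W_sum W_add)
qed (simp_all add: Y_iA iA_W clinear_add[OF Y_clinear] clinear_scale[OF Y_clinear] W_add W_scale)

text \<open>The relation of the functionals evaluated at \<open>T x\<close>; by
  \<open>ra_T_ra_T\<close> a composition of operators \<open>L\<close> corresponds to the
  convolution product in the same order.\<close>

lemma braid_L:
  assumes "n \<in> I" "m \<in> I" "p \<in> I" "q \<in> I"
  shows "(\<Sum>i=1..N. \<Sum>j=1..N. \<sigma> i j n m *\<^sub>C L i p (L j q \<alpha>)) =
    (\<Sum>i=1..N. \<Sum>j=1..N. \<sigma> p q i j *\<^sub>C L n i (L m j \<alpha>))"
proof -
  have L: "L a b (L c e \<alpha>) = \<alpha> \<triangleleft> (conv A (f a b) (f c e) \<circ> T)"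
    if "a \<in> I" "b \<in> I" "c \<in> I" "e \<in> I" for a b c e
    using that by (simp add: L_def ra_T_ra_T f_clinear)
  have "(\<Sum>i=1..N. \<Sum>j=1..N. \<sigma> i j n m *\<^sub>C L i p (L j q \<alpha>)) =
      \<alpha> \<triangleleft> (\<lambda>x. \<Sum>i=1..N. \<Sum>j=1..N. \<sigma> i j n m * conv A (f i p) (f j q) (T x))"
    using assms by (simp add: L ra_sum ra_scale comp_def)
  also have "\<dots> = \<alpha> \<triangleleft> (\<lambda>x. \<Sum>i=1..N. \<Sum>j=1..N. \<sigma> p q i j * conv A (f n i) (f m j) (T x))"
    by (simp add: braid_f_f[OF assms] mult.commute)
  also have "\<dots> = (\<Sum>i=1..N. \<Sum>j=1..N. \<sigma> p q i j *\<^sub>C L n i (L m j \<alpha>))"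
    using assms by (simp add: L ra_sum ra_scale comp_def)
  finally show ?thesis .
qed

lemma mixed_L:
  assumes "i \<in> I" "b \<in> I" "k \<in> I"
  shows "(\<Sum>r=1..N. \<Sum>c=1..N. struct_coeff X J r c i *\<^sub>C L r k (L c b \<alpha>)) + L i k (Y b \<alpha>) =
    (\<Sum>c=1..N. \<Sum>l=1..N. \<sigma> k b c l *\<^sub>C Y c (L i l \<alpha>)) + (\<Sum>l=1..N. struct_coeff X J k b l *\<^sub>C L i l \<alpha>)"
proof -
  have L: "L a b (L c e \<alpha>) = \<alpha> \<triangleleft> (conv A (f a b) (f c e) \<circ> T)"
    if "a \<in> I" "b \<in> I" "c \<in> I" "e \<in> I" for a b c e
    using that by (simp add: L_def ra_T_ra_T f_clinear)
  have LY: "L a b (Y c \<alpha>) = \<alpha> \<triangleleft> (conv A (f a b) (X c) \<circ> T)" "Y c (L a b \<alpha>) = \<alpha> \<triangleleft> (conv A (X c) (f a b) \<circ> T)"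
    if "a \<in> I" "b \<in> I" "c \<in> I" for a b c
    using that by (simp_all add: L_def Y_def ra_T_ra_T f_clinear X_clinear)
  have "(\<Sum>r=1..N. \<Sum>c=1..N. struct_coeff X J r c i *\<^sub>C L r k (L c b \<alpha>)) + L i k (Y b \<alpha>) =
      \<alpha> \<triangleleft> (\<lambda>x. (\<Sum>r=1..N. \<Sum>c=1..N. struct_coeff X J r c i * conv A (f r k) (f c b) (T x)) +
        conv A (f i k) (X b) (T x))"
    using assms by (simp add: L LY ra_sum ra_scale ra_plus comp_def)
  also have "\<dots> = \<alpha> \<triangleleft> (\<lambda>x. (\<Sum>c=1..N. \<Sum>l=1..N. \<sigma> k b c l * conv A (X c) (f i l) (T x)) +
    (\<Sum>l=1..N. struct_coeff X J k b l * f i l (T x)))"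
    by (simp add: mixed_relation[OF assms])
  also have "\<dots> = (\<Sum>c=1..N. \<Sum>l=1..N. \<sigma> k b c l *\<^sub>C Y c (L i l \<alpha>)) +
      (\<Sum>l=1..N. struct_coeff X J k b l *\<^sub>C L i l \<alpha>)"
    using assms by (simp add: LY ra_sum ra_scale ra_plus) (simp add: comp_def L_def)
  finally show ?thesis .
qed

section \<open>The right inner derivatives and inductions for operator relations\<close>

lemma iR_clinear: "j \<in> I \<Longrightarrow> clinear (iR j)" and iR_iA [simp]: "j \<in> I \<Longrightarrow> iR j (iA x) = 0"
  and iR_W: "j \<in> I \<Longrightarrow> \<alpha> \<in> W (Suc n) \<Longrightarrow> iR j \<alpha> \<in> W n"
  and iR_right_form: "j \<in> I \<Longrightarrow> i \<in> I \<Longrightarrow> iR j (iG (right_form A G N \<omega> J i)) = (if i = j then 1 else 0)"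
  and iR_mult: "j \<in> I \<Longrightarrow> \<alpha> \<in> W n \<Longrightarrow>
    iR j (\<alpha> * \<beta>) = iR j \<alpha> * \<beta> + (-1) ^ n *\<^sub>C (\<Sum>k=1..N. L k j \<alpha> * iR k \<beta>)"
  using inner by (auto simp: is_right_inner_derivative_def iA_def iG_def)

lemma iR_one [simp]: "j \<in> I \<Longrightarrow> iR j 1 = 0"
  using iR_iA[of j 1] by simp

lemma iR_W0: "\<alpha> \<in> W 0 \<Longrightarrow> \<forall>j\<in>I. iR j \<alpha> = 0"
  by (induction rule: W_span_induct)
    (simp_all add: clinear_add[OF iR_clinear] clinear_scale[OF iR_clinear])

text \<open>The matrix with entries \<open>S (J i j)\<close> that defines the right-invariant forms
  is inverse to \<open>J\<close>: this is the antipode axiom at \<open>J i k\<close>.\<close>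

lemma omega_right_form:
  assumes k: "k \<in> I"
  shows "\<omega> k = (\<Sum>j=1..N. right_form A G N \<omega> J j \<star> J j k)"
proof -
  have "(\<Sum>j=1..N. right_form A G N \<omega> J j \<star> J j k) =
      (\<Sum>j=1..N. \<Sum>i=1..N. \<omega> i \<star> (S (J i j) * J j k))"
    by (simp add: right_form_def clinear_sum[OF rm_lin(1)[OF clinear_id]] rm_mult)
  also have "\<dots> = (\<Sum>i=1..N. \<omega> i \<star> (\<Sum>j=1..N. S (J i j) * J j k))"
    by (subst sum.swap) (simp add: clinear_sum[OF rm_lin(2)[OF clinear_id]])
  also have "\<dots> = (\<Sum>i=1..N. (if i = k then 1 else 0) *\<^sub>C \<omega> i)"
  proof (rule sum.cong)
    fix i assume i: "i \<in> I"
    have "swe (\<lambda>y z. S y * z) (J i k) = (\<Sum>j=1..N. S (J i j) * J j k)"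
      unfolding comul_J[OF k i] by (rule tensor_lift_decomp) (intro clin)
    then have "(\<Sum>j=1..N. S (J i j) * J j k) = (if i = k then 1 else 0) *\<^sub>C 1"
      using eps_J[OF k i] by (simp add: antipode_left)
    then show "\<omega> i \<star> (\<Sum>j=1..N. S (J i j) * J j k) = (if i = k then 1 else 0) *\<^sub>C \<omega> i"
      by (simp only: clinear_scale[OF rm_lin(2)[OF clinear_id]] rm_one)
  qed simp
  also have "\<dots> = \<omega> k"
    using k by (simp add: sum_delta_scaleC)
  finally show ?thesis ..
qed

text \<open>The value is prescribed on right-invariant forms. Expanding \<open>\<omega> k\<close> in
  these with coefficients \<open>J j k\<close> on the right leaves a single entry, as functions are
  annihilated.\<close>

lemma iR_omega:
  assumes m: "m \<in> I" and k: "k \<in> I"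
  shows "iR m (iG (\<omega> k)) = iA (J m k)"
proof -
  have "iG (\<omega> k) = (\<Sum>j=1..N. iG (right_form A G N \<omega> J j) * iA (J j k))"
    by (subst omega_right_form[OF k]) (simp add: clinear_sum[OF iG_clinear] iG_rm)
  then have "iR m (iG (\<omega> k)) = (\<Sum>j=1..N. (if j = m then 1 else 0) * iA (J j k))"
    using m by (simp add: clinear_sum[OF iR_clinear] iR_mult[OF _ iG_W] iR_right_form)
  also have "\<dots> = (\<Sum>j=1..N. if j = m then iA (J j k) else 0)"
    by (rule sum.cong) auto
  finally show ?thesis using m by simp
qed

lemma closed_sum:
  assumes "P 0" and "\<And>\<alpha> \<beta>. P \<alpha> \<Longrightarrow> P \<beta> \<Longrightarrow> P (\<alpha> + \<beta>)" and "\<And>k. k \<in> K \<Longrightarrow> P (g k)"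
  shows "P (\<Sum>k\<in>K. g k)"
  using assms(3) by (induction K rule: infinite_finite_induct) (auto intro: assms(1,2))

text \<open>The left factor of a product is homogeneous because the graded Leibniz rules carry the
  sign of its degree.\<close>

lemma prod_induct [case_names add scale mult iA iG]:
  assumes add: "\<And>\<alpha> \<beta>. P \<alpha> \<Longrightarrow> P \<beta> \<Longrightarrow> P (\<alpha> + \<beta>)" and scale: "\<And>c \<alpha>. P \<alpha> \<Longrightarrow> P (c *\<^sub>C \<alpha>)"
    and mult: "\<And>n \<alpha> \<beta>. \<alpha> \<in> W n \<Longrightarrow> P \<alpha> \<Longrightarrow> P \<beta> \<Longrightarrow> P (\<alpha> * \<beta>)"
    and iA: "\<And>x. P (iA x)" and iG: "\<And>\<gamma>. P (iG \<gamma>)"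
  shows "P \<alpha>"
proof (induction \<alpha> rule: gen_induct)
  case one
  show ?case using iA[of 1] by simp
qed (fact add scale mult[OF iA_W iA] mult[OF iG_W iG])+

text \<open>Left-invariant one-forms as base case suit relations in \<open>L\<close> and
  \<open>Y\<close>, since on them \<open>L k j\<close> acts by a Kronecker symbol and
  \<open>Y j\<close> by zero.\<close>

lemma prod_induct_omega [case_names add scale mult iA omega]:
  assumes add: "\<And>\<alpha> \<beta>. P \<alpha> \<Longrightarrow> P \<beta> \<Longrightarrow> P (\<alpha> + \<beta>)" and scale: "\<And>c \<alpha>. P \<alpha> \<Longrightarrow> P (c *\<^sub>C \<alpha>)"
    and mult: "\<And>n \<alpha> \<beta>. \<alpha> \<in> W n \<Longrightarrow> P \<alpha> \<Longrightarrow> P \<beta> \<Longrightarrow> P (\<alpha> * \<beta>)"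
    and iA: "\<And>x. P (iA x)" and omega: "\<And>k. k \<in> I \<Longrightarrow> P (iG (\<omega> k))"
  shows "P \<alpha>"
proof -
  have iG: "P (iG \<gamma>)" for \<gamma>
  proof -
    obtain a where "\<gamma> = (\<Sum>k=1..N. a k \<cdot> \<omega> k)" using forms_expand by blast
    then have *: "iG \<gamma> = (\<Sum>k=1..N. iA (a k) * iG (\<omega> k))"
      by (simp add: clinear_sum[OF iG_clinear] iG_lm)
    have "P 0" using iA[of 0] by (simp add: clinear_0[OF iA_clinear])
    then show ?thesis
      unfolding * by (rule closed_sum[where P = P]) (fact add, rule mult[OF iA_W iA omega])
  qed
  show ?thesis
    by (rule prod_induct[where P = P]) (fact assms(1-4) iG)+
qed

text \<open>Exact one-forms as base case suit an identity in which \<open>d\<close> occurs: because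
  \<open>d\<close> squares to zero, the case of \<open>dx\<close> can be derived from that of
  \<open>x\<close>.\<close>

lemma prod_induct_exact [case_names add scale mult iA d_base]:
  assumes add: "\<And>\<alpha> \<beta>. P \<alpha> \<Longrightarrow> P \<beta> \<Longrightarrow> P (\<alpha> + \<beta>)" and scale: "\<And>c \<alpha>. P \<alpha> \<Longrightarrow> P (c *\<^sub>C \<alpha>)"
    and mult: "\<And>n \<alpha> \<beta>. \<alpha> \<in> W n \<Longrightarrow> P \<alpha> \<Longrightarrow> P \<beta> \<Longrightarrow> P (\<alpha> * \<beta>)"
    and iA: "\<And>x. P (iA x)" and d_base: "\<And>x. P (d (iA x))"
  shows "P \<alpha>"
proof -
  have iG: "P (iG \<gamma>)" for \<gamma>
  proof -
    obtain n :: nat and x y where "\<gamma> = (\<Sum>k<n. x k \<cdot> D (y k))"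
      using bicovariant unfolding bicovariant_calculus_def by blast
    then have *: "iG \<gamma> = (\<Sum>k<n. iA (x k) * d (iA (y k)))"
      by (simp add: clinear_sum[OF iG_clinear] iG_lm d_iA)
    have "P 0" using iA[of 0] by (simp add: clinear_0[OF iA_clinear])
    then show ?thesis
      unfolding * by (rule closed_sum[where P = P]) (fact add, rule mult[OF iA_W iA assms(5)])
  qed
  show ?thesis
    by (rule prod_induct[where P = P]) (fact assms(1-4) iG)+
qed

subsection \<open>The relations between the operators\<close>

text \<open>\<open>iR i \<alpha>\<close> has degree \<open>n - 1\<close>, so its sign is opposite to
  that of \<open>\<alpha>\<close>. Degree 0 is separate: there \<open>iR i \<alpha>\<close>
  vanishes.\<close>

lemma d_iR_mult:
  assumes \<alpha>: "\<alpha> \<in> W n" and i: "i \<in> I"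
  shows "d (iR i \<alpha> * \<beta>) = d (iR i \<alpha>) * \<beta> - (-1) ^ n *\<^sub>C (iR i \<alpha> * d \<beta>)"
proof (cases n)
  case 0
  then show ?thesis using iR_W0 \<alpha> i by (simp add: clinear_0[OF d_clinear])
next
  case (Suc m)
  then show ?thesis using d_mult[OF iR_W[OF i, of \<alpha> m], of \<beta>] \<alpha>
    by (simp add: complex_vector.scale_minus_left)
qed

text \<open>The twisted Leibniz rule of \<open>X i\<close> is applied to \<open>x2 T(x1)\<close>,
  which is a scalar and hence annihilated by \<open>X i\<close>.\<close>

lemma convolution_f_X:
  assumes i: "i \<in> I"
  shows "(\<Sum>j=1..N. swe (\<lambda>y z. f j i (T y) * X j z) x) = - X i (T x)"
proof -
  have "X i (swe (\<lambda>y z. z * T y) x) = 0"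
    using i by (simp add: T_right clinear_scale[OF X_clinear])
  moreover have "X i (swe (\<lambda>y z. z * T y) x) =
      swe (\<lambda>y z. \<epsilon> z *\<^sub>C X i (T y)) x + (\<Sum>j=1..N. swe (\<lambda>y z. f j i (T y) * X j z) x)"
    using i by (simp add: tensor_lift_push[OF X_clinear] X_mult tensor_lift_plus tensor_lift_sum mult.commute)
  moreover have "swe (\<lambda>y z. \<epsilon> z *\<^sub>C X i (T y)) x = X i (T x)"
    using i by (intro counit_right clin)
  ultimately show ?thesis
    by (simp add: eq_neg_iff_add_eq_0 add.commute)
qed

text \<open>Expanding \<open>dx\<close> in left-invariant forms turns \<open>iR i\<close> into
  entries of \<open>J\<close>, with coefficients moved by \<open>L\<close>. Right covariance in the
  form \<open>X_J\<close> converts the sum against \<open>J\<close> into a translation by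
  \<open>X m\<close> on the other leg, and the resulting convolution of
  \<open>f m i \<circ> T\<close> with \<open>X m\<close> is evaluated by
  \<open>convolution_f_X\<close>.\<close>

lemma Cartan_iA:
  assumes i: "i \<in> I"
  shows "iR i (d (iA x)) = - Y i (iA x)"
proof -
  \<comment> \<open>\<open>iA (rt m x)\<close> is \<open>L m i (iA x)\<close>. It acts on the first
    leg of the coproduct and \<open>left_act\<close> on the second, so the two commute by
    coassociativity.\<close>
  define rt where "rt m x = swe (\<lambda>u v. f m i (T u) *\<^sub>C v) x" for m x
  have rt_la: "rt m (X k \<triangleright> x) = X k \<triangleright> rt m x" if "m \<in> I" "k \<in> I" for m k x
  proof -
    note [clin] = f_lin[OF that(1) i]
    have lin: "clinear (rt m)" unfolding rt_def[abs_def] by (intro clin)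
    have "rt m (X k \<triangleright> x) = swe (\<lambda>y z. X k z *\<^sub>C rt m y) x"
      unfolding left_act_def by (simp add: tensor_lift_push[OF lin] clinear_scale[OF lin])
    also have "\<dots> = swe (\<lambda>y z. swe (\<lambda>u v. f m i (T u) *\<^sub>C X k z *\<^sub>C v) y) x"
      unfolding rt_def tensor_lift_scaleC[symmetric] scaleC_scaleC by (simp only: mult.commute)
    also have "\<dots> = swe (\<lambda>u y. swe (\<lambda>v z. f m i (T u) *\<^sub>C X k z *\<^sub>C v) y) x"
      by (rule coassoc) (intro clin that)+
    also have "\<dots> = swe (\<lambda>u y. f m i (T u) *\<^sub>C (X k \<triangleright> y)) x"
      unfolding left_act_def tensor_lift_scaleC ..
    also have "\<dots> = X k \<triangleright> rt m x"
      unfolding rt_def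
      by (simp add: tensor_lift_push[OF la_clinear[OF X_clinear]] clinear_scale[OF la_clinear[OF X_clinear]] that)
    finally show ?thesis .
  qed
  have "iR i (d (iA x)) = (\<Sum>k=1..N. iR i (iA (X k \<triangleright> x) * iG (\<omega> k)))"
    unfolding d_iA by (subst D_expand)
      (simp add: clinear_sum[OF iG_clinear] clinear_sum[OF iR_clinear[OF i]] iG_lm)
  also have "\<dots> = (\<Sum>k=1..N. \<Sum>m=1..N. iA (rt m (X k \<triangleright> x)) * iA (J m k))"
    using i by (simp add: iR_mult[OF _ iA_W] L_iA iR_omega rt_def)
  also have "\<dots> = iA (\<Sum>m=1..N. \<Sum>k=1..N. (X k \<triangleright> rt m x) * J m k)"
    by (subst sum.swap) (simp add: clinear_sum[OF iA_clinear] rt_la iA_mult)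
  also have "(\<Sum>m=1..N. \<Sum>k=1..N. (X k \<triangleright> rt m x) * J m k) = (\<Sum>m=1..N. swe (\<lambda>u v. X m u *\<^sub>C v) (rt m x))"
    by (simp add: X_J)
  also have "\<dots> = (\<Sum>m=1..N. swe (\<lambda>w v. swe (\<lambda>u y. f m i (T u) * X m y) w *\<^sub>C v) x)"
  proof (rule sum.cong)
    fix m assume m: "m \<in> I"
    note [clin] = f_lin[OF m i] X_lin[OF m]
    have lin: "clinear (\<lambda>x. swe (\<lambda>u v. X m u *\<^sub>C v) x)" by (intro clin)
    have "swe (\<lambda>u v. X m u *\<^sub>C v) (rt m x) = swe (\<lambda>u y. swe (\<lambda>y v. f m i (T u) *\<^sub>C X m y *\<^sub>C v) y) x"
      unfolding rt_def tensor_lift_push[OF lin] clinear_scale[OF lin] tensor_lift_scaleC ..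
    also have "\<dots> = swe (\<lambda>w v. swe (\<lambda>u y. f m i (T u) *\<^sub>C X m y *\<^sub>C v) w) x"
      by (rule coassoc[symmetric]) (intro clin)+
    also have "\<dots> = swe (\<lambda>w v. swe (\<lambda>u y. f m i (T u) * X m y) w *\<^sub>C v) x"
      unfolding scaleC_scaleC tensor_lift_scaleC_left ..
    finally show "swe (\<lambda>u v. X m u *\<^sub>C v) (rt m x) = \<dots>" .
  qed simp
  also have "\<dots> = swe (\<lambda>w v. (\<Sum>m=1..N. swe (\<lambda>u y. f m i (T u) * X m y) w) *\<^sub>C v) x"
    unfolding complex_vector.scale_sum_left tensor_lift_sum ..
  also have "\<dots> = - swe (\<lambda>u v. X i (T u) *\<^sub>C v) x"
    unfolding convolution_f_X[OF i] complex_vector.scale_minus_left tensor_lift_push[OF clinear_uminus] ..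
  finally show ?thesis
    by (simp add: Y_iA i clinear_neg[OF iA_clinear])
qed

text \<open>The anticommutator of \<open>d\<close> and \<open>iR i\<close> and the operator
  \<open>- Y i\<close> obey the same Leibniz rule twisted by \<open>L\<close>, so agreement on
  functions and exact one-forms suffices.\<close>

lemma Cartan_identity: "\<forall>i\<in>I. d (iR i \<alpha>) + iR i (d \<alpha>) = - Y i \<alpha>"
proof (induction \<alpha> rule: prod_induct_exact)
  case (add \<alpha> \<beta>)
  show ?case
  proof
    fix i assume i: "i \<in> I"
    have "d (iR i (\<alpha> + \<beta>)) + iR i (d (\<alpha> + \<beta>)) =
        (d (iR i \<alpha>) + iR i (d \<alpha>)) + (d (iR i \<beta>) + iR i (d \<beta>))"
      by (simp add: clinear_add[OF d_clinear] clinear_add[OF iR_clinear[OF i]])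
    then show "d (iR i (\<alpha> + \<beta>)) + iR i (d (\<alpha> + \<beta>)) = - Y i (\<alpha> + \<beta>)"
      using i add by (simp add: clinear_add[OF Y_clinear])
  qed
next
  case (scale c \<alpha>)
  then show ?case
    by (simp add: clinear_scale[OF d_clinear] clinear_scale[OF iR_clinear] clinear_scale[OF Y_clinear]
       scaleC_add_right[symmetric])
next
  case (iA x)
  show ?case by (simp add: Cartan_iA clinear_0[OF d_clinear])
next
  case (d_base x)
  show ?case by (simp add: Cartan_iA clinear_neg[OF d_clinear] Y_d clinear_0[OF iR_clinear])
next
  case (mult n \<alpha> \<beta>)
  let ?s = "(-1) ^ n :: complex"
  show ?case
  proof
    fix i assume i: "i \<in> I"
    have 1: "iR i (d (\<alpha> * \<beta>)) = iR i (d \<alpha>) * \<beta> - ?s *\<^sub>C (\<Sum>k=1..N. d (L k i \<alpha>) * iR k \<beta>) +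
        ?s *\<^sub>C (iR i \<alpha> * d \<beta>) + (\<Sum>k=1..N. L k i \<alpha> * iR k (d \<beta>))"
      using i mult.hyps
      by (simp add: d_mult clinear_add[OF iR_clinear] clinear_scale[OF iR_clinear] iR_mult[OF _ d_W] iR_mult
          L_d scaleC_add_right complex_vector.scale_minus_left)
    have 2: "d (iR i (\<alpha> * \<beta>)) = d (iR i \<alpha>) * \<beta> - ?s *\<^sub>C (iR i \<alpha> * d \<beta>) +
        ?s *\<^sub>C (\<Sum>k=1..N. d (L k i \<alpha>) * iR k \<beta>) + (\<Sum>k=1..N. L k i \<alpha> * d (iR k \<beta>))"
      using i mult.hyps L_W[OF mult.hyps]
      by (simp add: iR_mult clinear_add[OF d_clinear] clinear_scale[OF d_clinear] clinear_sum[OF d_clinear]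
          d_iR_mult d_mult[where n = n] sum.distrib scaleC_add_right complex_vector.scale_sum_right)
    \<comment> \<open>The terms containing \<open>iR i \<alpha> * d \<beta>\<close> and
      \<open>d (L k i \<alpha>) * iR k \<beta>\<close> occur with opposite signs in 1 and 2; for the
      latter this uses that \<open>d\<close> commutes with \<open>L\<close>.\<close>
    have "d (iR i (\<alpha> * \<beta>)) + iR i (d (\<alpha> * \<beta>)) =
        (d (iR i \<alpha>) + iR i (d \<alpha>)) * \<beta> + (\<Sum>k=1..N. L k i \<alpha> * (d (iR k \<beta>) + iR k (d \<beta>)))"
      unfolding 1 2 by (simp add: distrib_left distrib_right sum.distrib)
    also have "\<dots> = - Y i (\<alpha> * \<beta>)"
      using i mult.IH by (simp add: Y_mult sum_negf)
    finally show "d (iR i (\<alpha> * \<beta>)) + iR i (d (\<alpha> * \<beta>)) = - Y i (\<alpha> * \<beta>)" .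
  qed
qed

lemma T_J:
  assumes i: "i \<in> I" and q: "q \<in> I"
  shows "(\<Sum>m=1..N. T (J m q) * J i m) = (if i = q then 1 else 0) *\<^sub>C 1"
proof -
  have "swe (\<lambda>y z. T z * y) (J i q) = (\<Sum>m=1..N. T (J m q) * J i m)"
    unfolding comul_J[OF q i] by (rule tensor_lift_decomp) (intro clin)
  then show ?thesis
    using eps_J[OF q i] by (simp add: T_left)
qed

lemma iA_J_ra:
  assumes "m \<in> I" "p \<in> I" and h: "clinear h"
  shows "iA (J m p) \<triangleleft> h = (\<Sum>q=1..N. h (J m q) *\<^sub>C iA (J q p))"
proof -
  have "swe (\<lambda>u v. h u *\<^sub>C v) (J m p) = (\<Sum>q=1..N. h (J m q) *\<^sub>C J q p)"
    unfolding comul_J[OF assms(2,1)] by (rule tensor_lift_decomp[OF ra_bilinear[OF h]])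
  then show ?thesis
    by (simp add: ra_iA h clinear_sum[OF iA_clinear] clinear_scale[OF iA_clinear])
qed

text \<open>In the product case of the next two relations the hypothesis for the right factor
  creates coefficients \<open>\<sigma> q p a b\<close>. The braid relation for \<open>L\<close> on
  the left factor exchanges them for the coefficients \<open>\<sigma> i j q p\<close> that the claim
  demands.\<close>

lemma braid_sum:
  assumes "i \<in> I" "j \<in> I"
  shows "(\<Sum>p=1..N. \<Sum>q=1..N. L q i (L p j \<alpha>) * (\<Sum>a=1..N. \<Sum>b=1..N. \<sigma> q p a b *\<^sub>C Z a b)) =
    (\<Sum>q=1..N. \<Sum>p=1..N. \<Sum>b=1..N. \<Sum>a=1..N. \<sigma> i j q p *\<^sub>C (L a q (L b p \<alpha>) * Z a b))"
proof -
  have "(\<Sum>p=1..N. \<Sum>q=1..N. L q i (L p j \<alpha>) * (\<Sum>a=1..N. \<Sum>b=1..N. \<sigma> q p a b *\<^sub>C Z a b)) =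
      (\<Sum>a=1..N. \<Sum>b=1..N. (\<Sum>q=1..N. \<Sum>p=1..N. \<sigma> q p a b *\<^sub>C L q i (L p j \<alpha>)) * Z a b)"
    by (simp only: sum_distrib_right sum_distrib_left mult_scaleC_right mult_scaleC_left,
        subst sum.swap, rule sum_swap4)
  also have "\<dots> = (\<Sum>a=1..N. \<Sum>b=1..N. (\<Sum>q=1..N. \<Sum>p=1..N. \<sigma> i j q p *\<^sub>C L a q (L b p \<alpha>)) * Z a b)"
    using assms by (simp add: braid_L)
  also have "\<dots> = (\<Sum>q=1..N. \<Sum>p=1..N. \<Sum>b=1..N. \<Sum>a=1..N. \<sigma> i j q p *\<^sub>C (L a q (L b p \<alpha>) * Z a b))"
    by (simp only: sum_distrib_right mult_scaleC_left, subst sum.swap, rule sum_swap4)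
  finally show ?thesis .
qed

text \<open>Functions are annihilated by both sides, and on left-invariant forms the claim amounts
  to the inverse matrix identity \<open>T_J\<close>. All indices are treated together because the
  Leibniz rules of \<open>L\<close> and \<open>iR\<close> change them.\<close>

lemma iR_L: "\<forall>i\<in>I. \<forall>k\<in>I. \<forall>j\<in>I.
    iR i (L k j \<alpha>) = (\<Sum>n=1..N. \<Sum>m=1..N. \<sigma> i j n m *\<^sub>C L k n (iR m \<alpha>))"
proof (induction \<alpha> rule: prod_induct_omega)
  case (add \<alpha> \<beta>)
  then show ?case
    by (simp add: clinear_add[OF L_clinear] clinear_add[OF iR_clinear] scaleC_add_right sum.distrib)
next
  case (scale c \<alpha>)
  then show ?case
    by (simp add: clinear_scale[OF L_clinear] clinear_scale[OF iR_clinear]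
      complex_vector.scale_sum_right scaleC_scaleC mult.commute)
next
  case (iA x)
  show ?case by (simp add: L_iA clinear_0[OF L_clinear])
next
  case (omega p)
  show ?case
  proof (intro ballI)
    fix i k j assume ikj: "i \<in> I" "k \<in> I" "j \<in> I"
    have "(\<Sum>n=1..N. \<Sum>m=1..N. \<sigma> i j n m *\<^sub>C L k n (iR m (iG (\<omega> p)))) =
        (\<Sum>n=1..N. \<Sum>m=1..N. \<Sum>q=1..N. (f k n (T (J m q)) * f n j (J i m)) *\<^sub>C iA (J q p))"
      using ikj omega
      by (simp add: iR_omega L_def iA_J_ra comp_T f_clinear braid_coeff_def
        complex_vector.scale_sum_right scaleC_scaleC mult.commute)
    also have "\<dots> = (\<Sum>m=1..N. \<Sum>q=1..N. \<Sum>n=1..N. (f k n (T (J m q)) * f n j (J i m)) *\<^sub>C iA (J q p))"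
      by (rule sum_swap3)
    \<comment> \<open>\<open>f_mult\<close> is read backwards: the sum over \<open>n\<close> merges
      two values of \<open>f\<close> into the value of \<open>f k j\<close> at a product of an entry
      of \<open>T J\<close> and an entry of \<open>J\<close>, to which \<open>T_J\<close>
      applies.\<close>
    also have "\<dots> = (\<Sum>m=1..N. \<Sum>q=1..N. f k j (T (J m q) * J i m) *\<^sub>C iA (J q p))"
      using ikj by (simp add: f_mult complex_vector.scale_sum_left)
    also have "\<dots> = (\<Sum>q=1..N. f k j (\<Sum>m=1..N. T (J m q) * J i m) *\<^sub>C iA (J q p))"
      using ikj by (subst sum.swap) (simp add: clinear_sum[OF f_clinear] complex_vector.scale_sum_left)
    also have "\<dots> = (\<Sum>q=1..N. (if i = q then 1 else 0) *\<^sub>C (if k = j then 1 else 0) *\<^sub>C iA (J q p))"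
      using ikj by (intro sum.cong) (simp_all add: T_J clinear_scale[OF f_clinear] f_one)
    also have "\<dots> = (if k = j then 1 else 0) *\<^sub>C iA (J i p)"
      using ikj by (simp only: sum_delta_scaleC finite_atLeastAtMost)
    also have "\<dots> = iR i (L k j (iG (\<omega> p)))"
      using ikj omega by (simp add: L_omega iR_omega clinear_0[OF iR_clinear])
    finally show "iR i (L k j (iG (\<omega> p))) =
      (\<Sum>n=1..N. \<Sum>m=1..N. \<sigma> i j n m *\<^sub>C L k n (iR m (iG (\<omega> p))))" ..
  qed
next
  case (mult n \<alpha> \<beta>)
  let ?s = "(-1) ^ n :: complex"
  show ?case
  proof (intro ballI)
    fix i k j assume ikj: "i \<in> I" "k \<in> I" "j \<in> I"
    have "iR i (L k j (\<alpha> * \<beta>)) =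
        (\<Sum>p=1..N. (\<Sum>a=1..N. \<Sum>b=1..N. \<sigma> i j a b *\<^sub>C L p a (iR b \<alpha>)) * L k p \<beta>) +
        ?s *\<^sub>C (\<Sum>p=1..N. \<Sum>q=1..N. L q i (L p j \<alpha>) *
          (\<Sum>a=1..N. \<Sum>b=1..N. \<sigma> q p a b *\<^sub>C L k a (iR b \<beta>)))"
      using ikj L_W[OF mult.hyps] mult.IH
      by (simp add: L_mult clinear_sum[OF iR_clinear] iR_mult[where n = n] sum.distrib complex_vector.scale_sum_right)
    also have "(\<Sum>p=1..N. (\<Sum>a=1..N. \<Sum>b=1..N. \<sigma> i j a b *\<^sub>C L p a (iR b \<alpha>)) * L k p \<beta>) =
        (\<Sum>a=1..N. \<Sum>b=1..N. \<Sum>p=1..N. \<sigma> i j a b *\<^sub>C (L p a (iR b \<alpha>) * L k p \<beta>))"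
      by (simp add: sum_distrib_right mult_scaleC_left) (rule sum_swap3)
    also have "(\<Sum>p=1..N. \<Sum>q=1..N. L q i (L p j \<alpha>) *
          (\<Sum>a=1..N. \<Sum>b=1..N. \<sigma> q p a b *\<^sub>C L k a (iR b \<beta>))) =
        (\<Sum>q=1..N. \<Sum>p=1..N. \<Sum>b=1..N. \<Sum>a=1..N. \<sigma> i j q p *\<^sub>C (L a q (L b p \<alpha>) * L k a (iR b \<beta>)))"
      by (rule braid_sum[OF ikj(1,3)])
    also have "(\<Sum>a=1..N. \<Sum>b=1..N. \<Sum>p=1..N. \<sigma> i j a b *\<^sub>C (L p a (iR b \<alpha>) * L k p \<beta>)) +
        ?s *\<^sub>C (\<Sum>q=1..N. \<Sum>p=1..N. \<Sum>b=1..N. \<Sum>a=1..N. \<sigma> i j q p *\<^sub>C (L a q (L b p \<alpha>) * L k a (iR b \<beta>))) =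
        (\<Sum>n=1..N. \<Sum>m=1..N. \<sigma> i j n m *\<^sub>C L k n (iR m (\<alpha> * \<beta>)))"
      using ikj mult.hyps
      by (simp add: iR_mult L_mult clinear_add[OF L_clinear] clinear_scale[OF L_clinear] clinear_sum[OF L_clinear]
          sum.distrib scaleC_add_right complex_vector.scale_sum_right scaleC_scaleC mult.commute)
    finally show "iR i (L k j (\<alpha> * \<beta>)) = (\<Sum>n=1..N. \<Sum>m=1..N. \<sigma> i j n m *\<^sub>C L k n (iR m (\<alpha> * \<beta>)))" .
  qed
qed

text \<open>The product case needs all the earlier exchange rules: \<open>iR_L\<close> for the left
  factor, \<open>braid_sum\<close> for the terms with two operators on each side, and
  \<open>mixed_L\<close> for what remains in front of \<open>iR a \<beta>\<close>.\<close>

lemma iR_Y: "\<forall>i\<in>I. \<forall>j\<in>I. iR i (Y j \<alpha>) =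
    (\<Sum>k=1..N. \<Sum>l=1..N. \<sigma> i j k l *\<^sub>C Y k (iR l \<alpha>)) + (\<Sum>k=1..N. struct_coeff X J i j k *\<^sub>C iR k \<alpha>)"
proof (induction \<alpha> rule: prod_induct_omega)
  case (add \<alpha> \<beta>)
  then show ?case
    by (simp add: clinear_add[OF Y_clinear] clinear_add[OF iR_clinear] scaleC_add_right sum.distrib)
next
  case (scale c \<alpha>)
  then show ?case
    by (simp add: clinear_scale[OF Y_clinear] clinear_scale[OF iR_clinear] scaleC_add_right
      complex_vector.scale_sum_right scaleC_scaleC mult.commute)
next
  case (iA x)
  show ?case by (simp add: Y_iA clinear_0[OF Y_clinear])
next
  case (omega p)
  show ?case
  proof (intro ballI)
    fix i j assume ij: "i \<in> I" "j \<in> I"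
    have "(\<Sum>k=1..N. \<Sum>l=1..N. \<sigma> i j k l *\<^sub>C Y k (iR l (iG (\<omega> p)))) =
        (\<Sum>k=1..N. \<Sum>l=1..N. \<Sum>q=1..N. (X k (T (J l q)) * f k j (J i l)) *\<^sub>C iA (J q p))"
      using ij omega
      by (simp add: iR_omega Y_def iA_J_ra comp_T X_clinear braid_coeff_def
        complex_vector.scale_sum_right scaleC_scaleC mult.commute)
    also have "\<dots> = (\<Sum>l=1..N. \<Sum>q=1..N. \<Sum>k=1..N. (X k (T (J l q)) * f k j (J i l)) *\<^sub>C iA (J q p))"
      by (rule sum_swap3)
    \<comment> \<open>\<open>X_mult\<close> is read backwards: the sum over \<open>k\<close> is the
      value of \<open>X j\<close> at the product, less its counit term. The counit of
      \<open>T (J l q)\<close> is a Kronecker symbol, and the product sums to a scalar, so in the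
      end only this correction survives; it is the structure coefficient.\<close>
    also have "\<dots> = (\<Sum>l=1..N. \<Sum>q=1..N. (X j (T (J l q) * J i l) - (if l = q then 1 else 0) * X j (J i l)) *\<^sub>C iA (J q p))"
      using ij by (simp add: X_mult eps_J complex_vector.scale_sum_left)
    also have "\<dots> = (\<Sum>q=1..N. (\<Sum>l=1..N. X j (T (J l q) * J i l) - (if l = q then 1 else 0) * X j (J i l)) *\<^sub>C iA (J q p))"
      by (subst sum.swap) (simp only: complex_vector.scale_sum_left)
    also have "\<dots> = (\<Sum>q=1..N. (X j (\<Sum>l=1..N. T (J l q) * J i l) - X j (J i q)) *\<^sub>C iA (J q p))"
      using ij by (intro sum.cong) (simp_all only: HOL.refl sum_subtractf clinear_sum[OF X_clinear] sum_delta_mult finite_atLeastAtMost)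
    also have "\<dots> = (\<Sum>q=1..N. (- X j (J i q)) *\<^sub>C iA (J q p))"
      using ij by (intro sum.cong) (simp_all add: T_J clinear_scale[OF X_clinear])
    also have "\<dots> = - (\<Sum>k=1..N. struct_coeff X J i j k *\<^sub>C iR k (iG (\<omega> p)))"
      using omega by (simp add: struct_coeff_def iR_omega sum_negf complex_vector.scale_minus_left)
    finally show "iR i (Y j (iG (\<omega> p))) = (\<Sum>k=1..N. \<Sum>l=1..N. \<sigma> i j k l *\<^sub>C Y k (iR l (iG (\<omega> p)))) +
        (\<Sum>k=1..N. struct_coeff X J i j k *\<^sub>C iR k (iG (\<omega> p)))"
      using ij omega by (simp add: Y_omega clinear_0[OF iR_clinear])
  qed
next
  case (mult n \<alpha> \<beta>)
  let ?s = "(-1) ^ n :: complex"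
  let ?C = "struct_coeff X J"
  show ?case
  proof (intro ballI)
    fix i j assume ij: "i \<in> I" "j \<in> I"
    \<comment> \<open>In \<open>A1\<close> and \<open>A2\<close> all operators but \<open>L\<close>
      act on \<open>\<alpha>\<close>; in \<open>B\<close> the inner derivative acts on
      \<open>\<alpha>\<close> and \<open>Y\<close> on \<open>\<beta>\<close>; in \<open>U\<close>
      both act on \<open>\<beta>\<close>. These terms match on the two sides.\<close>
    define A1 where "A1 = (\<Sum>k=1..N. \<Sum>l=1..N. \<sigma> i j k l *\<^sub>C Y k (iR l \<alpha>)) * \<beta>"
    define A2 where "A2 = (\<Sum>k=1..N. ?C i j k *\<^sub>C iR k \<alpha>) * \<beta>"
    define B where "B = (\<Sum>a=1..N. \<Sum>b=1..N. \<Sum>p=1..N. \<sigma> i j a b *\<^sub>C (L p a (iR b \<alpha>) * Y p \<beta>))"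
    define U where "U = (\<Sum>q=1..N. \<Sum>p=1..N. \<Sum>b=1..N. \<Sum>a=1..N. \<sigma> i j q p *\<^sub>C (L a q (L b p \<alpha>) * Y a (iR b \<beta>)))"
    have "iR i (Y j (\<alpha> * \<beta>)) = iR i (Y j \<alpha>) * \<beta> + ?s *\<^sub>C (\<Sum>q=1..N. L q i (Y j \<alpha>) * iR q \<beta>) +
        ((\<Sum>p=1..N. iR i (L p j \<alpha>) * Y p \<beta>) +
        ?s *\<^sub>C (\<Sum>p=1..N. \<Sum>q=1..N. L q i (L p j \<alpha>) * iR q (Y p \<beta>)))"
      using ij L_W[OF mult.hyps] Y_W[OF mult.hyps]
      by (simp add: Y_mult clinear_add[OF iR_clinear] clinear_sum[OF iR_clinear] iR_mult[where n = n]
          sum.distrib complex_vector.scale_sum_right)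
    also have "iR i (Y j \<alpha>) * \<beta> = A1 + A2"
      using ij mult.IH(1) by (simp add: A1_def A2_def distrib_right)
    also have "(\<Sum>p=1..N. iR i (L p j \<alpha>) * Y p \<beta>) = B"
    proof -
      have "(\<Sum>p=1..N. iR i (L p j \<alpha>) * Y p \<beta>) =
          (\<Sum>p=1..N. (\<Sum>a=1..N. \<Sum>b=1..N. \<sigma> i j a b *\<^sub>C L p a (iR b \<alpha>)) * Y p \<beta>)"
        using ij iR_L by (intro sum.cong) auto
      also have "\<dots> = B"
        unfolding B_def by (simp only: sum_distrib_right mult_scaleC_left, rule sum_swap3)
      finally show ?thesis .
    qed
    also have "(\<Sum>p=1..N. \<Sum>q=1..N. L q i (L p j \<alpha>) * iR q (Y p \<beta>)) =
        U + (\<Sum>a=1..N. (\<Sum>r=1..N. \<Sum>c=1..N. ?C r c a *\<^sub>C L r i (L c j \<alpha>)) * iR a \<beta>)"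
    proof -
      have "(\<Sum>p=1..N. \<Sum>q=1..N. L q i (L p j \<alpha>) * iR q (Y p \<beta>)) =
          (\<Sum>p=1..N. \<Sum>q=1..N. L q i (L p j \<alpha>) * (\<Sum>a=1..N. \<Sum>b=1..N. \<sigma> q p a b *\<^sub>C Y a (iR b \<beta>))) +
          (\<Sum>p=1..N. \<Sum>q=1..N. L q i (L p j \<alpha>) * (\<Sum>a=1..N. ?C q p a *\<^sub>C iR a \<beta>))"
        using mult.IH(2) by (simp add: distrib_left sum.distrib)
      also have "(\<Sum>p=1..N. \<Sum>q=1..N. L q i (L p j \<alpha>) * (\<Sum>a=1..N. \<Sum>b=1..N. \<sigma> q p a b *\<^sub>C Y a (iR b \<beta>))) = U"
        unfolding U_def by (rule braid_sum[OF ij])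
      also have "(\<Sum>p=1..N. \<Sum>q=1..N. L q i (L p j \<alpha>) * (\<Sum>a=1..N. ?C q p a *\<^sub>C iR a \<beta>)) =
          (\<Sum>a=1..N. (\<Sum>r=1..N. \<Sum>c=1..N. ?C r c a *\<^sub>C L r i (L c j \<alpha>)) * iR a \<beta>)"
        by (simp only: sum_distrib_right sum_distrib_left mult_scaleC_right mult_scaleC_left,
            subst sum.swap, rule sum_swap3[symmetric])
      finally show ?thesis .
    qed
    finally have lhs: "iR i (Y j (\<alpha> * \<beta>)) = A1 + A2 + B + ?s *\<^sub>C U + ?s *\<^sub>C
        (\<Sum>a=1..N. ((\<Sum>r=1..N. \<Sum>c=1..N. ?C r c a *\<^sub>C L r i (L c j \<alpha>)) + L a i (Y j \<alpha>)) * iR a \<beta>)"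
      by (simp add: distrib_right sum.distrib scaleC_add_right add.commute add.left_commute)
    have 1: "(\<Sum>k=1..N. \<Sum>l=1..N. \<sigma> i j k l *\<^sub>C Y k (iR l (\<alpha> * \<beta>))) =
        A1 + B + ?s *\<^sub>C ((\<Sum>k=1..N. \<Sum>l=1..N. \<Sum>q=1..N. \<sigma> i j k l *\<^sub>C (Y k (L q l \<alpha>) * iR q \<beta>)) + U)"
      unfolding A1_def B_def U_def using mult.hyps
      by (simp add: iR_mult[where n = n] Y_mult clinear_add[OF Y_clinear] clinear_scale[OF Y_clinear] clinear_sum[OF Y_clinear]
          sum.distrib scaleC_add_right complex_vector.scale_sum_right scaleC_scaleC mult.commute
          sum_distrib_right mult_scaleC_left)
    have 2: "(\<Sum>k=1..N. ?C i j k *\<^sub>C iR k (\<alpha> * \<beta>)) =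
        A2 + ?s *\<^sub>C (\<Sum>k=1..N. \<Sum>q=1..N. ?C i j k *\<^sub>C (L q k \<alpha> * iR q \<beta>))"
      unfolding A2_def using mult.hyps
      by (simp add: iR_mult[where n = n] sum.distrib scaleC_add_right complex_vector.scale_sum_right scaleC_scaleC
          mult.commute sum_distrib_right mult_scaleC_left)
    have 3: "(\<Sum>k=1..N. \<Sum>l=1..N. \<Sum>q=1..N. \<sigma> i j k l *\<^sub>C (Y k (L q l \<alpha>) * iR q \<beta>)) +
        (\<Sum>k=1..N. \<Sum>q=1..N. ?C i j k *\<^sub>C (L q k \<alpha> * iR q \<beta>)) =
        (\<Sum>a=1..N. ((\<Sum>c=1..N. \<Sum>l=1..N. \<sigma> i j c l *\<^sub>C Y c (L a l \<alpha>)) +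
          (\<Sum>l=1..N. ?C i j l *\<^sub>C L a l \<alpha>)) * iR a \<beta>)"
    proof -
      have "(\<Sum>k=1..N. \<Sum>l=1..N. \<Sum>q=1..N. \<sigma> i j k l *\<^sub>C (Y k (L q l \<alpha>) * iR q \<beta>)) =
          (\<Sum>q=1..N. \<Sum>k=1..N. \<Sum>l=1..N. \<sigma> i j k l *\<^sub>C (Y k (L q l \<alpha>) * iR q \<beta>))"
        by (rule sum_swap3[symmetric])
      moreover have "(\<Sum>k=1..N. \<Sum>q=1..N. ?C i j k *\<^sub>C (L q k \<alpha> * iR q \<beta>)) =
          (\<Sum>q=1..N. \<Sum>k=1..N. ?C i j k *\<^sub>C (L q k \<alpha> * iR q \<beta>))"
        by (rule sum.swap)
      ultimately show ?thesis
        by (simp only: distrib_right sum.distrib sum_distrib_right mult_scaleC_left)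
    qed
    show "iR i (Y j (\<alpha> * \<beta>)) = (\<Sum>k=1..N. \<Sum>l=1..N. \<sigma> i j k l *\<^sub>C Y k (iR l (\<alpha> * \<beta>))) +
        (\<Sum>k=1..N. ?C i j k *\<^sub>C iR k (\<alpha> * \<beta>))"
    proof -
      \<comment> \<open>The remaining terms all end in \<open>iR a \<beta>\<close>, and
        \<open>mixed_L\<close> is exactly the equality of what stands in front of it.\<close>
      have 4: "(\<Sum>a=1..N. ((\<Sum>r=1..N. \<Sum>c=1..N. ?C r c a *\<^sub>C L r i (L c j \<alpha>)) + L a i (Y j \<alpha>)) * iR a \<beta>) =
          (\<Sum>a=1..N. ((\<Sum>c=1..N. \<Sum>l=1..N. \<sigma> i j c l *\<^sub>C Y c (L a l \<alpha>)) +
          (\<Sum>l=1..N. ?C i j l *\<^sub>C L a l \<alpha>)) * iR a \<beta>)"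
        using ij by (intro sum.cong) (simp_all only: HOL.refl mixed_L)
      show ?thesis
        unfolding lhs 1 2 4 3[symmetric]
        by (simp add: scaleC_add_right add.commute add.left_commute)
    qed
  qed
qed

text \<open>The condition on an array \<open>c\<close> that the sum of
  \<open>c i j *\<^sub>C (X i \<otimes> X j)\<close> be fixed by \<open>\<sigma>\<^sup>t\<close>.
  The entries may lie in any complex vector space, since arrays of forms satisfy it too in the
  product case of \<open>iR_iR\<close>.\<close>

definition braid_kernel :: "(nat \<Rightarrow> nat \<Rightarrow> 'b::complex_vector) \<Rightarrow> bool"
  where "braid_kernel c \<longleftrightarrow> (\<forall>k\<in>I. \<forall>l\<in>I. (\<Sum>i=1..N. \<Sum>j=1..N. \<sigma> i j k l *\<^sub>C c i j) = c k l)"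

text \<open>
  The coordinates of a form-valued kernel vector in a basis of the exterior algebra are scalar
  kernel vectors.
\<close>

lemma braid_kernel_sum:
  fixes e :: "nat \<Rightarrow> nat \<Rightarrow> 'w"
  assumes e: "braid_kernel e"
    and Z: "\<And>c :: nat \<Rightarrow> nat \<Rightarrow> complex. braid_kernel c \<Longrightarrow> (\<Sum>q=1..N. \<Sum>k=1..N. c q k *\<^sub>C Z q k) = 0"
  shows "(\<Sum>q=1..N. \<Sum>k=1..N. e q k * Z q k) = 0"
proof -
  define B where "B = (complex_vector.extend_basis {} :: 'w set)"
  have indep: "cindependent B" and span: "cspan B = UNIV"
    using complex_vector.independent_extend_basis[OF complex_vector.independent_empty]
      complex_vector.span_extend_basis[OF complex_vector.independent_empty]
    by (auto simp: B_def)
  define r where "r w b = complex_vector.representation B w b" for w b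
  define K where "K = (\<Union>q\<in>I. \<Union>k\<in>I. {b. r (e q k) b \<noteq> 0})"
  have K: "finite K"
    unfolding K_def r_def by (auto intro: complex_vector.finite_representation)
  have expand: "e q k = (\<Sum>b\<in>K. r (e q k) b *\<^sub>C b)" if "q \<in> I" "k \<in> I" for q k
  proof -
    have "e q k = (\<Sum>b | r (e q k) b \<noteq> 0. r (e q k) b *\<^sub>C b)"
      unfolding r_def by (rule complex_vector.sum_nonzero_representation_eq[symmetric]) (use indep span in auto)
    also have "\<dots> = (\<Sum>b\<in>K. r (e q k) b *\<^sub>C b)"
      by (rule sum.mono_neutral_left) (use K that in \<open>auto simp: K_def\<close>)
    finally show ?thesis .
  qed
  have kernel: "braid_kernel (\<lambda>q k. r (e q k) b)" for b
    unfolding braid_kernel_def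
  proof (intro ballI)
    fix n m assume nm: "n \<in> I" "m \<in> I"
    have "r (\<Sum>i=1..N. \<Sum>j=1..N. \<sigma> i j n m *\<^sub>C e i j) b = (\<Sum>i=1..N. \<Sum>j=1..N. \<sigma> i j n m *\<^sub>C r (e i j) b)"
      unfolding r_def using indep span
      by (simp add: complex_vector.representation_sum complex_vector.representation_scale)
    with e nm show "(\<Sum>i=1..N. \<Sum>j=1..N. \<sigma> i j n m *\<^sub>C r (e i j) b) = r (e n m) b"
      by (simp add: braid_kernel_def)
  qed
  have "(\<Sum>q=1..N. \<Sum>k=1..N. e q k * Z q k) = (\<Sum>q=1..N. \<Sum>k=1..N. (\<Sum>b\<in>K. r (e q k) b *\<^sub>C b) * Z q k)"
    by (intro sum.cong HOL.refl) (simp only: expand[symmetric])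
  also have "\<dots> = (\<Sum>b\<in>K. b * (\<Sum>q=1..N. \<Sum>k=1..N. r (e q k) b *\<^sub>C Z q k))"
    by (simp only: sum_distrib_right sum_distrib_left mult_scaleC_right mult_scaleC_left,
            rule sum_swap3[symmetric])
  also have "\<dots> = 0"
    by (simp only: Z[OF kernel] mult_zero_right sum.neutral_const)
  finally show ?thesis .
qed

lemma iR_iR_mult:
  assumes \<alpha>: "\<alpha> \<in> W n" and i: "i \<in> I" and j: "j \<in> I"
  shows "iR i (iR j \<alpha> * \<beta>) = iR i (iR j \<alpha>) * \<beta> - (-1) ^ n *\<^sub>C (\<Sum>q=1..N. L q i (iR j \<alpha>) * iR q \<beta>)"
proof (cases n)
  case 0
  then show ?thesis using iR_W0 \<alpha> i j by (simp add: clinear_0[OF iR_clinear] clinear_0[OF L_clinear])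
next
  case (Suc m)
  then show ?thesis using iR_mult[OF i iR_W[OF j, of \<alpha> m], of \<beta>] \<alpha>
    by (simp add: complex_vector.scale_minus_left)
qed

text \<open>The quantifier over all kernel arrays belongs to the induction: on a product, the terms
  in which both inner derivatives hit the right factor have an array of forms as coefficients, and
  the coordinates of these forms are scalar kernel arrays other than \<open>c\<close>.\<close>

lemma iR_iR: "\<forall>c :: nat \<Rightarrow> nat \<Rightarrow> complex. braid_kernel c \<longrightarrow>
    (\<Sum>i=1..N. \<Sum>j=1..N. c i j *\<^sub>C iR i (iR j \<alpha>)) = 0"
proof (induction \<alpha> rule: prod_induct_omega)
  case (add \<alpha> \<beta>)
  then show ?case
    by (simp add: clinear_add[OF iR_clinear] scaleC_add_right sum.distrib)
next
  case (scale a \<alpha>)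
  have "(\<Sum>i=1..N. \<Sum>j=1..N. c i j *\<^sub>C iR i (iR j (a *\<^sub>C \<alpha>))) =
      a *\<^sub>C (\<Sum>i=1..N. \<Sum>j=1..N. c i j *\<^sub>C iR i (iR j \<alpha>))" for c
    by (simp add: clinear_scale[OF iR_clinear] complex_vector.scale_sum_right scaleC_scaleC mult.commute)
  with scale show ?case by simp
next
  case (iA x)
  show ?case by (simp add: clinear_0[OF iR_clinear])
next
  case (omega p)
  then show ?case by (simp add: iR_omega)
next
  case (mult n \<alpha> \<beta>)
  let ?s = "(-1) ^ n :: complex"
  show ?case
  proof (intro allI impI)
    fix c :: "nat \<Rightarrow> nat \<Rightarrow> complex" assume c: "braid_kernel c"
    have c': "(\<Sum>i=1..N. \<Sum>j=1..N. c i j * \<sigma> i j k l) = c k l" if "k \<in> I" "l \<in> I" for k l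
      using c that by (simp add: braid_kernel_def mult.commute)
    \<comment> \<open>The form-valued coefficients of \<open>iR q (iR k \<beta>)\<close>. The braid
      relation for \<open>L\<close> passes the kernel condition from \<open>c\<close> to
      \<open>e\<close>.\<close>
    define e where "e q k = (\<Sum>i=1..N. \<Sum>j=1..N. c i j *\<^sub>C L q i (L k j \<alpha>))" for q k
    define M where "M = (\<Sum>i=1..N. \<Sum>j=1..N. \<Sum>q=1..N. c i j *\<^sub>C (L q i (iR j \<alpha>) * iR q \<beta>))"
    have "iR i (iR j (\<alpha> * \<beta>)) = iR i (iR j \<alpha>) * \<beta> - ?s *\<^sub>C (\<Sum>q=1..N. L q i (iR j \<alpha>) * iR q \<beta>) +
        ?s *\<^sub>C (\<Sum>k=1..N. (\<Sum>n=1..N. \<Sum>m=1..N. \<sigma> i j n m *\<^sub>C L k n (iR m \<alpha>)) * iR k \<beta>) +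
        (\<Sum>k=1..N. \<Sum>q=1..N. L q i (L k j \<alpha>) * iR q (iR k \<beta>))" if "i \<in> I" "j \<in> I" for i j
      using that L_W[OF mult.hyps] iR_L
      by (simp add: iR_mult[OF _ mult.hyps] clinear_add[OF iR_clinear] clinear_scale[OF iR_clinear] clinear_sum[OF iR_clinear]
          iR_iR_mult[OF mult.hyps] iR_mult[where n = n and \<alpha> = "L _ _ \<alpha>"] sum.distrib scaleC_add_right
          complex_vector.scale_sum_right)
    then have "(\<Sum>i=1..N. \<Sum>j=1..N. c i j *\<^sub>C iR i (iR j (\<alpha> * \<beta>))) =
        (\<Sum>i=1..N. \<Sum>j=1..N. c i j *\<^sub>C iR i (iR j \<alpha>)) * \<beta> - ?s *\<^sub>C M +
        ?s *\<^sub>C (\<Sum>i=1..N. \<Sum>j=1..N. \<Sum>k=1..N. \<Sum>n=1..N. \<Sum>m=1..N. (c i j * \<sigma> i j n m) *\<^sub>C (L k n (iR m \<alpha>) * iR k \<beta>)) +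
        (\<Sum>i=1..N. \<Sum>j=1..N. \<Sum>k=1..N. \<Sum>q=1..N. c i j *\<^sub>C (L q i (L k j \<alpha>) * iR q (iR k \<beta>)))"
      unfolding M_def
      by (simp add: scaleC_add_right complex_vector.scale_right_diff_distrib sum.distrib sum_subtractf
          complex_vector.scale_sum_right scaleC_scaleC mult.commute mult.left_commute sum_distrib_right mult_scaleC_left)
    also have "(\<Sum>i=1..N. \<Sum>j=1..N. c i j *\<^sub>C iR i (iR j \<alpha>)) = 0"
      using mult.IH(1) c by blast
    \<comment> \<open>In these mixed terms \<open>iR_L\<close> has produced a factor
      \<open>\<sigma>\<close>, which the kernel condition absorbs into \<open>c\<close>. They become
      \<open>M\<close> and cancel the mixed terms of the opposite sign.\<close>
    also have "(\<Sum>i=1..N. \<Sum>j=1..N. \<Sum>k=1..N. \<Sum>n=1..N. \<Sum>m=1..N. (c i j * \<sigma> i j n m) *\<^sub>C (L k n (iR m \<alpha>) * iR k \<beta>)) = M"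
    proof -
      have "(\<Sum>i=1..N. \<Sum>j=1..N. \<Sum>k=1..N. \<Sum>n=1..N. \<Sum>m=1..N. (c i j * \<sigma> i j n m) *\<^sub>C (L k n (iR m \<alpha>) * iR k \<beta>)) =
          (\<Sum>k=1..N. \<Sum>i=1..N. \<Sum>j=1..N. \<Sum>n=1..N. \<Sum>m=1..N. (c i j * \<sigma> i j n m) *\<^sub>C (L k n (iR m \<alpha>) * iR k \<beta>))"
        by (rule sum_swap3[symmetric])
      also have "\<dots> = (\<Sum>k=1..N. \<Sum>n=1..N. \<Sum>m=1..N. (\<Sum>i=1..N. \<Sum>j=1..N. c i j * \<sigma> i j n m) *\<^sub>C (L k n (iR m \<alpha>) * iR k \<beta>))"
        by (simp only: complex_vector.scale_sum_left) (intro sum.cong HOL.refl sum_swap4)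
      also have "\<dots> = (\<Sum>k=1..N. \<Sum>n=1..N. \<Sum>m=1..N. c n m *\<^sub>C (L k n (iR m \<alpha>) * iR k \<beta>))"
        by (simp add: c')
      also have "\<dots> = M"
        unfolding M_def by (rule sum_swap3)
      finally show ?thesis .
    qed
    also have "(\<Sum>i=1..N. \<Sum>j=1..N. \<Sum>k=1..N. \<Sum>q=1..N. c i j *\<^sub>C (L q i (L k j \<alpha>) * iR q (iR k \<beta>))) =
        (\<Sum>q=1..N. \<Sum>k=1..N. e q k * iR q (iR k \<beta>))"
      unfolding e_def by (simp only: sum_distrib_right mult_scaleC_left, subst sum_swap4, rule sum.swap)
    also have "\<dots> = 0"
    proof (rule braid_kernel_sum)
      show "braid_kernel e"
        unfolding braid_kernel_def
      proof (intro ballI)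
        fix n m assume nm: "n \<in> I" "m \<in> I"
        have "(\<Sum>q=1..N. \<Sum>k=1..N. \<sigma> q k n m *\<^sub>C e q k) =
            (\<Sum>i=1..N. \<Sum>j=1..N. c i j *\<^sub>C (\<Sum>q=1..N. \<Sum>k=1..N. \<sigma> q k n m *\<^sub>C L q i (L k j \<alpha>)))"
          unfolding e_def complex_vector.scale_sum_right scaleC_scaleC
          by (subst sum_swap4) (simp only: mult.commute)
        also have "\<dots> = (\<Sum>i=1..N. \<Sum>j=1..N. c i j *\<^sub>C (\<Sum>a=1..N. \<Sum>b=1..N. \<sigma> i j a b *\<^sub>C L n a (L m b \<alpha>)))"
          using nm by (simp add: braid_L)
        also have "\<dots> = (\<Sum>a=1..N. \<Sum>b=1..N. (\<Sum>i=1..N. \<Sum>j=1..N. c i j * \<sigma> i j a b) *\<^sub>C L n a (L m b \<alpha>))"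
          unfolding complex_vector.scale_sum_right complex_vector.scale_sum_left scaleC_scaleC by (rule sum_swap4)
        also have "\<dots> = e n m"
          unfolding e_def by (simp add: c')
        finally show "(\<Sum>q=1..N. \<Sum>k=1..N. \<sigma> q k n m *\<^sub>C e q k) = e n m" .
      qed
      show "(\<Sum>q=1..N. \<Sum>k=1..N. c q k *\<^sub>C iR q (iR k \<beta>)) = 0" if "braid_kernel c" for c :: "nat \<Rightarrow> nat \<Rightarrow> complex"
        using mult.IH(2) that by blast
    qed
    finally show "(\<Sum>i=1..N. \<Sum>j=1..N. c i j *\<^sub>C iR i (iR j (\<alpha> * \<beta>))) = 0" by simp
  qed
qed

text \<open>This is the coefficient array of a spanning element of the kernel: the Kronecker symbols
  account for \<open>X i \<otimes> X j\<close>. Such an element is fixed by the transposed braiding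
  \<open>st\<close>, and independence of the \<open>X k \<otimes> X l\<close> allows comparison of
  coefficients.\<close>

lemma kernel_coeffs_braid_kernel:
  assumes "kernel_coeffs N f J X P t" and P: "(i, j) \<in> P"
  shows "braid_kernel (\<lambda>k l. (if k = i then 1 else 0) * (if l = j then 1 else 0) + t i j k l)"
    (is "braid_kernel ?c")
proof -
  obtain st where st: "clinear st"
    "\<And>i j. i \<in> I \<Longrightarrow> j \<in> I \<Longrightarrow> st (X i \<otimes> X j) = (\<Sum>k=1..N. \<Sum>l=1..N. \<sigma> i j k l *\<^sub>C (X k \<otimes> X l))"
    "{u \<in> cspan {X i \<otimes> X j |i j. i \<in> I \<and> j \<in> I}. st u = u} =
        cspan {X i \<otimes> X j + (\<Sum>k=1..N. \<Sum>l=1..N. t i j k l *\<^sub>C (X k \<otimes> X l)) |i j. (i, j) \<in> P}"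
    and ij: "i \<in> I" "j \<in> I"
    using assms unfolding kernel_coeffs_def by auto
  let ?u = "X i \<otimes> X j + (\<Sum>k=1..N. \<Sum>l=1..N. t i j k l *\<^sub>C (X k \<otimes> X l))"
  have "?u \<in> cspan {X i \<otimes> X j + (\<Sum>k=1..N. \<Sum>l=1..N. t i j k l *\<^sub>C (X k \<otimes> X l)) |i j. (i, j) \<in> P}"
    by (rule complex_vector.span_base) (use P in blast)
  then have u: "st ?u = ?u"
    using st(3) by blast
  have "?u = (\<Sum>k=1..N. \<Sum>l=1..N. ?c k l *\<^sub>C (X k \<otimes> X l))"
  proof -
    have "(\<Sum>k=1..N. \<Sum>l=1..N. ((if k = i then 1 else 0) * (if l = j then 1 else 0)) *\<^sub>C (X k \<otimes> X l)) =
        (\<Sum>k=1..N. (if k = i then 1 else 0) *\<^sub>C (\<Sum>l=1..N. (if l = j then 1 else 0) *\<^sub>C (X k \<otimes> X l)))"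
      by (simp only: complex_vector.scale_sum_right scaleC_scaleC)
    also have "\<dots> = X i \<otimes> X j"
      using ij by (simp only: sum_delta_scaleC finite_atLeastAtMost)
    finally show ?thesis by (simp only: scaleC_add_left sum.distrib)
  qed
  with u have "st (\<Sum>k=1..N. \<Sum>l=1..N. ?c k l *\<^sub>C (X k \<otimes> X l)) = (\<Sum>k=1..N. \<Sum>l=1..N. ?c k l *\<^sub>C (X k \<otimes> X l))"
    by (simp only:)
  moreover have "st (\<Sum>k=1..N. \<Sum>l=1..N. c k l *\<^sub>C (X k \<otimes> X l)) =
      (\<Sum>a=1..N. \<Sum>b=1..N. (\<Sum>k=1..N. \<Sum>l=1..N. \<sigma> k l a b *\<^sub>C c k l) *\<^sub>C (X a \<otimes> X b))" for c
  proof -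
    have "st (\<Sum>k=1..N. \<Sum>l=1..N. c k l *\<^sub>C (X k \<otimes> X l)) =
        (\<Sum>k=1..N. \<Sum>l=1..N. \<Sum>a=1..N. \<Sum>b=1..N. (\<sigma> k l a b *\<^sub>C c k l) *\<^sub>C (X a \<otimes> X b))"
      by (simp add: clinear_sum[OF st(1)] clinear_scale[OF st(1)] st(2) complex_vector.scale_sum_right
          scaleC_scaleC mult.commute)
    also have "\<dots> = (\<Sum>a=1..N. \<Sum>b=1..N. (\<Sum>k=1..N. \<Sum>l=1..N. \<sigma> k l a b *\<^sub>C c k l) *\<^sub>C (X a \<otimes> X b))"
      unfolding complex_vector.scale_sum_left by (rule sum_swap4)
    finally show ?thesis .
  qed
  ultimately have "(\<Sum>a=1..N. \<Sum>b=1..N. (\<Sum>k=1..N. \<Sum>l=1..N. \<sigma> k l a b *\<^sub>C ?c k l) *\<^sub>C (X a \<otimes> X b)) =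
      (\<Sum>k=1..N. \<Sum>l=1..N. ?c k l *\<^sub>C (X k \<otimes> X l))"
    by (simp only:)
  from X_tensor_coeffs[OF this] show ?thesis
    unfolding braid_kernel_def by blast
qed

end

section \<open>The action of the Cartan algebra\<close>

text \<open>The universal property of a presentation needs a target algebra as a type. Linear
  endomorphisms are made one, with composition as product; on the function space itself the
  multiplication is pointwise.\<close>

typedef (overloaded) 'w endo = "{h :: 'w::complex_vector \<Rightarrow> 'w. clinear h}"
  morphisms endo_app Endo
  by (rule exI[of _ id]) (simp add: clinear_id')

setup_lifting type_definition_endo

instantiation endo :: (complex_algebra_1) complex_algebra_1
begin

lift_definition zero_endo :: "'a endo" is "\<lambda>_. 0" by (rule clinear_zero)
lift_definition one_endo :: "'a endo" is "\<lambda>x. x" by (rule clinear_id)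
lift_definition plus_endo :: "'a endo \<Rightarrow> 'a endo \<Rightarrow> 'a endo" is "\<lambda>f g x. f x + g x" by (rule clinear_plus)
lift_definition minus_endo :: "'a endo \<Rightarrow> 'a endo \<Rightarrow> 'a endo" is "\<lambda>f g x. f x - g x" by (rule clinear_minus)
lift_definition uminus_endo :: "'a endo \<Rightarrow> 'a endo" is "\<lambda>f x. - f x" by (rule clinear_uminus')
lift_definition times_endo :: "'a endo \<Rightarrow> 'a endo \<Rightarrow> 'a endo" is "\<lambda>f g x. f (g x)" by (rule clinear_comp)
lift_definition scaleC_endo :: "complex \<Rightarrow> 'a endo \<Rightarrow> 'a endo" is "\<lambda>c f x. c *\<^sub>C f x"
  by (rule clinear_scaleC_right)

instance
proof
  show "(0 :: 'a endo) \<noteq> 1"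
    by transfer (metis zero_neq_one)
qed (transfer, auto simp: fun_eq_iff algebra_simps scaleC_add_right scaleC_add_left scaleC_scaleC
    clinear_add clinear_scale)+

end

lemma endo_app_simps [simp]:
  "endo_app 0 \<alpha> = 0" "endo_app 1 \<alpha> = \<alpha>" "endo_app (x + y) \<alpha> = endo_app x \<alpha> + endo_app y \<alpha>"
  "endo_app (x - y) \<alpha> = endo_app x \<alpha> - endo_app y \<alpha>" "endo_app (- x) \<alpha> = - endo_app x \<alpha>"
  "endo_app (x * y) \<alpha> = endo_app x (endo_app y \<alpha>)" "endo_app (c *\<^sub>C x) \<alpha> = c *\<^sub>C endo_app x \<alpha>"
  by (transfer; simp)+

lemma endo_app_sum [simp]: "endo_app (\<Sum>i\<in>K. x i) \<alpha> = (\<Sum>i\<in>K. endo_app (x i) \<alpha>)"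
  by (induction K rule: infinite_finite_induct) simp_all

lemma endo_app_Endo: "clinear h \<Longrightarrow> endo_app (Endo h) = h"
  by (simp add: Endo_inverse)

lemma endo_app_clinear: "clinear (endo_app x)"
  using endo_app[of x] by simp

lemma endo_eqI: "(\<And>\<alpha>. endo_app x \<alpha> = endo_app y \<alpha>) \<Longrightarrow> x = y"
  by (simp add: endo_app_inject[symmetric] fun_eq_iff)

section \<open>The homomorphism from the Cartan algebra to the endomorphisms\<close>

locale cartan = exterior A G N \<omega> f J X jA jG \<pi> d \<Lambda> iR
  for A :: "'a::complex_algebra_1 hopf_struct"
    and G :: "('a, 'g::complex_vector) calculus_struct" and N \<omega> f J X
    and jA :: "'a \<Rightarrow> 't::complex_algebra_1" and jG and \<pi> :: "'t \<Rightarrow> 'w::complex_algebra_1" and d \<Lambda> iR +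
  fixes P :: "(nat \<times> nat) set" and t :: "nat \<Rightarrow> nat \<Rightarrow> nat \<Rightarrow> nat \<Rightarrow> complex"
    and \<iota> :: "('a \<Rightarrow> complex) \<Rightarrow> 'c::complex_algebra_1" and \<xi> :: "nat \<Rightarrow> 'c" and \<delta> :: 'c
    and C :: "'c hopf_struct"
  assumes S_compatible: "S_compatible A N f X"
    and kernel_coeffs: "kernel_coeffs N f J X P t"
    and cartan_algebra: "is_cartan_algebra A N f J X P t \<iota> \<xi> \<delta>"
    and cartan_hopf: "cartan_hopf_struct A N f X \<iota> \<xi> \<delta> C"
begin

abbreviation E where "E \<equiv> bialgebra_E A N f X"
abbreviation gr where "gr \<equiv> cartan_grading A N f X \<iota> \<xi> \<delta>"
abbreviation V where "V \<equiv> ext_parity jA jG \<pi>"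
abbreviation val where "val \<equiv> cartan_value \<iota> \<xi> \<delta>"
abbreviation gens where "gens \<equiv> cartan_gens E N"

lemma E_clinear: "h \<in> E \<Longrightarrow> clinear h"
proof (induction rule: bialgebra_E.induct)
  case (add g h)
  show ?case unfolding plus_fun_def by (intro clinear_plus add.IH)
next
  case (scale g c)
  show ?case unfolding scaleC_fun_def by (intro clinear_scaleC_right scale.IH)
next
  case (mult g h)
  show ?case
    unfolding conv_def[abs_def]
    by (intro clin clinear_comp[OF mult.IH(1)] clinear_comp[OF mult.IH(2)] comul_clinear)
qed (rule counit_clinear X_clinear f_clinear; assumption)+

definition gen_endo :: "('a \<Rightarrow> complex) cartan_gen \<Rightarrow> 'w endo"
  where "gen_endo g = (case g of Ev h \<Rightarrow> Endo (\<lambda>\<alpha>. \<alpha> \<triangleleft> (h \<circ> T)) | Xi j \<Rightarrow> Endo (\<lambda>\<alpha>. - iR j \<alpha>) | Dl \<Rightarrow> Endo d)"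

lemma gen_endo:
  "h \<in> E \<Longrightarrow> endo_app (gen_endo (Ev h)) \<alpha> = \<alpha> \<triangleleft> (h \<circ> T)"
  "j \<in> I \<Longrightarrow> endo_app (gen_endo (Xi j)) \<alpha> = - iR j \<alpha>"
  "endo_app (gen_endo Dl) \<alpha> = d \<alpha>"
  by (simp_all add: gen_endo_def endo_app_Endo ra_clinear comp_T E_clinear iR_clinear clinear_uminus' d_clinear)

lemma X_E: "i \<in> I \<Longrightarrow> X i \<in> E" and f_E: "i \<in> I \<Longrightarrow> j \<in> I \<Longrightarrow> f i j \<in> E"
  by (auto intro: bialgebra_E.X bialgebra_E.f)

lemma gen_endo_X: "j \<in> I \<Longrightarrow> endo_app (gen_endo (Ev (X j))) \<alpha> = Y j \<alpha>"
  and gen_endo_f: "i \<in> I \<Longrightarrow> j \<in> I \<Longrightarrow> endo_app (gen_endo (Ev (f i j))) \<alpha> = L i j \<alpha>"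
  by (simp_all add: gen_endo X_E f_E Y_def L_def)

lemmas free_eval_simps = free_eval_add free_eval_diff free_eval_mult free_eval_sum

lemma gen_endo_even_relations:
  assumes "r \<in> even_relations A E"
  shows "free_eval gen_endo r = 0"
proof (rule endo_eqI)
  fix \<alpha>
  consider "r = gen (Ev \<epsilon>) - 1"
    | g h where "g \<in> E" "h \<in> E" "r = gen (Ev (g + h)) - gen (Ev g) - gen (Ev h)"
    | c g where "g \<in> E" "r = gen (Ev (c *\<^sub>C g)) - scalar c * gen (Ev g)"
    | g h where "g \<in> E" "h \<in> E" "r = gen (Ev (conv A g h)) - gen (Ev g) * gen (Ev h)"
    using assms unfolding even_relations_def by blast
  then show "endo_app (free_eval gen_endo r) \<alpha> = endo_app 0 \<alpha>"
  proof cases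
    case 1
    have "\<epsilon> \<circ> T = \<epsilon>" by (simp add: fun_eq_iff)
    then show ?thesis by (simp add: 1 free_eval_simps gen_endo bialgebra_E.one)
  next
    case 2
    have "\<alpha> \<triangleleft> ((g + h) \<circ> T) = \<alpha> \<triangleleft> (g \<circ> T) + \<alpha> \<triangleleft> (h \<circ> T)"
      using ra_plus[of \<alpha> "g \<circ> T" "h \<circ> T"] by (simp add: comp_def plus_fun_def)
    then show ?thesis using 2 by (simp add: free_eval_simps gen_endo bialgebra_E.add)
  next
    case 3
    have "\<alpha> \<triangleleft> ((c *\<^sub>C g) \<circ> T) = c *\<^sub>C (\<alpha> \<triangleleft> (g \<circ> T))"
      using ra_scale[of \<alpha> c "g \<circ> T"] by (simp add: comp_def scaleC_fun_def)
    then show ?thesis using 3 by (simp add: free_eval_simps gen_endo bialgebra_E.scale)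
  next
    case 4
    then show ?thesis
      by (simp add: free_eval_simps gen_endo bialgebra_E.mult ra_T_ra_T E_clinear)
  qed
qed

lemma gen_endo_odd_relations:
  assumes "r \<in> odd_relations N f J X P t"
  shows "free_eval gen_endo r = 0"
proof (rule endo_eqI)
  fix \<alpha>
  have Y_neg: "Y k (- \<beta>) = - Y k \<beta>" if "k \<in> I" for k \<beta>
    using that by (rule clinear_neg[OF Y_clinear])
  have L_neg: "L k l (- \<beta>) = - L k l \<beta>" if "k \<in> I" "l \<in> I" for k l \<beta>
    using that by (rule clinear_neg[OF L_clinear])
  have iR_neg: "iR k (- \<beta>) = - iR k \<beta>" if "k \<in> I" for k \<beta>
    using that by (rule clinear_neg[OF iR_clinear])
  consider i j where "(i, j) \<in> P"
      "r = gen (Xi i) * gen (Xi j) + (\<Sum>k=1..N. \<Sum>l=1..N. scalar (t i j k l) * gen (Xi k) * gen (Xi l))"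
    | i where "i \<in> I" "r = gen (Xi i) * gen Dl + gen Dl * gen (Xi i) - gen (Ev (X i))"
    | "r = gen Dl * gen Dl"
    | i j k where "i \<in> I" "j \<in> I" "k \<in> I" "r = gen (Xi i) * gen (Ev (f k j)) -
        (\<Sum>n=1..N. \<Sum>m=1..N. scalar (\<sigma> i j n m) * gen (Ev (f k n)) * gen (Xi m))"
    | i j where "i \<in> I" "j \<in> I" "r = gen (Xi i) * gen (Ev (X j)) -
        (\<Sum>k=1..N. \<Sum>l=1..N. scalar (\<sigma> i j k l) * gen (Ev (X k)) * gen (Xi l)) -
        (\<Sum>k=1..N. scalar (struct_coeff X J i j k) * gen (Xi k))"
    | i j where "i \<in> I" "j \<in> I" "r = gen (Ev (f i j)) * gen Dl - gen Dl * gen (Ev (f i j))"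
    | i where "i \<in> I" "r = gen (Ev (X i)) * gen Dl - gen Dl * gen (Ev (X i))"
    using assms unfolding odd_relations_def by blast
  then show "endo_app (free_eval gen_endo r) \<alpha> = endo_app 0 \<alpha>"
  proof cases
    case 1
    have ij: "i \<in> I" "j \<in> I" using 1 kernel_coeffs by (auto simp: kernel_coeffs_def)
    have "(\<Sum>k=1..N. \<Sum>l=1..N. ((if k = i then 1 else 0) * (if l = j then 1 else 0) + t i j k l) *\<^sub>C iR k (iR l \<alpha>)) = 0"
      using iR_iR[of \<alpha>] kernel_coeffs_braid_kernel[OF kernel_coeffs 1(1)] by blast
    moreover have "(\<Sum>k=1..N. \<Sum>l=1..N. ((if k = i then 1 else 0) * (if l = j then 1 else 0)) *\<^sub>C iR k (iR l \<alpha>)) =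
        iR i (iR j \<alpha>)"
    proof -
      have "(\<Sum>k=1..N. \<Sum>l=1..N. ((if k = i then 1 else 0) * (if l = j then 1 else 0)) *\<^sub>C iR k (iR l \<alpha>)) =
          (\<Sum>k=1..N. (if k = i then 1 else 0) *\<^sub>C (\<Sum>l=1..N. (if l = j then 1 else 0) *\<^sub>C iR k (iR l \<alpha>)))"
        by (simp only: complex_vector.scale_sum_right scaleC_scaleC)
      also have "\<dots> = iR i (iR j \<alpha>)"
        using ij by (simp only: sum_delta_scaleC finite_atLeastAtMost)
      finally show ?thesis .
    qed
    ultimately have "iR i (iR j \<alpha>) + (\<Sum>k=1..N. \<Sum>l=1..N. t i j k l *\<^sub>C iR k (iR l \<alpha>)) = 0"
      by (simp only: scaleC_add_left sum.distrib)
    then show ?thesis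
      using ij by (simp add: 1 free_eval_simps gen_endo iR_neg mult_scaleC_left)
  next
    case 2
    then have "d (iR i \<alpha>) + iR i (d \<alpha>) = - Y i \<alpha>"
      using Cartan_identity by blast
    then have "- iR i (d \<alpha>) - d (iR i \<alpha>) = Y i \<alpha>"
      by (metis add.commute add_uminus_conv_diff minus_add_distrib minus_minus)
    then show ?thesis
      using 2 by (simp add: free_eval_simps gen_endo gen_endo_X clinear_neg[OF d_clinear])
  next
    case 3
    then show ?thesis by (simp add: free_eval_simps gen_endo)
  next
    case 4
    then have "iR i (L k j \<alpha>) = (\<Sum>n=1..N. \<Sum>m=1..N. \<sigma> i j n m *\<^sub>C L k n (iR m \<alpha>))"
      using iR_L by blast
    then show ?thesis
      using 4 by (simp add: free_eval_simps gen_endo gen_endo_f L_neg mult_scaleC_left sum_negf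
        complex_vector.scale_minus_right)
  next
    case 5
    then have "iR i (Y j \<alpha>) = (\<Sum>k=1..N. \<Sum>l=1..N. \<sigma> i j k l *\<^sub>C Y k (iR l \<alpha>)) +
        (\<Sum>k=1..N. struct_coeff X J i j k *\<^sub>C iR k \<alpha>)"
      using iR_Y by blast
    then show ?thesis
      using 5 by (simp add: free_eval_simps gen_endo gen_endo_X Y_neg mult_scaleC_left sum_negf
        complex_vector.scale_minus_right)
  next
    case 6
    then show ?thesis by (simp add: free_eval_simps gen_endo gen_endo_f L_d)
  next
    case 7
    then show ?thesis by (simp add: free_eval_simps gen_endo gen_endo_X Y_d)
  qed
qed

definition \<Phi> :: "'c \<Rightarrow> 'w \<Rightarrow> 'w"
  where "\<Phi> x = endo_app ((SOME h. algebra_hom h \<and> (\<forall>s\<in>gens. h (val s) = gen_endo s)) x)"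

lemma \<Phi>_hom:
  "clinear (\<Phi> x)" "\<Phi> (x + y) \<alpha> = \<Phi> x \<alpha> + \<Phi> y \<alpha>" "\<Phi> (c *\<^sub>C x) \<alpha> = c *\<^sub>C \<Phi> x \<alpha>"
  "\<Phi> 1 \<alpha> = \<alpha>" "\<Phi> (x * y) \<alpha> = \<Phi> x (\<Phi> y \<alpha>)"
  "s \<in> gens \<Longrightarrow> \<Phi> (val s) \<alpha> = endo_app (gen_endo s) \<alpha>"
proof -
  define h where "h = (SOME h. algebra_hom h \<and> (\<forall>s\<in>gens. h (val s) = gen_endo s))"
  have "\<exists>h. algebra_hom h \<and> (\<forall>s\<in>gens. h (val s) = gen_endo s)"
    by (rule presented_hom[OF cartan_algebra[unfolded is_cartan_algebra_def]])
      (use gen_endo_even_relations gen_endo_odd_relations in auto)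
  then have "algebra_hom h \<and> (\<forall>s\<in>gens. h (val s) = gen_endo s)"
    unfolding h_def by (rule someI_ex)
  then have h: "clinear h" "h 1 = 1" "h (x * y) = h x * h y" "s \<in> gens \<Longrightarrow> h (val s) = gen_endo s" for x y s
    by (auto simp: algebra_hom_def)
  have \<Phi>: "\<Phi> x = endo_app (h x)" for x
    by (simp add: \<Phi>_def h_def)
  show "clinear (\<Phi> x)" "\<Phi> (x + y) \<alpha> = \<Phi> x \<alpha> + \<Phi> y \<alpha>" "\<Phi> (c *\<^sub>C x) \<alpha> = c *\<^sub>C \<Phi> x \<alpha>"
    "\<Phi> 1 \<alpha> = \<alpha>" "\<Phi> (x * y) \<alpha> = \<Phi> x (\<Phi> y \<alpha>)"
    by (simp_all add: \<Phi> endo_app_clinear clinear_add[OF h(1)] clinear_scale[OF h(1)] h(2,3))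
  show "s \<in> gens \<Longrightarrow> \<Phi> (val s) \<alpha> = endo_app (gen_endo s) \<alpha>"
    by (simp add: \<Phi> h(4))
qed

lemma gens_simps [simp]: "Ev h \<in> gens \<longleftrightarrow> h \<in> E" "Xi j \<in> gens \<longleftrightarrow> j \<in> I" "Dl \<in> gens"
  by (auto simp: cartan_gens_def)

lemma \<Phi>_iota: "h \<in> E \<Longrightarrow> \<Phi> (\<iota> h) \<alpha> = \<alpha> \<triangleleft> (h \<circ> T)"
  and \<Phi>_xi: "j \<in> I \<Longrightarrow> \<Phi> (\<xi> j) \<alpha> = - iR j \<alpha>"
  and \<Phi>_delta: "\<Phi> \<delta> \<alpha> = d \<alpha>"
  using \<Phi>_hom(6)[of "Ev h"] \<Phi>_hom(6)[of "Xi j"] \<Phi>_hom(6)[of Dl] by (simp_all add: gen_endo)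

lemma \<Phi>_neg: "\<Phi> (- x) \<alpha> = - \<Phi> x \<alpha>"
  using \<Phi>_hom(3)[of "- 1" x \<alpha>] by (simp add: complex_vector.scale_minus_left scaleC_one)

lemma \<Phi>_clinear: "clinear \<Phi>"
  by (rule clinearI) (simp_all add: fun_eq_iff \<Phi>_hom scaleC_fun_def)

lemma \<Phi>_sum: "\<Phi> (\<Sum>i\<in>K. x i) \<alpha> = (\<Sum>i\<in>K. \<Phi> (x i) \<alpha>)"
proof -
  have "clinear (\<lambda>x. \<Phi> x \<alpha>)" by (rule clinearI) (simp_all add: \<Phi>_hom)
  then show ?thesis by (rule clinear_sum)
qed

section \<open>The antipode of the Cartan algebra and its inverse\<close>

sublocale H: graded_hopf gr C
  using cartan_hopf by unfold_locales (auto simp: cartan_hopf_struct_def graded_hopf_algebra_def)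

abbreviation SC where "SC \<equiv> antipode C"
abbreviation TC where "TC \<equiv> inv (antipode C)"

lemma comul_C:
  "i \<in> I \<Longrightarrow> comul C (\<iota> (X i)) = 1 \<otimes> \<iota> (X i) + (\<Sum>j=1..N. \<iota> (X j) \<otimes> \<iota> (f j i))"
  "i \<in> I \<Longrightarrow> j \<in> I \<Longrightarrow> comul C (\<iota> (f i j)) = (\<Sum>k=1..N. \<iota> (f i k) \<otimes> \<iota> (f k j))"
  "i \<in> I \<Longrightarrow> comul C (\<xi> i) = 1 \<otimes> \<xi> i + (\<Sum>j=1..N. \<xi> j \<otimes> \<iota> (f j i))"
  "comul C \<delta> = 1 \<otimes> \<delta> + \<delta> \<otimes> 1"
  using cartan_hopf by (auto simp: cartan_hopf_struct_def)

lemma counit_C: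
  "i \<in> I \<Longrightarrow> counit C (\<iota> (X i)) = 0" "i \<in> I \<Longrightarrow> counit C (\<xi> i) = 0" "counit C \<delta> = 0"
  "i \<in> I \<Longrightarrow> j \<in> I \<Longrightarrow> counit C (\<iota> (f i j)) = (if i = j then 1 else 0)"
  using cartan_hopf by (auto simp: cartan_hopf_struct_def)

lemma counit_odd: "x \<in> gr (Suc 0) \<Longrightarrow> counit C x = 0"
  using cartan_hopf by (simp add: cartan_hopf_struct_def graded_hopf_algebra_def One_nat_def)

lemma antipode_C:
  "h \<in> E \<Longrightarrow> SC (\<iota> h) = \<iota> (h \<circ> S)"
  "i \<in> I \<Longrightarrow> SC (\<iota> (X i)) = - (\<Sum>j=1..N. \<iota> (X j) * SC (\<iota> (f j i)))"
  "i \<in> I \<Longrightarrow> SC (\<xi> i) = - (\<Sum>j=1..N. \<xi> j * SC (\<iota> (f j i)))"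
  "SC \<delta> = - \<delta>"
  using cartan_hopf by (auto simp: cartan_hopf_struct_def dual_antipode_def)

lemma bij_SC: "bij SC"
  using cartan_hopf by (auto simp: cartan_hopf_struct_def)

lemma SC_TC [simp]: "SC (TC x) = x" and TC_SC [simp]: "TC (SC x) = x"
  using bij_SC by (simp_all add: bij_is_surj surj_f_inv_f bij_is_inj)

lemma TC_clinear: "clinear TC"
  by (rule clinearI)
    (metis SC_TC TC_SC clinear_add[OF H.antipode_clinear], metis SC_TC TC_SC clinear_scale[OF H.antipode_clinear])

text \<open>The antipode preserves degrees, so it maps the homogeneous parts of \<open>TC x\<close>
  to those of \<open>x\<close>. As it is injective, the part of the wrong degree is zero.\<close>

lemma TC_degree:
  assumes p: "p < 2" and x: "x \<in> gr p"
  shows "TC x \<in> gr p"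
proof -
  define y where "y q = z2_part gr q (TC x)" for q
  have y: "q < 2 \<Longrightarrow> y q \<in> gr q" for q
    by (simp add: y_def H.part_mem)
  have sum: "y 0 + y (Suc 0) = TC x"
    by (simp add: y_def H.part_sum)
  then have Sx: "SC (y 0) + SC (y (Suc 0)) = x"
    by (metis SC_TC clinear_add[OF H.antipode_clinear])
  have "z2_part gr 0 x = SC (y 0)" "z2_part gr (Suc 0) x = SC (y (Suc 0))"
    using H.part_unique[of "SC (y 0)" "SC (y (Suc 0))"] y H.antipode_degree Sx by auto
  moreover have "SC z = 0 \<Longrightarrow> z = 0" for z
    by (metis TC_SC clinear_0[OF H.antipode_clinear])
  ultimately have "y q = 0" if "q < 2" "q \<noteq> p" for q
    using that H.part_homogeneous[OF p that(1) x] by (auto simp: less_2_cases_iff')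
  then have "TC x = y p"
    using sum p by (auto simp: less_2_cases_iff')
  then show ?thesis using y[OF p] by simp
qed

lemma TC_mult:
  assumes "p < 2" "x \<in> gr p" "q < 2" "y \<in> gr q"
  shows "TC (x * y) = (-1) ^ (p * q) *\<^sub>C (TC y * TC x)"
proof -
  have "SC (TC y * TC x) = (-1) ^ (q * p) *\<^sub>C (x * y)"
    using H.antipode_graded_mult[OF assms(3) TC_degree[OF assms(3,4)] assms(1) TC_degree[OF assms(1,2)]] by simp
  then have "TC y * TC x = TC ((-1) ^ (q * p) *\<^sub>C (x * y))"
    by (metis TC_SC)
  then show ?thesis
    by (simp add: clinear_scale[OF TC_clinear] mult.commute[of q p])
qed

lemma TC_one: "TC 1 = 1"
  by (metis TC_SC H.antipode_one)

section \<open>Degrees of words and of their operators\<close>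

abbreviation odds where "odds w \<equiv> length (filter is_odd w)"

lemma word_degree: "set w \<subseteq> gens \<Longrightarrow> prod_list (map val w) \<in> gr (odds w mod 2)"
  unfolding cartan_grading_def by (rule complex_vector.span_base) blast

lemma iota_degree: "h \<in> E \<Longrightarrow> \<iota> h \<in> gr 0"
  using word_degree[of "[Ev h]"] by simp

lemma xi_degree: "j \<in> I \<Longrightarrow> \<xi> j \<in> gr (Suc 0)"
  using word_degree[of "[Xi j]"] by (simp add: One_nat_def)

lemma delta_degree: "\<delta> \<in> gr (Suc 0)"
  using word_degree[of "[Dl]"] by (simp add: One_nat_def)

lemma iota_add: "g \<in> E \<Longrightarrow> h \<in> E \<Longrightarrow> \<iota> (g + h) = \<iota> g + \<iota> h"
  and iota_scale: "g \<in> E \<Longrightarrow> \<iota> (c *\<^sub>C g) = c *\<^sub>C \<iota> g"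
  and iota_conv: "g \<in> E \<Longrightarrow> h \<in> E \<Longrightarrow> \<iota> (conv A g h) = \<iota> g * \<iota> h"
  and iota_eps: "\<iota> \<epsilon> = 1"
proof -
  have rel: "free_eval val r = 0" if "r \<in> even_relations A E" for r
    using presented_relation[OF cartan_algebra[unfolded is_cartan_algebra_def]] that by blast
  show "\<iota> \<epsilon> = 1"
    using rel[of "gen (Ev \<epsilon>) - 1"] by (simp add: even_relations_def free_eval_simps)
  assume g: "g \<in> E"
  have "gen (Ev (c *\<^sub>C g)) - scalar c * gen (Ev g) \<in> even_relations A E"
    unfolding even_relations_def using g by blast
  from rel[OF this] show "\<iota> (c *\<^sub>C g) = c *\<^sub>C \<iota> g"
    by (simp add: free_eval_simps mult_scaleC_left)
  assume h: "h \<in> E"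
  have "gen (Ev (g + h)) - gen (Ev g) - gen (Ev h) \<in> even_relations A E"
    unfolding even_relations_def using g h by blast
  from rel[OF this] show "\<iota> (g + h) = \<iota> g + \<iota> h"
    by (simp add: free_eval_diff diff_eq_eq add.commute)
  have "gen (Ev (conv A g h)) - gen (Ev g) * gen (Ev h) \<in> even_relations A E"
    unfolding even_relations_def using g h by blast
  from rel[OF this] show "\<iota> (conv A g h) = \<iota> g * \<iota> h"
    by (simp add: free_eval_simps)
qed

lemma word_span: "x \<in> cspan {prod_list (map val w) |w. set w \<subseteq> gens}"
  by (rule presented_span[OF cartan_algebra[unfolded is_cartan_algebra_def]])

lemma word_induct [consumes 0, case_names add scale word]:
  assumes "\<And>x y. R x \<Longrightarrow> R y \<Longrightarrow> R (x + y)" and "\<And>c x. R x \<Longrightarrow> R (c *\<^sub>C x)"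
    and "\<And>w. set w \<subseteq> gens \<Longrightarrow> R (prod_list (map val w))"
  shows "R x"
  using word_span[of x]
proof (induction rule: complex_vector.span_induct_alt)
  case base
  have "R (0 *\<^sub>C prod_list (map val []))" by (rule assms(2)[OF assms(3)]) simp
  then show ?case unfolding scaleC_simps(2) .
next
  case (step c x y)
  from step(1) have "R x" by (elim CollectE exE conjE) (simp only: assms(3))
  then show ?case by (rule assms(1)[OF assms(2) step(2)])
qed

lemma V_subspace: "module.subspace scaleC (V q)"
  unfolding ext_parity_def by (rule complex_vector.subspace_span)

lemma W_V: "\<alpha> \<in> W n \<Longrightarrow> n mod 2 = q \<Longrightarrow> \<alpha> \<in> V q"
  unfolding ext_parity_def by (rule complex_vector.span_base) auto

lemma V_induct [consumes 1, case_names W add scale]: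
  assumes "\<alpha> \<in> V q" and "\<And>n \<alpha>. \<alpha> \<in> W n \<Longrightarrow> n mod 2 = q \<Longrightarrow> R \<alpha>" and "q < 2"
    and "\<And>\<alpha> \<beta>. R \<alpha> \<Longrightarrow> R \<beta> \<Longrightarrow> R (\<alpha> + \<beta>)" and "\<And>c \<alpha>. R \<alpha> \<Longrightarrow> R (c *\<^sub>C \<alpha>)"
  shows "R \<alpha>"
  using assms(1) unfolding ext_parity_def
proof (induction rule: complex_vector.span_induct_alt)
  case base
  show ?case using assms(2)[OF W_zero, of q] assms(3) by simp
next
  case (step c x y)
  from step(1) obtain n where "x \<in> W n" "n mod 2 = q" by blast
  then have "R x" by (rule assms(2))
  then show ?case by (rule assms(4)[OF assms(5) step(2)])
qed

lemma \<Phi>_iota_W: "h \<in> E \<Longrightarrow> \<alpha> \<in> W n \<Longrightarrow> \<Phi> (\<iota> h) \<alpha> \<in> W n"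
proof (induction arbitrary: \<alpha> rule: bialgebra_E.induct)
  case (X i)
  then show ?case using Y_W by (simp add: \<Phi>_iota X_E Y_def)
next
  case (f i j)
  then show ?case using L_W by (simp add: \<Phi>_iota f_E L_def)
qed (simp_all add: iota_eps iota_add iota_scale iota_conv \<Phi>_hom W_add W_scale)

lemma \<Phi>_val_V:
  assumes "s \<in> gens" and q: "q < 2" and "\<alpha> \<in> V q"
  shows "\<Phi> (val s) \<alpha> \<in> V ((of_bool (is_odd s) + q) mod 2)"
  using assms(3)
proof (induction rule: V_induct)
  case (W n \<alpha>)
  show ?case
  proof (cases s)
    case (Ev h)
    then show ?thesis using assms(1) W by (auto intro!: W_V[where n = n] \<Phi>_iota_W)
  next
    case (Xi j)
    then have j: "j \<in> I" using assms(1) by simp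
    show ?thesis
    proof (cases n)
      case 0
      then show ?thesis
        using W iR_W0 Xi j complex_vector.subspace_0[OF V_subspace] by (simp add: \<Phi>_xi)
    next
      case (Suc m)
      then have "\<Phi> (\<xi> j) \<alpha> \<in> W m" using W iR_W[OF j] by (simp add: \<Phi>_xi j W_neg)
      \<comment> \<open>Lowering the degree by one changes the parity just as raising it
        does.\<close>
      moreover have "m mod 2 = (1 + q) mod 2"
        using W(2) unfolding Suc by (elim subst) presburger
      ultimately have "\<Phi> (\<xi> j) \<alpha> \<in> V ((1 + q) mod 2)" by (rule W_V)
      then show ?thesis using Xi by simp
    qed
  next
    case Dl
    have "Suc n mod 2 = (1 + q) mod 2"
      using W(2) by (elim subst) presburger
    with d_W[OF W(1)] have "d \<alpha> \<in> V ((1 + q) mod 2)" by (rule W_V)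
    then show ?thesis using Dl by (simp add: \<Phi>_delta)
  qed
qed (simp_all add: q clinear_add[OF \<Phi>_hom(1)] clinear_scale[OF \<Phi>_hom(1)]
    complex_vector.subspace_add[OF V_subspace] complex_vector.subspace_scale[OF V_subspace])

lemma \<Phi>_word_V: "set w \<subseteq> gens \<Longrightarrow> q < 2 \<Longrightarrow> \<alpha> \<in> V q \<Longrightarrow> \<Phi> (prod_list (map val w)) \<alpha> \<in> V ((odds w + q) mod 2)"
proof (induction w)
  case (Cons s w)
  then have "\<Phi> (val s) (\<Phi> (prod_list (map val w)) \<alpha>) \<in> V ((of_bool (is_odd s) + (odds w + q) mod 2) mod 2)"
    by (intro \<Phi>_val_V) auto
  then show ?case by (cases "is_odd s") (simp_all add: \<Phi>_hom mod_simps One_nat_def)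
qed (simp add: \<Phi>_hom)

lemma \<Phi>_V:
  assumes "x \<in> gr p" and "q < 2" and "\<alpha> \<in> V q"
  shows "\<Phi> x \<alpha> \<in> V ((p + q) mod 2)"
  using assms(1) unfolding cartan_grading_def
proof (induction rule: complex_vector.span_induct_alt)
  case base
  have "\<Phi> 0 \<alpha> = 0" using \<Phi>_hom(3)[of 0 0 \<alpha>] by simp
  then show ?case by (simp add: complex_vector.subspace_0[OF V_subspace])
next
  case (step c x y)
  then obtain w where w: "x = prod_list (map val w)" "set w \<subseteq> gens" "odds w mod 2 = p" by blast
  have "\<Phi> x \<alpha> \<in> V ((p + q) mod 2)"
    using \<Phi>_word_V[OF w(2) assms(2,3)] unfolding w(1) w(3)[symmetric] by (simp add: mod_simps)
  then show ?case
    using step(2) by (simp add: \<Phi>_hom complex_vector.subspace_add[OF V_subspace]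
      complex_vector.subspace_scale[OF V_subspace])
qed

section \<open>Existence and uniqueness of the action\<close>

definition \<rho> :: "'c \<Rightarrow> 'w \<Rightarrow> 'w" where "\<rho> x = \<Phi> (SC x)"

definition is_action :: "('c \<Rightarrow> 'w \<Rightarrow> 'w) \<Rightarrow> bool"
  where "is_action r \<longleftrightarrow> graded_anti_hom gr V r \<and>
      (\<forall>j\<in>I. r (- TC (\<iota> (X j))) = LR1 A X \<Lambda> j) \<and>
      (\<forall>j\<in>I. \<forall>k\<in>I. r (TC (\<iota> (f j k))) = L j k) \<and>
      (\<forall>j\<in>I. r (- TC (\<xi> j)) = iR j) \<and>
      r (TC \<delta>) = d"

lemma \<rho>_clinear: "clinear \<rho>"
  unfolding \<rho>_def[abs_def] by (rule clinear_comp[OF \<Phi>_clinear H.antipode_clinear])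

lemma \<rho>_app_clinear: "clinear (\<rho> x)"
  unfolding \<rho>_def by (rule \<Phi>_hom)

lemma \<rho>_one: "\<rho> 1 \<alpha> = \<alpha>"
  by (simp add: \<rho>_def H.antipode_one \<Phi>_hom)

lemma \<rho>_mult: "p < 2 \<Longrightarrow> x \<in> gr p \<Longrightarrow> q < 2 \<Longrightarrow> y \<in> gr q \<Longrightarrow>
    \<rho> (x * y) \<alpha> = (-1) ^ (p * q) *\<^sub>C \<rho> y (\<rho> x \<alpha>)"
  by (simp add: \<rho>_def H.antipode_graded_mult \<Phi>_hom)

lemma \<rho>_V: "p < 2 \<Longrightarrow> x \<in> gr p \<Longrightarrow> q < 2 \<Longrightarrow> \<alpha> \<in> V q \<Longrightarrow> \<rho> x \<alpha> \<in> V ((p + q) mod 2)"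
  unfolding \<rho>_def by (rule \<Phi>_V[OF H.antipode_degree])

lemma \<rho>_is_action: "is_action \<rho>"
proof -
  have neg: "SC (- x) = - SC x" for x by (rule clinear_neg[OF H.antipode_clinear])
  have "graded_anti_hom gr V \<rho>"
    unfolding graded_anti_hom_def
    by (intro conjI allI impI ballI \<rho>_clinear \<rho>_app_clinear \<rho>_V)
      (auto simp: fun_eq_iff \<rho>_one \<rho>_mult scaleC_fun_def)
  then show ?thesis
    by (simp add: is_action_def fun_eq_iff \<rho>_def neg \<Phi>_neg \<Phi>_xi \<Phi>_delta \<Phi>_iota X_E f_E LR1_eq Y_def L_def)
qed

text \<open>\<open>\<rho>'\<close> composed with \<open>TC\<close> is multiplicative: both reverse
  products, and their signs cancel. On the even part only the values at \<open>X i\<close> and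
  \<open>f i j\<close> are prescribed; they determine it on \<open>E\<close> by the relations for
  sums, multiples and convolution products, and words in the generators do the rest.\<close>

lemma is_action_unique:
  assumes "is_action \<rho>'"
  shows "\<rho>' = \<rho>"
proof -
  have hom: "clinear \<rho>'" "\<rho>' 1 = id"
    "\<And>p q x y. p < 2 \<Longrightarrow> q < 2 \<Longrightarrow> x \<in> gr p \<Longrightarrow> y \<in> gr q \<Longrightarrow> \<rho>' (x * y) = (-1) ^ (p * q) *\<^sub>C (\<rho>' y \<circ> \<rho>' x)"
    using assms unfolding is_action_def graded_anti_hom_def by blast+
  have vals: "\<And>j. j \<in> I \<Longrightarrow> \<rho>' (- TC (\<iota> (X j))) = LR1 A X \<Lambda> j"
      "\<And>j k. j \<in> I \<Longrightarrow> k \<in> I \<Longrightarrow> \<rho>' (TC (\<iota> (f j k))) = L j k"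
      "\<And>j. j \<in> I \<Longrightarrow> \<rho>' (- TC (\<xi> j)) = iR j" "\<rho>' (TC \<delta>) = d"
    using assms unfolding is_action_def by blast+
  define \<Psi> where "\<Psi> x = \<rho>' (TC x)" for x
  have \<Psi>_lin: "clinear \<Psi>"
    unfolding \<Psi>_def[abs_def] by (rule clinear_comp[OF hom(1) TC_clinear])
  have \<Psi>_one: "\<Psi> 1 \<alpha> = \<alpha>" for \<alpha>
    by (simp add: \<Psi>_def TC_one hom(2))
  have \<Psi>_add: "\<Psi> (x + y) \<alpha> = \<Psi> x \<alpha> + \<Psi> y \<alpha>" and \<Psi>_scale: "\<Psi> (c *\<^sub>C x) \<alpha> = c *\<^sub>C \<Psi> x \<alpha>" for x y c \<alpha>
    by (simp_all add: clinear_add[OF \<Psi>_lin] clinear_scale[OF \<Psi>_lin] scaleC_fun_def)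
  have \<Psi>_mult: "\<Psi> (x * y) \<alpha> = \<Psi> x (\<Psi> y \<alpha>)" if "p < 2" "x \<in> gr p" "q < 2" "y \<in> gr q" for p q x y \<alpha>
    using hom(3)[OF that(3,1) TC_degree[OF that(3,4)] TC_degree[OF that(1,2)]]
    by (simp add: \<Psi>_def TC_mult[OF that] clinear_scale[OF hom(1)] scaleC_fun_def mult.commute[of q p])
  have neg: "\<rho>' (- x) \<alpha> = - \<rho>' x \<alpha>" for x \<alpha>
    by (simp add: clinear_neg[OF hom(1)])
  have \<Psi>_iota: "\<Psi> (\<iota> h) \<alpha> = \<Phi> (\<iota> h) \<alpha>" if "h \<in> E" for h \<alpha>
    using that
  proof (induction arbitrary: \<alpha> rule: bialgebra_E.induct)
    case (X i)
    then have "- \<rho>' (TC (\<iota> (X i))) \<alpha> = LR1 A X \<Lambda> i \<alpha>"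
      using fun_cong[OF vals(1), of i \<alpha>] by (simp add: neg)
    then show ?case using X by (simp add: \<Psi>_def LR1_eq \<Phi>_iota X_E Y_def)
  next
    case (f i j)
    then show ?case by (simp add: \<Psi>_def vals \<Phi>_iota f_E L_def)
  next
    case (mult g h)
    then show ?case
      using \<Psi>_mult[of 0 "\<iota> g" 0 "\<iota> h"] by (simp add: iota_conv iota_degree \<Phi>_hom)
  qed (simp_all add: iota_eps iota_add iota_scale \<Psi>_one \<Psi>_add \<Psi>_scale \<Phi>_hom)
  have \<Psi>_val: "\<Psi> (val s) \<alpha> = \<Phi> (val s) \<alpha>" if "s \<in> gens" for s \<alpha>
  proof (cases s)
    case (Xi j)
    then have j: "j \<in> I" using that by simp
    then have "- \<rho>' (TC (\<xi> j)) \<alpha> = iR j \<alpha>"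
      using fun_cong[OF vals(3), of j \<alpha>] by (simp add: neg)
    then have "\<rho>' (TC (\<xi> j)) \<alpha> = - iR j \<alpha>" by (metis minus_minus)
    then show ?thesis using Xi j by (simp add: \<Psi>_def \<Phi>_xi)
  next
    case Dl
    then show ?thesis by (simp add: \<Psi>_def vals \<Phi>_delta)
  qed (use that in \<open>simp add: \<Psi>_iota\<close>)
  have "\<forall>\<alpha>. \<Psi> x \<alpha> = \<Phi> x \<alpha>" for x
  proof (induction x rule: word_induct)
    case (word w)
    then show ?case
    proof (induction w)
      case (Cons s w)
      then have "\<Psi> (val s * prod_list (map val w)) \<alpha> = \<Psi> (val s) (\<Psi> (prod_list (map val w)) \<alpha>)" for \<alpha>
        using word_degree[of "[s]"] word_degree[of w]
          \<Psi>_mult[of "odds [s] mod 2" "val s" "odds w mod 2" "prod_list (map val w)" \<alpha>] by simp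
      then show ?case using Cons by (simp add: \<Psi>_val \<Phi>_hom)
    qed (simp add: \<Psi>_one \<Phi>_hom)
  qed (simp_all add: \<Psi>_add \<Psi>_scale \<Phi>_hom)
  then have "\<Psi> (SC x) = \<Phi> (SC x)" for x
    by (simp add: fun_eq_iff)
  then show ?thesis
    by (intro ext) (simp add: \<Psi>_def \<rho>_def)
qed

lemma \<rho>_lin: "clinear h \<Longrightarrow> clinear (\<lambda>x. \<rho> (h x) \<alpha>)"
  by (rule clinearI)
    (simp_all add: clinear_add[OF \<rho>_clinear] clinear_scale[OF \<rho>_clinear] clinear_add[of h]
      clinear_scale[of h] scaleC_fun_def)

lemma \<rho>_add: "\<rho> (x + y) \<alpha> = \<rho> x \<alpha> + \<rho> y \<alpha>" and \<rho>_scale: "\<rho> (c *\<^sub>C x) \<alpha> = c *\<^sub>C \<rho> x \<alpha>"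
  by (simp_all add: clinear_add[OF \<rho>_clinear] clinear_scale[OF \<rho>_clinear] scaleC_fun_def)

section \<open>The twisted Leibniz rule and its multiplicativity\<close>

definition twisted :: "nat \<Rightarrow> 'w \<Rightarrow> 'w \<Rightarrow> 'c \<Rightarrow> 'c \<Rightarrow> 'w"
  where "twisted q \<alpha> \<beta> y z = (\<Sum>p<2. (-1) ^ (p * q) *\<^sub>C (\<rho> y \<alpha> * \<rho> (z2_part gr p z) \<beta>))"

lemma twisted_bilinear: "cbilinear (twisted q \<alpha> \<beta>)"
  unfolding twisted_def[abs_def] by (intro clin \<rho>_lin H.part_clinear) auto

lemma twisted_homogeneous:
  "b < 2 \<Longrightarrow> z \<in> gr b \<Longrightarrow> twisted q \<alpha> \<beta> y z = (-1) ^ (b * q) *\<^sub>C (\<rho> y \<alpha> * \<rho> z \<beta>)"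
  using clinear_0[OF \<rho>_lin[OF clinear_id], of \<beta>]
  by (auto simp: twisted_def sum_lessThan_2 H.part_homogeneous less_2_cases_iff')

definition twisted_Leibniz :: "'c \<Rightarrow> bool"
  where "twisted_Leibniz x \<longleftrightarrow>
    (\<forall>q<2. \<forall>\<alpha>\<in>V q. \<forall>\<beta>. \<rho> x (\<alpha> * \<beta>) = tensor_lift (twisted q \<alpha> \<beta>) (comul C x))"

lemma twisted_Leibniz_add: "twisted_Leibniz x \<Longrightarrow> twisted_Leibniz y \<Longrightarrow> twisted_Leibniz (x + y)"
  by (simp add: twisted_Leibniz_def \<rho>_add clinear_add[OF H.comul_clinear]
      clinear_add[OF tensor_lift(2)[OF twisted_bilinear]])

lemma twisted_Leibniz_scale: "twisted_Leibniz x \<Longrightarrow> twisted_Leibniz (c *\<^sub>C x)"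
  by (simp add: twisted_Leibniz_def \<rho>_scale clinear_scale[OF H.comul_clinear]
      clinear_scale[OF tensor_lift(2)[OF twisted_bilinear]])

text \<open>A decomposition of the coproduct into homogeneous legs of explicit degrees, so that
  every graded sign becomes a definite number. Scalars are absorbed into the first leg.\<close>

lemma comul_homogeneous:
  assumes "p < 2" and "x \<in> gr p"
  shows "\<exists>(n::nat) a b y z. comul C x = (\<Sum>k<n. y k \<otimes> z k) \<and> (\<forall>k<n. a k < (2::nat) \<and> b k < (2::nat) \<and>
    (a k + b k) mod 2 = p \<and> y k \<in> gr (a k) \<and> z k \<in> gr (b k))" (is "?R (comul C x)")
proof -
  have "comul C x \<in> cspan {y \<otimes> z |y z q r. q < 2 \<and> r < 2 \<and> (q + r) mod 2 = p \<and> y \<in> gr q \<and> z \<in> gr r}"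
    using cartan_hopf assms unfolding cartan_hopf_struct_def graded_hopf_algebra_def by blast
  then show ?thesis
  proof (induction rule: complex_vector.span_induct_alt)
    case base
    show ?case by (intro exI[of _ 0]) simp
  next
    case (step c u v)
    from step(1) obtain y0 z0 a0 b0 where 0: "u = y0 \<otimes> z0" "a0 < 2" "b0 < 2" "(a0 + b0) mod 2 = p"
      "y0 \<in> gr a0" "z0 \<in> gr b0" by blast
    from step(2) obtain n :: nat and a b y z where n: "v = (\<Sum>k<n. y k \<otimes> z k)" "\<forall>k<n. a k < (2::nat) \<and>
      b k < (2::nat) \<and> (a k + b k) mod 2 = p \<and> y k \<in> gr (a k) \<and> z k \<in> gr (b k)" by blast
    have "c *\<^sub>C u + v = (\<Sum>k<Suc n. (y(n := c *\<^sub>C y0)) k \<otimes> (z(n := z0)) k)"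
      by (simp add: 0(1) n(1) elementary_tensor_scale_left add.commute)
    moreover have "\<forall>k<Suc n. (a(n := a0)) k < 2 \<and> (b(n := b0)) k < 2 \<and>
        ((a(n := a0)) k + (b(n := b0)) k) mod 2 = p \<and> (y(n := c *\<^sub>C y0)) k \<in> gr ((a(n := a0)) k) \<and>
        (z(n := z0)) k \<in> gr ((b(n := b0)) k)"
      using 0 n(2) by (auto simp: less_Suc_eq H.D_scale)
    ultimately show ?case by blast
  qed
qed

lemma graded_tensor_mult_homogeneous:
  assumes "\<And>k. k < n \<Longrightarrow> b k < 2 \<and> z k \<in> gr (b k)" and "\<And>l. l < n' \<Longrightarrow> a' l < 2 \<and> y' l \<in> gr (a' l)"
  shows "graded_tensor_mult gr (\<Sum>k<n. y k \<otimes> z k) (\<Sum>l<n'. y' l \<otimes> z' l) =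
    (\<Sum>k<n. \<Sum>l<n'. (-1) ^ (b k * a' l) *\<^sub>C ((y k * y' l) \<otimes> (z k * z' l)))"
proof -
  let ?B = "\<lambda>x y x' y'. \<Sum>p<2. \<Sum>q<2. (-1) ^ (p * q) *\<^sub>C ((x * z2_part gr q x') \<otimes> (z2_part gr p y * y'))"
  have bil: "cbilinear (?B x y)" for x y
    by (intro clin) auto
  have "graded_tensor_mult gr (\<Sum>k<n. y k \<otimes> z k) (\<Sum>l<n'. y' l \<otimes> z' l) =
      (\<Sum>k<n. \<Sum>l<n'. ?B (y k) (z k) (y' l) (z' l))"
    unfolding graded_tensor_mult_def tensor_lift_decomp[OF bil]
    by (rule tensor_lift_decomp, intro clin) auto
  also have "\<dots> = (\<Sum>k<n. \<Sum>l<n'. (-1) ^ (b k * a' l) *\<^sub>C ((y k * y' l) \<otimes> (z k * z' l)))"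
  proof (intro sum.cong HOL.refl)
    fix k l assume "k \<in> {..<n}" "l \<in> {..<n'}"
    then have k: "b k < 2" "z k \<in> gr (b k)" and l: "a' l < 2" "y' l \<in> gr (a' l)"
      using assms by auto
    have zero: "u \<otimes> 0 = 0" "0 \<otimes> u = 0" for u :: 'c
      using clinear_0[OF clinear_tensor_right[OF clinear_id]] clinear_0[OF clinear_tensor_left[OF clinear_id]]
      by auto
    have "z2_part gr 0 (z k) = (if b k = 0 then z k else 0)" "z2_part gr (Suc 0) (z k) = (if b k = Suc 0 then z k else 0)"
      "z2_part gr 0 (y' l) = (if a' l = 0 then y' l else 0)" "z2_part gr (Suc 0) (y' l) = (if a' l = Suc 0 then y' l else 0)"
      using H.part_homogeneous[OF k(1) _ k(2)] H.part_homogeneous[OF l(1) _ l(2)] by auto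
    then show "?B (y k) (z k) (y' l) (z' l) = (-1) ^ (b k * a' l) *\<^sub>C ((y k * y' l) \<otimes> (z k * z' l))"
      using k(1) l(1) by (auto simp: less_2_cases_iff' sum_lessThan_2 zero)
  qed
  finally show ?thesis .
qed

text \<open>Left: the sign of reversing \<open>x\<close> and \<open>x'\<close>, then those of the
  Leibniz rules of \<open>x\<close> at degree \<open>q\<close> and of \<open>x'\<close> at degree
  \<open>a + q\<close>. Right: the sign of the tensor square, that of the Leibniz rule of
  \<open>x x'\<close>, and those of reversing the two pairs of legs.\<close>

lemma sign_identity:
  assumes "a < 2" "b < 2" "a' < 2" "b' < 2" "q < 2"
  shows "(-1) ^ (((a + b) mod 2) * ((a' + b') mod 2)) * ((-1) ^ (b * q) * (-1) ^ (b' * ((a + q) mod 2))) =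
    (-1) ^ (b * a') * ((-1) ^ (((b + b') mod 2) * q) * ((-1) ^ (a * a') * (-1 :: complex) ^ (b * b')))"
  using assms by (auto simp: less_2_cases_iff')

text \<open>The rules for \<open>x\<close> and \<open>x'\<close> are applied one after the other,
  the second to forms \<open>\<rho> (y k) \<alpha>\<close> of shifted parity; the outcome is the
  rule for \<open>x x'\<close> leg by leg, up to the signs compared in
  \<open>sign_identity\<close>.\<close>

lemma twisted_Leibniz_mult:
  assumes p: "p < 2" "x \<in> gr p" "twisted_Leibniz x" and p': "p' < 2" "x' \<in> gr p'" "twisted_Leibniz x'"
  shows "twisted_Leibniz (x * x')"
  unfolding twisted_Leibniz_def
proof (intro allI impI ballI)
  fix q :: nat and \<alpha> \<beta> assume q: "q < 2" and \<alpha>: "\<alpha> \<in> V q"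
  obtain n :: nat and a b y z where x: "comul C x = (\<Sum>k<n. y k \<otimes> z k)"
    and h: "\<forall>k<n. a k < (2::nat) \<and> b k < (2::nat) \<and> (a k + b k) mod 2 = p \<and> y k \<in> gr (a k) \<and> z k \<in> gr (b k)"
    using comul_homogeneous[OF p(1,2)] by blast
  obtain n' :: nat and a' b' y' z' where x': "comul C x' = (\<Sum>k<n'. y' k \<otimes> z' k)"
    and h': "\<forall>k<n'. a' k < (2::nat) \<and> b' k < (2::nat) \<and> (a' k + b' k) mod 2 = p' \<and> y' k \<in> gr (a' k) \<and> z' k \<in> gr (b' k)"
    using comul_homogeneous[OF p'(1,2)] by blast
  have Lx: "\<rho> x (\<alpha> * \<beta>) = (\<Sum>k<n. (-1) ^ (b k * q) *\<^sub>C (\<rho> (y k) \<alpha> * \<rho> (z k) \<beta>))"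
  proof -
    have "twisted q \<alpha> \<beta> (y k) (z k) = (-1) ^ (b k * q) *\<^sub>C (\<rho> (y k) \<alpha> * \<rho> (z k) \<beta>)" if "k < n" for k
      using h that by (intro twisted_homogeneous) auto
    then show ?thesis
      using p(3) q \<alpha> by (simp add: twisted_Leibniz_def x tensor_lift_decomp[OF twisted_bilinear])
  qed
  have Lx': "\<rho> x' (\<gamma> * \<gamma>') = (\<Sum>k<n'. (-1) ^ (b' k * r) *\<^sub>C (\<rho> (y' k) \<gamma> * \<rho> (z' k) \<gamma>'))" if "r < 2" "\<gamma> \<in> V r" for r \<gamma> \<gamma>'
  proof -
    have "twisted r \<gamma> \<gamma>' (y' k) (z' k) = (-1) ^ (b' k * r) *\<^sub>C (\<rho> (y' k) \<gamma> * \<rho> (z' k) \<gamma>')" if "k < n'" for k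
      using h' that by (intro twisted_homogeneous) auto
    then show ?thesis
      using p'(3) that by (simp add: twisted_Leibniz_def x' tensor_lift_decomp[OF twisted_bilinear])
  qed
  have "\<rho> (x * x') (\<alpha> * \<beta>) = (-1) ^ (p * p') *\<^sub>C \<rho> x' (\<rho> x (\<alpha> * \<beta>))"
    by (rule \<rho>_mult[OF p(1,2) p'(1,2)])
  also have "\<dots> = (\<Sum>k<n. \<Sum>l<n'. ((-1) ^ (p * p') * ((-1) ^ (b k * q) * (-1) ^ (b' l * ((a k + q) mod 2)))) *\<^sub>C
      (\<rho> (y' l) (\<rho> (y k) \<alpha>) * \<rho> (z' l) (\<rho> (z k) \<beta>)))"
  proof -
    have "\<rho> x' (\<rho> (y k) \<alpha> * \<rho> (z k) \<beta>) = (\<Sum>l<n'. (-1) ^ (b' l * ((a k + q) mod 2)) *\<^sub>C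
        (\<rho> (y' l) (\<rho> (y k) \<alpha>) * \<rho> (z' l) (\<rho> (z k) \<beta>)))" if "k < n" for k
      using h that by (intro Lx' \<rho>_V q \<alpha>) auto
    then show ?thesis
      unfolding Lx
      by (simp add: clinear_sum[OF \<rho>_app_clinear] clinear_scale[OF \<rho>_app_clinear]
          complex_vector.scale_sum_right scaleC_scaleC)
  qed
  also have "\<dots> = (\<Sum>k<n. \<Sum>l<n'. (-1) ^ (b k * a' l) *\<^sub>C twisted q \<alpha> \<beta> (y k * y' l) (z k * z' l))"
  proof (intro sum.cong HOL.refl)
    fix k l assume "k \<in> {..<n}" "l \<in> {..<n'}"
    then have k: "a k < 2" "b k < 2" "(a k + b k) mod 2 = p" "y k \<in> gr (a k)" "z k \<in> gr (b k)"
      and l: "a' l < 2" "b' l < 2" "(a' l + b' l) mod 2 = p'" "y' l \<in> gr (a' l)" "z' l \<in> gr (b' l)"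
      using h h' by auto
    have "z k * z' l \<in> gr ((b k + b' l) mod 2)"
      using k l by (intro H.D_mult)
    then have "twisted q \<alpha> \<beta> (y k * y' l) (z k * z' l) = (-1) ^ (((b k + b' l) mod 2) * q) *\<^sub>C
        (\<rho> (y k * y' l) \<alpha> * \<rho> (z k * z' l) \<beta>)"
      by (intro twisted_homogeneous) auto
    also have "\<dots> = ((-1) ^ (((b k + b' l) mod 2) * q) * ((-1) ^ (a k * a' l) * (-1) ^ (b k * b' l))) *\<^sub>C
        (\<rho> (y' l) (\<rho> (y k) \<alpha>) * \<rho> (z' l) (\<rho> (z k) \<beta>))"
      using k l by (simp add: \<rho>_mult[where p = "a k" and q = "a' l"] \<rho>_mult[where p = "b k" and q = "b' l"]
          mult_scaleC_left mult_scaleC_right scaleC_scaleC mult.assoc)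
    finally show "((-1) ^ (p * p') * ((-1) ^ (b k * q) * (-1) ^ (b' l * ((a k + q) mod 2)))) *\<^sub>C
        (\<rho> (y' l) (\<rho> (y k) \<alpha>) * \<rho> (z' l) (\<rho> (z k) \<beta>)) = (-1) ^ (b k * a' l) *\<^sub>C twisted q \<alpha> \<beta> (y k * y' l) (z k * z' l)"
      using sign_identity[OF k(1,2) l(1,2) q] k(3) l(3) by (simp only: scaleC_scaleC)
  qed
  also have "\<dots> = tensor_lift (twisted q \<alpha> \<beta>) (comul C (x * x'))"
  proof -
    have "comul C (x * x') = (\<Sum>k<n. \<Sum>l<n'. (-1) ^ (b k * a' l) *\<^sub>C ((y k * y' l) \<otimes> (z k * z' l)))"
      unfolding H.comul_mult x x' by (rule graded_tensor_mult_homogeneous) (use h h' in auto)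
    then show ?thesis
      by (simp add: clinear_sum[OF tensor_lift(2)[OF twisted_bilinear]]
          clinear_scale[OF tensor_lift(2)[OF twisted_bilinear]] tensor_lift(1)[OF twisted_bilinear])
  qed
  finally show "\<rho> (x * x') (\<alpha> * \<beta>) = tensor_lift (twisted q \<alpha> \<beta>) (comul C (x * x'))" .
qed

section \<open>Values of the action on the generators and their Leibniz rules\<close>

lemma SC_f_E: "i \<in> I \<Longrightarrow> j \<in> I \<Longrightarrow> f i j \<circ> S \<in> E"
  using S_compatible by (auto simp: S_compatible_def dual_antipode_def)

lemma \<rho>_f:
  assumes "i \<in> I" "j \<in> I"
  shows "\<rho> (\<iota> (f i j)) \<alpha> = \<alpha> \<triangleleft> f i j"
proof -
  have "f i j \<circ> S \<circ> T = f i j" by (simp add: fun_eq_iff)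
  then show ?thesis
    using assms by (simp add: \<rho>_def antipode_C(1) f_E \<Phi>_iota SC_f_E)
qed

text \<open>The counterpart of \<open>convolution_f_X\<close>: the scalar to which
  \<open>X i\<close> is applied is now \<open>T(x2) x1\<close>.\<close>

lemma convolution_X_f:
  assumes i: "i \<in> I"
  shows "(\<Sum>j=1..N. conv A (f j i) (X j \<circ> T) x) = - X i x"
proof -
  have "X i (swe (\<lambda>y z. T z * y) x) = 0"
    using i by (simp add: T_left clinear_scale[OF X_clinear])
  moreover have "X i (swe (\<lambda>y z. T z * y) x) =
      swe (\<lambda>y z. \<epsilon> z *\<^sub>C X i y) x + (\<Sum>j=1..N. conv A (f j i) (X j \<circ> T) x)"
    using i by (simp add: tensor_lift_push[OF X_clinear] X_mult tensor_lift_plus tensor_lift_sum conv_def mult.commute)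
  moreover have "swe (\<lambda>y z. \<epsilon> z *\<^sub>C X i y) x = X i x"
    using i by (intro counit_right clin)
  ultimately show ?thesis
    by (simp add: eq_neg_iff_add_eq_0 add.commute)
qed

text \<open>The antipode of \<open>X i\<close> is minus the sum of \<open>X j\<close> times the
  antipode of \<open>f j i\<close>, so \<open>\<rho>_f\<close> reduces the claim to a convolution of
  \<open>f j i\<close> with \<open>X j \<circ> T\<close>, evaluated above.\<close>

lemma \<rho>_X:
  assumes i: "i \<in> I"
  shows "\<rho> (\<iota> (X i)) \<alpha> = \<alpha> \<triangleleft> X i"
proof -
  have "\<rho> (\<iota> (X i)) \<alpha> = - (\<Sum>j=1..N. Y j (\<alpha> \<triangleleft> f j i))"
    using i by (simp add: \<rho>_def antipode_C(2) \<Phi>_neg \<Phi>_sum \<Phi>_hom \<Phi>_iota X_E Y_def \<rho>_f[unfolded \<rho>_def])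
  also have "(\<Sum>j=1..N. Y j (\<alpha> \<triangleleft> f j i)) = \<alpha> \<triangleleft> (\<lambda>x. \<Sum>j=1..N. conv A (f j i) (X j \<circ> T) x)"
    using i by (simp add: Y_def ra_ra f_clinear X_clinear comp_T ra_sum)
  also have "\<dots> = - (\<alpha> \<triangleleft> X i)"
    using ra_scale[of \<alpha> "- 1" "X i"] by (simp add: convolution_X_f i)
  finally show ?thesis by simp
qed

lemma \<rho>_xi: "i \<in> I \<Longrightarrow> \<rho> (\<xi> i) \<alpha> = (\<Sum>j=1..N. iR j (\<alpha> \<triangleleft> f j i))"
  by (simp add: \<rho>_def antipode_C(3) \<Phi>_neg \<Phi>_sum \<Phi>_hom \<Phi>_xi \<rho>_f[unfolded \<rho>_def] sum_negf)

lemma \<rho>_delta: "\<rho> \<delta> \<alpha> = - d \<alpha>"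
  by (simp add: \<rho>_def antipode_C(4) \<Phi>_neg \<Phi>_delta)

lemma twisted_even: "h \<in> E \<Longrightarrow> twisted q \<alpha> \<beta> y (\<iota> h) = \<rho> y \<alpha> * \<rho> (\<iota> h) \<beta>"
  using twisted_homogeneous[OF _ iota_degree] by simp

lemma twisted_odd: "z \<in> gr (Suc 0) \<Longrightarrow> twisted q \<alpha> \<beta> y z = (-1) ^ q *\<^sub>C (\<rho> y \<alpha> * \<rho> z \<beta>)"
  using twisted_homogeneous[of "Suc 0" z] by simp

lemma twisted_one: "twisted q \<alpha> \<beta> y 1 = \<rho> y \<alpha> * \<beta>"
  using twisted_even[OF bialgebra_E.one] by (simp add: iota_eps \<rho>_one)

lemma ra_f_mult: "i \<in> I \<Longrightarrow> j \<in> I \<Longrightarrow> (\<alpha> * \<beta>) \<triangleleft> f i j = (\<Sum>k=1..N. (\<alpha> \<triangleleft> f i k) * (\<beta> \<triangleleft> f k j))"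
  by (rule ra_mult) (simp_all add: f_clinear f_mult)

lemma ra_X_mult:
  assumes i: "i \<in> I"
  shows "(\<alpha> * \<beta>) \<triangleleft> X i = \<alpha> * (\<beta> \<triangleleft> X i) + (\<Sum>j=1..N. (\<alpha> \<triangleleft> X j) * (\<beta> \<triangleleft> f j i))"
proof -
  \<comment> \<open>Index 0 again carries the isolated coproduct term, now with the counit on the
    left factor and \<open>X i\<close> on the right.\<close>
  have "(\<alpha> * \<beta>) \<triangleleft> X i = (\<Sum>p\<in>insert 0 I. (\<alpha> \<triangleleft> (if p = 0 then \<epsilon> else X p)) *
      (\<beta> \<triangleleft> (if p = 0 then X i else f p i)))"
  proof (rule ra_mult)
    show "clinear (X i)" by (rule X_clinear[OF i])
    fix x y
    have "(\<Sum>p\<in>I. (if p = 0 then \<epsilon> else X p) x * (if p = 0 then X i else f p i) y) =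
        (\<Sum>p\<in>I. X p x * f p i y)"
      by (rule sum.cong) (auto simp: atLeastAtMost_iff)
    then show "X i (x * y) = (\<Sum>p\<in>insert 0 I. (if p = 0 then \<epsilon> else X p) x * (if p = 0 then X i else f p i) y)"
      using i by (simp add: X_mult atLeastAtMost_iff)
  qed
  moreover have "(\<Sum>p\<in>I. (\<alpha> \<triangleleft> (if p = 0 then \<epsilon> else X p)) * (\<beta> \<triangleleft> (if p = 0 then X i else f p i))) =
      (\<Sum>j=1..N. (\<alpha> \<triangleleft> X j) * (\<beta> \<triangleleft> f j i))"
    by (rule sum.cong) (auto simp: atLeastAtMost_iff)
  ultimately show ?thesis
    by (simp add: atLeastAtMost_iff)
qed

lemma lift_twisted_generator:
  "tensor_lift (twisted q \<alpha> \<beta>) (1 \<otimes> x + (\<Sum>j=1..N. y j \<otimes> z j)) =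
    twisted q \<alpha> \<beta> 1 x + (\<Sum>j=1..N. twisted q \<alpha> \<beta> (y j) (z j))"
  by (simp add: clinear_add[OF tensor_lift(2)[OF twisted_bilinear]] tensor_lift_decomp[OF twisted_bilinear]
      tensor_lift(1)[OF twisted_bilinear])

lemma twisted_Leibniz_iota: "h \<in> E \<Longrightarrow> twisted_Leibniz (\<iota> h)"
proof (induction rule: bialgebra_E.induct)
  case one
  show ?case
    unfolding iota_eps twisted_Leibniz_def H.comul_one tensor_lift(1)[OF twisted_bilinear] twisted_one
    by (simp add: \<rho>_one)
next
  case (X i)
  then show ?case
    by (simp add: twisted_Leibniz_def comul_C lift_twisted_generator twisted_even X_E f_E \<rho>_one \<rho>_X \<rho>_f ra_X_mult)
next
  case (f i j)
  then show ?case
    by (simp add: twisted_Leibniz_def comul_C tensor_lift_decomp[OF twisted_bilinear] twisted_even f_E \<rho>_f ra_f_mult)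
next
  case (mult g h)
  then show ?case
    using twisted_Leibniz_mult[of 0 "\<iota> g" 0 "\<iota> h"] by (simp add: iota_conv iota_degree)
next
  case (add g h)
  show ?case unfolding iota_add[OF add.hyps] by (intro twisted_Leibniz_add add.IH)
next
  case (scale g c)
  show ?case unfolding iota_scale[OF scale.hyps] by (intro twisted_Leibniz_scale scale.IH)
qed

lemma twisted_Leibniz_W:
  assumes "\<And>n \<alpha> \<beta>. \<alpha> \<in> W n \<Longrightarrow> \<rho> x (\<alpha> * \<beta>) = tensor_lift (twisted (n mod 2) \<alpha> \<beta>) (comul C x)"
  shows "twisted_Leibniz x"
  unfolding twisted_Leibniz_def
proof (intro allI impI ballI)
  fix q :: nat and \<alpha> \<beta> assume q: "q < 2" and "\<alpha> \<in> V q"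
  have lin: "clinear (\<lambda>\<alpha>. tensor_lift (twisted q \<alpha> \<beta>) (comul C x))"
    unfolding twisted_def[abs_def] by (intro clin \<rho>_app_clinear)
  show "\<rho> x (\<alpha> * \<beta>) = tensor_lift (twisted q \<alpha> \<beta>) (comul C x)"
    using \<open>\<alpha> \<in> V q\<close>
  proof (induction rule: V_induct)
    case (W n \<alpha>)
    then show ?case using assms by auto
  qed (simp_all add: q distrib_right mult_scaleC_left clinear_add[OF \<rho>_app_clinear] clinear_scale[OF \<rho>_app_clinear]
      clinear_add[OF lin] clinear_scale[OF lin])
qed

text \<open>The functional \<open>f m k\<close> at the scalar \<open>T(x2) x1\<close> shows that the
  operators of \<open>f j k\<close> and of \<open>f m j \<circ> T\<close> form inverse
  matrices.\<close>

lemma ra_f_T: "k \<in> I \<Longrightarrow> m \<in> I \<Longrightarrow> (\<Sum>j=1..N. L m j (\<alpha> \<triangleleft> f j k)) = (if m = k then \<alpha> else 0)"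
proof -
  assume km: "k \<in> I" "m \<in> I"
  have "(\<Sum>j=1..N. conv A (f j k) (f m j \<circ> T) x) = (if m = k then 1 else 0) * \<epsilon> x" for x
  proof -
    have "f m k (swe (\<lambda>y z. T z * y) x) = (\<Sum>j=1..N. conv A (f j k) (f m j \<circ> T) x)"
      using km by (simp add: tensor_lift_push[OF f_clinear] f_mult tensor_lift_sum conv_def mult.commute)
    then show ?thesis
      using km by (simp add: T_left clinear_scale[OF f_clinear] f_one mult.commute split del: if_split)
  qed
  then have "\<alpha> \<triangleleft> (\<lambda>x. \<Sum>j=1..N. conv A (f j k) (f m j \<circ> T) x) = (if m = k then 1 else 0) *\<^sub>C \<alpha>"
    by (simp only: ra_scale ra_eps)
  then show ?thesis
    using km by (simp add: L_def ra_ra f_clinear comp_T ra_sum)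
qed

lemma ra_f_W:
  assumes "\<alpha> \<in> W n" "i \<in> I" "j \<in> I"
  shows "\<alpha> \<triangleleft> f i j \<in> W n"
  using \<Phi>_iota_W[OF SC_f_E[OF assms(2,3)] assms(1)] \<rho>_f[OF assms(2,3), of \<alpha>] assms(2,3)
  by (simp add: \<rho>_def antipode_C(1) f_E)

lemma minus_one_power_mod_2: "(-1 :: complex) ^ (n mod 2) = (-1) ^ n"
  by (cases "even n") (simp_all add: odd_iff_mod_2_eq_one)

text \<open>\<open>\<rho> (\<xi> i)\<close> first acts with \<open>f j i\<close> and then with
  \<open>iR j\<close>. The Leibniz rule of \<open>iR j\<close> twists the left factor by
  \<open>L m j\<close>, and by \<open>ra_f_T\<close> this undoes the preceding action of
  \<open>f j k\<close>: the left factor stays unchanged, as the coproduct term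
  \<open>1 \<otimes> \<xi> i\<close> requires.\<close>

lemma twisted_Leibniz_xi:
  assumes i: "i \<in> I"
  shows "twisted_Leibniz (\<xi> i)"
proof (rule twisted_Leibniz_W)
  fix n \<alpha> \<beta> assume \<alpha>: "\<alpha> \<in> W n"
  have "\<rho> (\<xi> i) (\<alpha> * \<beta>) = (\<Sum>j=1..N. \<Sum>k=1..N. iR j ((\<alpha> \<triangleleft> f j k) * (\<beta> \<triangleleft> f k i)))"
    using i by (simp add: \<rho>_xi ra_f_mult clinear_sum[OF iR_clinear])
  also have "\<dots> = (\<Sum>j=1..N. \<Sum>k=1..N. iR j (\<alpha> \<triangleleft> f j k) * (\<beta> \<triangleleft> f k i) +
      (-1) ^ n *\<^sub>C (\<Sum>m=1..N. L m j (\<alpha> \<triangleleft> f j k) * iR m (\<beta> \<triangleleft> f k i)))"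
    by (intro sum.cong HOL.refl iR_mult ra_f_W \<alpha>)
  also have "\<dots> = (\<Sum>k=1..N. (\<Sum>j=1..N. iR j (\<alpha> \<triangleleft> f j k)) * (\<beta> \<triangleleft> f k i)) +
      (-1) ^ n *\<^sub>C (\<Sum>k=1..N. \<Sum>m=1..N. (\<Sum>j=1..N. L m j (\<alpha> \<triangleleft> f j k)) * iR m (\<beta> \<triangleleft> f k i))"
  proof -
    have 1: "(\<Sum>j=1..N. \<Sum>k=1..N. iR j (\<alpha> \<triangleleft> f j k) * (\<beta> \<triangleleft> f k i)) =
        (\<Sum>k=1..N. \<Sum>j=1..N. iR j (\<alpha> \<triangleleft> f j k) * (\<beta> \<triangleleft> f k i))"
      by (rule sum.swap)
    have 2: "(\<Sum>j=1..N. \<Sum>k=1..N. \<Sum>m=1..N. L m j (\<alpha> \<triangleleft> f j k) * iR m (\<beta> \<triangleleft> f k i)) =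
        (\<Sum>k=1..N. \<Sum>m=1..N. \<Sum>j=1..N. L m j (\<alpha> \<triangleleft> f j k) * iR m (\<beta> \<triangleleft> f k i))"
      by (rule sum_swap3)
    show ?thesis
      by (simp only: sum.distrib complex_vector.scale_sum_right[symmetric] sum_distrib_right 1 2)
  qed
  also have "(\<Sum>k=1..N. (\<Sum>j=1..N. iR j (\<alpha> \<triangleleft> f j k)) * (\<beta> \<triangleleft> f k i)) =
      (\<Sum>k=1..N. \<rho> (\<xi> k) \<alpha> * \<rho> (\<iota> (f k i)) \<beta>)"
    using i by (simp add: \<rho>_xi \<rho>_f)
  also have "(\<Sum>k=1..N. \<Sum>m=1..N. (\<Sum>j=1..N. L m j (\<alpha> \<triangleleft> f j k)) * iR m (\<beta> \<triangleleft> f k i)) = \<alpha> * \<rho> (\<xi> i) \<beta>"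
  proof -
    have "(\<Sum>k=1..N. \<Sum>m=1..N. (\<Sum>j=1..N. L m j (\<alpha> \<triangleleft> f j k)) * iR m (\<beta> \<triangleleft> f k i)) =
        (\<Sum>k=1..N. \<Sum>m=1..N. (if m = k then 1 else 0) *\<^sub>C (\<alpha> * iR m (\<beta> \<triangleleft> f k i)))"
      by (intro sum.cong HOL.refl) (simp add: ra_f_T)
    also have "\<dots> = (\<Sum>k=1..N. \<alpha> * iR k (\<beta> \<triangleleft> f k i))"
      by (intro sum.cong HOL.refl) (simp only: sum_delta_scaleC finite_atLeastAtMost)
    also have "\<dots> = \<alpha> * \<rho> (\<xi> i) \<beta>"
      using i by (simp add: \<rho>_xi sum_distrib_left)
    finally show ?thesis .
  qed
  finally show "\<rho> (\<xi> i) (\<alpha> * \<beta>) = tensor_lift (twisted (n mod 2) \<alpha> \<beta>) (comul C (\<xi> i))"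
    using i by (simp add: comul_C lift_twisted_generator twisted_odd[OF xi_degree] twisted_even f_E \<rho>_one
        minus_one_power_mod_2 add.commute)
qed

lemma twisted_Leibniz_delta: "twisted_Leibniz \<delta>"
proof (rule twisted_Leibniz_W)
  fix n \<alpha> \<beta> assume \<alpha>: "\<alpha> \<in> W n"
  show "\<rho> \<delta> (\<alpha> * \<beta>) = tensor_lift (twisted (n mod 2) \<alpha> \<beta>) (comul C \<delta>)"
    using d_mult[OF \<alpha>, of \<beta>]
    by (simp add: comul_C clinear_add[OF tensor_lift(2)[OF twisted_bilinear]] tensor_lift(1)[OF twisted_bilinear]
        twisted_odd[OF delta_degree] minus_one_power_mod_2 twisted_one \<rho>_one \<rho>_delta complex_vector.scale_minus_right)
qed

lemma twisted_Leibniz_word: "set w \<subseteq> gens \<Longrightarrow> twisted_Leibniz (prod_list (map val w))"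
proof (induction w)
  case Nil
  show ?case using twisted_Leibniz_iota[OF bialgebra_E.one] by (simp add: iota_eps)
next
  case (Cons s w)
  have "twisted_Leibniz (val s)"
    using Cons.prems by (cases s) (auto intro: twisted_Leibniz_iota twisted_Leibniz_xi twisted_Leibniz_delta)
  then show ?case
    using twisted_Leibniz_mult[of "odds [s] mod 2" "val s" "odds w mod 2" "prod_list (map val w)"]
      word_degree[of "[s]"] word_degree[of w] Cons by simp
qed

lemma twisted_Leibniz: "twisted_Leibniz x"
  by (induction x rule: word_induct)
    (auto intro: twisted_Leibniz_add twisted_Leibniz_scale twisted_Leibniz_word)

section \<open>The action on the unit form\<close>

lemma \<rho>_iota_unit: "h \<in> E \<Longrightarrow> \<rho> (\<iota> h) 1 = counit C (\<iota> h) *\<^sub>C 1"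
proof (induction rule: bialgebra_E.induct)
  case (mult g h)
  then show ?case
    by (simp add: iota_conv \<rho>_mult[of 0 _ 0] iota_degree clinear_scale[OF \<rho>_app_clinear] scaleC_scaleC)
next
  case (add g h)
  show ?case
    unfolding iota_add[OF add.hyps]
    by (simp add: \<rho>_add add.IH clinear_add[OF H.counit_clinear] scaleC_add_left)
next
  case (scale g c)
  show ?case
    unfolding iota_scale[OF scale.hyps]
    by (simp add: \<rho>_scale scale.IH clinear_scale[OF H.counit_clinear] scaleC_scaleC)
qed (simp_all add: iota_eps \<rho>_one \<rho>_X \<rho>_f ra_one X_clinear f_clinear f_one counit_C)

lemma d_one: "d 1 = 0"
  using d_iA[of 1] by (simp add: clinear_0[OF iG_clinear])

lemma \<rho>_val_unit: "s \<in> gens \<Longrightarrow> \<rho> (val s) 1 = counit C (val s) *\<^sub>C 1"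
  by (cases s) (simp_all add: \<rho>_iota_unit \<rho>_xi \<rho>_delta counit_C ra_one f_clinear clinear_scale[OF iR_clinear] d_one)

lemma \<rho>_unit: "\<rho> x 1 = counit C x *\<^sub>C 1"
proof (induction x rule: word_induct)
  case (word w)
  then show ?case
  proof (induction w)
    case (Cons s w)
    let ?p = "odds [s] mod 2" and ?q = "odds w mod 2"
    have "\<rho> (val s * prod_list (map val w)) 1 =
        (-1) ^ (?p * ?q) *\<^sub>C \<rho> (prod_list (map val w)) (\<rho> (val s) 1)"
      using Cons.prems word_degree[of "[s]"] word_degree[of w] by (intro \<rho>_mult) auto
    also have "\<dots> = (-1) ^ (?p * ?q) *\<^sub>C (counit C (val s) * counit C (prod_list (map val w))) *\<^sub>C 1"
      using Cons by (simp add: \<rho>_val_unit clinear_scale[OF \<rho>_app_clinear] scaleC_scaleC)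
    also have "\<dots> = counit C (val s * prod_list (map val w)) *\<^sub>C 1"
    \<comment> \<open>For odd \<open>s\<close> both sides vanish with the counit of
      \<open>val s\<close>; for even \<open>s\<close> the exponent of the sign is 0.\<close>
    proof (cases "is_odd s")
      case True
      then have "counit C (val s) = 0"
        using Cons.prems word_degree[of "[s]"] by (intro counit_odd) (simp add: One_nat_def)
      then show ?thesis by simp
    qed simp
    finally show ?case by simp
  qed (simp add: \<rho>_one)
qed (simp_all add: \<rho>_add \<rho>_scale clinear_add[OF H.counit_clinear] clinear_scale[OF H.counit_clinear]
    scaleC_add_left scaleC_scaleC)

lemma module_algebra: "graded_right_module_algebra gr C V \<rho>"
  using \<rho>_is_action twisted_Leibniz \<rho>_unit
  unfolding graded_right_module_algebra_def is_action_def twisted_Leibniz_def twisted_def[abs_def] by blast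

end

theorem theorem3p6:
  fixes A :: "'a::complex_algebra_1 hopf_struct"
    and G :: "('a, 'g::complex_vector) calculus_struct"
    and N :: nat
    and \<omega> :: "nat \<Rightarrow> 'g"
    and f :: "nat \<Rightarrow> nat \<Rightarrow> 'a \<Rightarrow> complex"
    and J :: "nat \<Rightarrow> nat \<Rightarrow> 'a"
    and X :: "nat \<Rightarrow> 'a \<Rightarrow> complex"
    and P :: "(nat \<times> nat) set"
    and t :: "nat \<Rightarrow> nat \<Rightarrow> nat \<Rightarrow> nat \<Rightarrow> complex"
    and \<iota> :: "('a \<Rightarrow> complex) \<Rightarrow> 'c::complex_algebra_1"
    and \<xi> :: "nat \<Rightarrow> 'c"
    and \<delta> :: 'c
    and C :: "'c hopf_struct"
    and jA :: "'a \<Rightarrow> 't::complex_algebra_1"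
    and jG :: "'g \<Rightarrow> 't"
    and \<sigma> :: "'t \<Rightarrow> 't"
    and \<pi> :: "'t \<Rightarrow> 'w::complex_algebra_1"
    and d :: "'w \<Rightarrow> 'w"
    and \<Lambda> :: "'w \<Rightarrow> ('a, 'w) tensor"
    and iR :: "nat \<Rightarrow> 'w \<Rightarrow> 'w"
    and D :: "nat \<Rightarrow> 'c set"
    and W V :: "nat \<Rightarrow> 'w set"
  assumes "hopf_algebra A" and "bij (antipode A)"
    and "bicovariant_calculus A G"
    and "calculus_data A G N \<omega> f J X"
    and "S_compatible A N f X"
    and "kernel_coeffs N f J X P t"
    and "is_cartan_algebra A N f J X P t \<iota> \<xi> \<delta>"
    and "D = cartan_grading A N f X \<iota> \<xi> \<delta>"
    and "cartan_hopf_struct A N f X \<iota> \<xi> \<delta> C"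
    and "is_tensor_algebra G jA jG"
    and "is_braiding N \<omega> f J jA jG \<sigma>"
    and "is_exterior_algebra jA jG \<sigma> \<pi>"
    and "W = ext_degree jA jG \<pi>" and "V = ext_parity jA jG \<pi>"
    and "is_exterior_derivative G W (\<pi> \<circ> jA) (\<pi> \<circ> jG) d"
    and "is_ext_lcoact A (\<pi> \<circ> jA) d \<Lambda>"
    and "is_right_inner_derivative A G N \<omega> f J W (\<pi> \<circ> jA) (\<pi> \<circ> jG) \<Lambda> iR"
  shows "let is_action = (\<lambda>\<rho>.
      graded_anti_hom D V \<rho> \<and>
      (\<forall>j\<in>{1..N}. \<rho> (- inv (antipode C) (\<iota> (X j))) = LR1 A X \<Lambda> j) \<and>
      (\<forall>j\<in>{1..N}. \<forall>k\<in>{1..N}. \<rho> (inv (antipode C) (\<iota> (f j k))) = LR2 A f \<Lambda> j k) \<and>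
      (\<forall>j\<in>{1..N}. \<rho> (- inv (antipode C) (\<xi> j)) = iR j) \<and>
      \<rho> (inv (antipode C) \<delta>) = d)
    in (\<exists>!\<rho>. is_action \<rho>) \<and>
       (\<forall>\<rho>. is_action \<rho> \<longrightarrow> graded_right_module_algebra D C V \<rho>)"
proof -
  have hopf: "hopf_bij A"
    by (rule hopf_bij.intro) (fact assms)+
  have cartan: "cartan A G N \<omega> f J X jA jG \<pi> d \<Lambda> iR P t \<iota> \<xi> \<delta> C"
    using assms hopf
    by (intro cartan.intro exterior.intro calculus.intro calculus_axioms.intro exterior_axioms.intro
        cartan_axioms.intro) (auto simp: is_exterior_algebra_def)
  have D: "D = cartan_grading A N f X \<iota> \<xi> \<delta>" and V: "V = ext_parity jA jG \<pi>"
    by (fact assms)+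
  show ?thesis
    unfolding Let_def D V cartan.is_action_def[OF cartan, symmetric]
    using cartan.\<rho>_is_action[OF cartan] cartan.is_action_unique[OF cartan] cartan.module_algebra[OF cartan]
    by blast
qed

end
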